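(* Let $d\ge 2$ be an integer, let $\mathbf c\in\overline{\mathbb Q}(t)$ be a rational function, and for $\lambda\in\overline{\mathbb Q}$ let $\mathbf f_\lambda(z)=\frac{z^d+\lambda}{z}$. Then there is a constant $C$, depending only on $\mathbf c$ (and $d$), such that for every $\lambda\in\overline{\mathbb Q}$, $$\left|\widehat h_{\mathbf f_\lambda}(\mathbf c(\lambda))-\widehat h_{\mathbf f}(\mathbf c)\cdot h(\lambda)\right|\le C.$$
   Context: $h$ denotes the absolute logarithmic Weil height on $\mathbb P^1(\overline{\mathbb Q})$, and for $x\in\overline{\mathbb Q}$ we set $h(x)=h([x:1])$. For $\lambda\in\overline{\mathbb Q}$ and $x\in\mathbb P^1(\overline{\mathbb Q})$ the canonical height is $\widehat h_{\mathbf f_\lambda}(x)=\lim_{n\to\infty}h(\mathbf f_\lambda^n(x))/d^n$, where $\mathbf f_\lambda^n$ is the $n$-th iterate; $\mathbf c(\lambda)\in\mathbb P^1(\overline{\mathbb Q})$ is the value of $\mathbf c$ at $\lambda$ (equal to $\infty$ at a pole). On the generic fiber, $\mathbf f_t(z)=\frac{z^d+t}{z}\in\overline{\mathbb Q}(t)(z)$, and $\widehat h_{\mathbf f}(\mathbf c)=\lim_{n\to\infty}\deg_t(\mathbf f_t^n(\mathbf c(t)))/d^n$, where the degree of a rational function in $t$ is the maximum of the degrees of numerator and denominator in lowest terms. *)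

theory Defs
  imports "HOL-Analysis.Analysis" "HOL-Computational_Algebra.Computational_Algebra"
    "HOL-Computational_Algebra.Normalized_Fraction"
begin

text \<open>Algebraic numbers are modelled as algebraic complex numbers; points of
  P^1 over them as complex option with None = infinity.\<close>

text \<open>Minimal polynomial over Z: irreducible integer polynomial (hence primitive)
  with positive leading coefficient vanishing at x.\<close>
definition min_int_poly :: "complex \<Rightarrow> int poly" where
  "min_int_poly x = (SOME p. p \<noteq> 0 \<and> poly (map_poly of_int p) x = 0 \<and> irreducible p \<and> lead_coeff p > 0)"

definition mahler_measure :: "complex poly \<Rightarrow> real" where
  "mahler_measure p = norm (lead_coeff p) *
     (\<Prod>a\<in>{a. poly p a = 0}. max 1 (norm a) ^ order a p)"

definition weil_height :: "complex \<Rightarrow> real" where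
  "weil_height x = ln (mahler_measure (map_poly of_int (min_int_poly x))) / real (degree (min_int_poly x))"

fun height_P1 :: "complex option \<Rightarrow> real" where
  "height_P1 None = 0"
| "height_P1 (Some x) = weil_height x"

fun f_map :: "nat \<Rightarrow> complex \<Rightarrow> complex option \<Rightarrow> complex option" where
  "f_map d lam None = None"
| "f_map d lam (Some z) =
     (if z \<noteq> 0 then Some ((z ^ d + lam) / z)
      else if lam = 0 then Some (0 ^ (d - 1)) else None)"

definition canonical_height :: "nat \<Rightarrow> complex \<Rightarrow> complex option \<Rightarrow> real" where
  "canonical_height d lam x = lim (\<lambda>n. height_P1 ((f_map d lam ^^ n) x) / real d ^ n)"

text \<open>Value of the rational function p/q (lowest terms) at lambda; infinity at a pole.\<close>
definition rat_eval :: "complex poly \<Rightarrow> complex poly \<Rightarrow> complex \<Rightarrow> complex option" where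
  "rat_eval p q lam = (if poly q lam = 0 then None else Some (poly p lam / poly q lam))"

text \<open>Degree of a rational function: max of degrees of numerator and
  denominator in lowest terms (well defined since lowest terms are unique up to units).\<close>

text \<open>Generic fibre: the field Qbar(t) is represented inside C(t) = complex poly fract.\<close>
definition T_var :: "complex poly fract" where
  "T_var = to_fract [:0, 1:]"

definition rdeg :: "complex poly fract \<Rightarrow> nat" where
  "rdeg x = (SOME n. \<exists>a b. b \<noteq> 0 \<and> coprime a b \<and> x = to_fract a / to_fract b
                        \<and> n = max (degree a) (degree b))"

fun rdeg_P1 :: "complex poly fract option \<Rightarrow> nat" where
  "rdeg_P1 None = 0"
| "rdeg_P1 (Some x) = rdeg x"

fun gen_f_map :: "nat \<Rightarrow> complex poly fract option \<Rightarrow> complex poly fract option" where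
  "gen_f_map d None = None"
| "gen_f_map d (Some z) = (if z = 0 then None else Some ((z ^ d + T_var) / z))"

definition gen_canonical_height :: "nat \<Rightarrow> complex poly fract \<Rightarrow> real" where
  "gen_canonical_height d c = lim (\<lambda>n. real (rdeg_P1 ((gen_f_map d ^^ n) (Some c))) / real d ^ n)"

end

(* Write h for the Weil height and f(c) = A/B in lowest terms in Qbar(t), after one application of f. Then
   A(0) is nonzero and deg B < deg A; both properties persist under the iteration
   a' = a^d + t b^d, b' = a b^(d-1), so there is no cancellation and the canonical height of c
   on the generic fibre is exactly deg A / d.

   For a single parameter lambda the height of [a_n : b_n] is an average of the local terms
   log max(|a_n|_v, |b_n|_v) over all embeddings and all places of Q. In every place v the term is
   d^n (deg A log max(1, |lambda|_v) + O(log T_v)), where T_v bounds the coefficients of A and B, the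
   inverses of the outer coefficients of A and a Bezout relation of A and B, and the implied constant
   depends only on degrees: if lambda is v-adically small or large, the term a^d dominates t b^d up to a
   first time N; at that time log |lambda|_v is already O(d^N log T_v), so the crude estimate for a single step,
   which loses O(log |lambda|_v), is harmless from then on. Summing over v, the errors add up to
   d^n times the heights of finitely many fixed algebraic numbers. *)

theory Submission
  imports "Jordan_Normal_Form.Char_Poly" Defs
begin

section \<open>Polynomials over subfields of the complex numbers\<close>

text \<open>The constant must be uniform in lambda, although the number field containing lambda
  varies with it. So every local estimate uses a bound T_v built from a fixed finite set of
  algebraic numbers, while field and places may be chosen anew for each lambda and each n; only sums
  over the places, normalised by the degree, survive. The crude one-step bound loses a multiple of
  h(lambda): enough for the existence of the limit, too much for the theorem. The Weil height is
  given by Mahler measures, so the finite places have to be built. One extension of each p-adic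
  absolute value to all algebraic numbers is enough, because embeddings of the field produce the
  others. Gauss's lemma turns the leading coefficient in the Mahler measure into p-adic terms. At
  lambda = 0 the two forms of the map acquire a common zero and a cancelled factor t vanishes; this
  single parameter goes into the constant. The function c = 0 is treated apart, since f(0) is
  infinity.\<close>

definition is_subfield :: "complex set \<Rightarrow> bool" where
  "is_subfield K \<longleftrightarrow> 0 \<in> K \<and> 1 \<in> K \<and> (\<forall>x\<in>K. \<forall>y\<in>K. x + y \<in> K \<and> x * y \<in> K)
     \<and> (\<forall>x\<in>K. - x \<in> K \<and> inverse x \<in> K)"

definition polys_over :: "complex set \<Rightarrow> complex poly set" where
  "polys_over K = {f. \<forall>i. coeff f i \<in> K}"

lemma is_subfieldD:
  assumes "is_subfield K"
  shows "0 \<in> K" "1 \<in> K" "x \<in> K \<Longrightarrow> y \<in> K \<Longrightarrow> x + y \<in> K" "x \<in> K \<Longrightarrow> y \<in> K \<Longrightarrow> x * y \<in> K"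
    "x \<in> K \<Longrightarrow> - x \<in> K" "x \<in> K \<Longrightarrow> inverse x \<in> K"
    "x \<in> K \<Longrightarrow> y \<in> K \<Longrightarrow> x - y \<in> K" "x \<in> K \<Longrightarrow> y \<in> K \<Longrightarrow> x / y \<in> K"
  using assms unfolding is_subfield_def divide_inverse diff_conv_add_uminus by blast+

lemma is_subfield_Rats: "is_subfield \<rat>"
  by (auto simp: is_subfield_def)

context
  fixes K :: "complex set"
  assumes K: "is_subfield K"
begin

lemma subfield_sum: "(\<And>i. i \<in> I \<Longrightarrow> f i \<in> K) \<Longrightarrow> sum f I \<in> K"
  by (induction I rule: infinite_finite_induct) (auto intro: is_subfieldD[OF K])

lemma subfield_power: "x \<in> K \<Longrightarrow> x ^ n \<in> K"
  by (induction n) (auto intro: is_subfieldD[OF K])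

lemma subfield_of_nat: "of_nat n \<in> K"
  by (induction n) (auto intro: is_subfieldD[OF K])

lemma subfield_of_int: "of_int n \<in> K"
  by (cases n) (auto intro!: is_subfieldD[OF K] subfield_of_nat simp del: of_nat_Suc)

lemma Rats_subset_subfield: "\<rat> \<subseteq> K"
  by (auto elim!: Rats_cases' intro!: is_subfieldD(8)[OF K] subfield_of_int)

lemma polys_over_0: "0 \<in> polys_over K"
  and polys_over_1: "1 \<in> polys_over K"
  and polys_over_add: "f \<in> polys_over K \<Longrightarrow> g \<in> polys_over K \<Longrightarrow> f + g \<in> polys_over K"
  and polys_over_diff: "f \<in> polys_over K \<Longrightarrow> g \<in> polys_over K \<Longrightarrow> f - g \<in> polys_over K"
  and polys_over_uminus: "f \<in> polys_over K \<Longrightarrow> - f \<in> polys_over K"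
  and polys_over_smult: "a \<in> K \<Longrightarrow> f \<in> polys_over K \<Longrightarrow> Polynomial.smult a f \<in> polys_over K"
  and polys_over_monom: "a \<in> K \<Longrightarrow> monom a n \<in> polys_over K"
  and polys_over_mult: "f \<in> polys_over K \<Longrightarrow> g \<in> polys_over K \<Longrightarrow> f * g \<in> polys_over K"
  and polys_over_pCons: "a \<in> K \<Longrightarrow> f \<in> polys_over K \<Longrightarrow> pCons a f \<in> polys_over K"
  by (auto simp: polys_over_def coeff_mult coeff_pCons intro!: is_subfieldD[OF K] subfield_sum split: nat.split)

lemma polys_over_power: "f \<in> polys_over K \<Longrightarrow> f ^ n \<in> polys_over K"
  by (induction n) (auto intro: polys_over_1 polys_over_mult)

lemma polys_over_poly: "f \<in> polys_over K \<Longrightarrow> x \<in> K \<Longrightarrow> poly f x \<in> K"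
  unfolding poly_altdef
  by (intro subfield_sum is_subfieldD[OF K] subfield_power) (auto simp: polys_over_def)

lemma polys_over_pcompose: "f \<in> polys_over K \<Longrightarrow> g \<in> polys_over K \<Longrightarrow> pcompose f g \<in> polys_over K"
proof (induction f)
  case (pCons a p)
  have "a \<in> K" "p \<in> polys_over K"
    using pCons.prems(1) by (auto simp: polys_over_def coeff_pCons split: nat.splits dest: spec[of _ 0] spec[of _ "Suc _"])
  then show ?case using pCons
    by (auto simp: pcompose_pCons intro!: polys_over_add polys_over_mult polys_over_pCons polys_over_0)
qed (auto intro: polys_over_0)

lemma polys_over_coeff: "f \<in> polys_over K \<Longrightarrow> coeff f i \<in> K"
  by (simp add: polys_over_def)

text \<open>Long division uses only field operations on the coefficients, so it can be carried out
  over \<open>K\<close>. By uniqueness of quotient and remainder the result agrees with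
  \<open>div\<close> and \<open>mod\<close> for complex polynomials.\<close>

lemma polys_over_div_mod:
  assumes "f \<in> polys_over K" "g \<in> polys_over K"
  shows "f div g \<in> polys_over K \<and> f mod g \<in> polys_over K"
proof (cases "g = 0")
  case False
  have "\<exists>q r. q \<in> polys_over K \<and> r \<in> polys_over K \<and> f = q * g + r \<and> (r = 0 \<or> degree r < degree g)"
    using assms(1)
  proof (induction "degree f" arbitrary: f rule: less_induct)
    case (less f)
    show ?case
    proof (cases "f = 0 \<or> degree f < degree g")
      case True
      then show ?thesis using less.prems polys_over_0 by (intro exI[of _ 0] exI[of _ f]) auto
    next
      case nd: False
      define h where "h = monom (lead_coeff f / lead_coeff g) (degree f - degree g)"
      have h: "h \<in> polys_over K"
        unfolding h_def by (intro polys_over_monom is_subfieldD(8)[OF K] polys_over_coeff less.prems assms)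
      define f' where "f' = f - h * g"
      have f': "f' \<in> polys_over K"
        unfolding f'_def by (intro polys_over_diff polys_over_mult h less.prems assms)
      have dh: "degree (h * g) = degree f" "h * g \<noteq> 0"
        using False nd by (auto simp: h_def degree_mult_eq degree_monom_eq)
      have "lead_coeff (h * g) = lead_coeff f"
        using False nd by (simp add: h_def lead_coeff_mult degree_monom_eq)
      hence c: "coeff f' (degree f) = 0" using dh by (simp add: f'_def)
      have le: "degree f' \<le> degree f" unfolding f'_def using dh by (intro degree_diff_le) auto
      show ?thesis
      proof (cases "f' = 0")
        case True
        then show ?thesis using h polys_over_0 by (intro exI[of _ h] exI[of _ 0]) (auto simp: f'_def)
      next
        case f'0: False
        have "degree f' < degree f"
          using le c f'0 by (metis leading_coeff_0_iff order_le_imp_less_or_eq)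
        from less.hyps[OF this f'] obtain q r where qr: "q \<in> polys_over K" "r \<in> polys_over K" "f' = q * g + r"
          "r = 0 \<or> degree r < degree g" by blast
        then show ?thesis
          by (intro exI[of _ "q + h"] exI[of _ r]) (auto simp: f'_def algebra_simps intro: polys_over_add h)
      qed
    qed
  qed
  then obtain q r where qr: "q \<in> polys_over K" "r \<in> polys_over K" "f = q * g + r" "r = 0 \<or> degree r < degree g"
    by blast
  then have "r mod g = r" "r div g = 0" by (auto simp: mod_poly_less div_poly_less)
  then show ?thesis using qr(1-3) False by simp
qed (use assms polys_over_0 in auto)

text \<open>A nonzero combination of least degree with cofactors over \<open>K\<close> divides every
  other one, since a remainder would be a smaller combination.\<close>

lemma polys_over_bezout:
  assumes "f \<in> polys_over K" "g \<in> polys_over K" "f \<noteq> 0"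
  shows "\<exists>u v. u \<in> polys_over K \<and> v \<in> polys_over K \<and> u * f + v * g \<noteq> 0
           \<and> u * f + v * g dvd f \<and> u * f + v * g dvd g"
proof -
  define P where "P h \<longleftrightarrow> h \<noteq> 0 \<and> (\<exists>u v. u \<in> polys_over K \<and> v \<in> polys_over K \<and> h = u * f + v * g)" for h
  have ex: "P f" unfolding P_def
    by (rule conjI[OF assms(3)], rule exI[of _ 1], rule exI[of _ 0]) (simp add: polys_over_0 polys_over_1)
  define h where "h = (ARG_MIN degree h. P h)"
  have h: "P h" and hmin: "\<And>k. P k \<Longrightarrow> degree h \<le> degree k"
    unfolding h_def using arg_min_nat_lemma[where P = P and m = degree and k = f] ex by auto
  then obtain u v where uv: "u \<in> polys_over K" "v \<in> polys_over K" "h = u * f + v * g" "h \<noteq> 0"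
    by (auto simp: P_def)
  have hK: "h \<in> polys_over K" unfolding uv(3) by (intro polys_over_add polys_over_mult uv assms)
  have dvd: "h dvd k" if k: "k \<in> polys_over K" "k = a * f + b * g" "a \<in> polys_over K" "b \<in> polys_over K" for k a b
  proof (rule ccontr)
    assume nd: "\<not> h dvd k"
    define q where "q = k div h"
    have q: "q \<in> polys_over K" unfolding q_def using polys_over_div_mod[OF k(1) hK] by blast
    have m: "k mod h = (a - q * u) * f + (b - q * v) * g"
      using div_mult_mod_eq[of k h] k(2) uv(3) unfolding q_def[symmetric] by (simp add: algebra_simps)
    have ne: "k mod h \<noteq> 0" using nd by (simp add: dvd_eq_mod_eq_0)
    have "a - q * u \<in> polys_over K" "b - q * v \<in> polys_over K"
      by (intro polys_over_diff polys_over_mult k(3,4) q uv(1,2))+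
    then have "P (k mod h)" unfolding P_def using m ne by blast
    from hmin[OF this] degree_mod_less[OF uv(4), of k] ne show False by simp
  qed
  have "h dvd f" by (rule dvd[of f 1 0]) (auto intro: assms polys_over_0 polys_over_1)
  moreover have "h dvd g" by (rule dvd[of g 0 1]) (auto intro: assms polys_over_0 polys_over_1)
  ultimately show ?thesis using uv by blast
qed

end

lemma polys_over_mono: "K \<subseteq> L \<Longrightarrow> polys_over K \<subseteq> polys_over L"
  by (auto simp: polys_over_def)

section \<open>The ring of algebraic integers\<close>

text \<open>The Z-module generated by the family \<open>v\<close>. A number that maps such a nonzero
  module, finitely generated, into itself is an algebraic integer; this criterion makes sums and
  products accessible.\<close>

definition int_span :: "'i set \<Rightarrow> ('i \<Rightarrow> complex) \<Rightarrow> complex set" where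
  "int_span I v = range (\<lambda>c :: 'i \<Rightarrow> int. \<Sum>j\<in>I. of_int (c j) * v j)"

lemma int_spanI: "x = (\<Sum>j\<in>I. of_int (c j) * v j) \<Longrightarrow> x \<in> int_span I v"
  unfolding int_span_def by blast

lemma int_span_add: "x \<in> int_span I v \<Longrightarrow> y \<in> int_span I v \<Longrightarrow> x + y \<in> int_span I v"
proof -
  assume "x \<in> int_span I v" "y \<in> int_span I v"
  then obtain c d where "x = (\<Sum>j\<in>I. of_int (c j) * v j)" "y = (\<Sum>j\<in>I. of_int (d j) * v j)"
    by (auto simp: int_span_def)
  then have "x + y = (\<Sum>j\<in>I. of_int (c j + d j) * v j)"
    by (simp add: sum.distrib algebra_simps)
  then show ?thesis by (rule int_spanI)
qed

lemma int_span_of_int_mult: "x \<in> int_span I v \<Longrightarrow> of_int k * x \<in> int_span I v"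
proof -
  assume "x \<in> int_span I v"
  then obtain c where "x = (\<Sum>j\<in>I. of_int (c j) * v j)"
    by (auto simp: int_span_def)
  then have "of_int k * x = (\<Sum>j\<in>I. of_int (k * c j) * v j)"
    by (simp add: sum_distrib_left mult.assoc)
  then show ?thesis by (rule int_spanI)
qed

lemma int_span_0: "0 \<in> int_span I v"
  unfolding int_span_def by (rule image_eqI[of _ _ "\<lambda>_. 0"]) auto

lemma int_span_sum: "(\<And>i. i \<in> J \<Longrightarrow> f i \<in> int_span I v) \<Longrightarrow> sum f J \<in> int_span I v"
  by (induction J rule: infinite_finite_induct) (auto intro: int_span_0 int_span_add)

lemma int_span_base:
  assumes "finite I" "i \<in> I"
  shows "v i \<in> int_span I v"
proof -
  have "v i = (\<Sum>j\<in>I. of_int (if j = i then 1 else 0) * v j)"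
    using assms by (simp add: if_distrib[of of_int] if_distrib[of "\<lambda>x. x * _"] cong: if_cong)
  then show ?thesis by (rule int_spanI)
qed

lemma int_span_mult:
  assumes "\<And>i. i \<in> I \<Longrightarrow> z * v i \<in> int_span I v" "w \<in> int_span I v"
  shows "z * w \<in> int_span I v"
proof -
  obtain c where c: "w = (\<Sum>j\<in>I. of_int (c j) * v j)"
    using assms(2) by (auto simp: int_span_def)
  have "z * w = (\<Sum>j\<in>I. of_int (c j) * (z * v j))"
    by (simp add: c sum_distrib_left mult_ac)
  then show ?thesis by (auto intro!: int_span_sum int_span_of_int_mult assms(1))
qed

text \<open>\<open>v\<close> is an eigenvector of the integer matrix \<open>M\<close> for the
  eigenvalue \<open>z\<close>, and the characteristic polynomial of \<open>M\<close> is monic with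
  integer coefficients.\<close>

lemma algebraic_int_eigenvalue:
  fixes v :: "nat \<Rightarrow> complex" and M :: "nat \<Rightarrow> nat \<Rightarrow> int"
  assumes "\<And>i. i < n \<Longrightarrow> z * v i = (\<Sum>j<n. of_int (M i j) * v j)" and "i0 < n" "v i0 \<noteq> 0"
  shows "algebraic_int z"
proof -
  define A where "A = Matrix.mat n n (\<lambda>(i, j). M i j)"
  define B where "B = (map_mat of_int A :: complex Matrix.mat)"
  have A: "A \<in> carrier_mat n n" and B: "B \<in> carrier_mat n n" by (auto simp: A_def B_def)
  have "eigenvector B (Matrix.vec n v) z"
    unfolding eigenvector_def
  proof (intro conjI)
    show "Matrix.vec n v \<noteq> 0\<^sub>v (dim_row B)"
    proof
      assume "Matrix.vec n v = 0\<^sub>v (dim_row B)"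
      then have "vec_index (Matrix.vec n v) i0 = vec_index (0\<^sub>v (dim_row B)) i0" by simp
      then show False using assms(2,3) B by simp
    qed
    show "B *\<^sub>v Matrix.vec n v = z \<cdot>\<^sub>v Matrix.vec n v"
      by (rule eq_vecI)
         (auto simp: A_def B_def scalar_prod_def assms(1) atLeast0LessThan intro!: sum.cong)
  qed (use B in auto)
  then have "eigenvalue B z" unfolding eigenvalue_def by blast
  then have "poly (char_poly B) z = 0" using eigenvalue_root_char_poly[OF B] by simp
  moreover have "char_poly B = map_poly of_int (char_poly A)"
    unfolding B_def by (rule of_int_hom.char_poly_hom[OF A])
  ultimately show ?thesis
    unfolding algebraic_int_altdef_ipoly using degree_monic_char_poly[OF A] by auto
qed

lemma algebraic_int_int_span:
  assumes "finite I" "i0 \<in> I" "v i0 \<noteq> 0" "\<And>i. i \<in> I \<Longrightarrow> z * v i \<in> int_span I v"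
  shows "algebraic_int z"
proof -
  obtain h where h: "bij_betw h {..<card I} I"
    using ex_bij_betw_nat_finite[OF assms(1)] by (auto simp: atLeast0LessThan)
  have "\<forall>i\<in>I. \<exists>c :: _ \<Rightarrow> int. z * v i = (\<Sum>j\<in>I. of_int (c j) * v j)"
    using assms(4) by (auto simp: int_span_def)
  then obtain C :: "_ \<Rightarrow> _ \<Rightarrow> int" where C: "\<And>i. i \<in> I \<Longrightarrow> z * v i = (\<Sum>j\<in>I. of_int (C i j) * v j)"
    by metis
  obtain k where k: "k < card I" "h k = i0"
    using h assms(2) by (metis bij_betw_iff_bijections lessThan_iff)
  show ?thesis
  proof (rule algebraic_int_eigenvalue[where v = "v \<circ> h" and M = "\<lambda>i j. C (h i) (h j)" and n = "card I"])
    fix i assume "i < card I"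
    then have "h i \<in> I" using h by (auto simp: bij_betw_def)
    then show "z * (v \<circ> h) i = (\<Sum>j<card I. of_int (C (h i) (h j)) * (v \<circ> h) j)"
      by (simp add: C sum.reindex_bij_betw[OF h, of "\<lambda>j. of_int (C (h i) j) * v j"])
  next
    show "k < card I" "(v \<circ> h) k \<noteq> 0" using k assms(3) by auto
  qed
qed

lemma algebraic_int_power_int_span:
  assumes "algebraic_int x"
  obtains m where "m > 0" "x ^ m \<in> int_span {..<m} (\<lambda>i. x ^ i)"
proof -
  obtain p where p: "poly (map_poly of_int p) x = 0" "lead_coeff p = 1"
    using assms unfolding algebraic_int_altdef_ipoly by auto
  have "degree p > 0"
  proof (rule ccontr)
    assume "\<not> degree p > 0"
    then obtain c where "p = [:c:]" by (auto elim: degree_eq_zeroE)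
    then show False using p by simp
  qed
  moreover have "x ^ degree p = (\<Sum>i<degree p. of_int (- coeff p i) * x ^ i)"
  proof -
    have "0 = (\<Sum>i\<le>degree p. of_int (coeff p i) * x ^ i)"
      using p(1) by (simp add: poly_altdef degree_map_poly coeff_map_poly)
    also have "\<dots> = x ^ degree p + (\<Sum>i<degree p. of_int (coeff p i) * x ^ i)"
      using p(2) by (simp add: lessThan_Suc_atMost[symmetric])
    finally show ?thesis by (simp add: sum_negf eq_neg_iff_add_eq_0)
  qed
  then have "x ^ degree p \<in> int_span {..<degree p} (\<lambda>i. x ^ i)"
    by (rule int_spanI)
  ultimately show thesis by (rule that)
qed

text \<open>Only the top power can leave the span, and the monic relation brings it back. The factor
  \<open>z\<close> carries the powers of a second integer, so that the lemma serves both variables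
  of a product module.\<close>

lemma int_span_power_mult:
  assumes "x ^ m \<in> int_span {..<m} (\<lambda>i. x ^ i)" "i < m" "\<And>i. i < m \<Longrightarrow> x ^ i * z \<in> int_span I v"
  shows "x * (x ^ i * z) \<in> int_span I v"
proof (cases "Suc i < m")
  case True
  then show ?thesis using assms(3)[of "Suc i"] by (simp add: mult_ac)
next
  case False
  then have i: "m = Suc i" using assms(2) by simp
  obtain c where c: "x ^ m = (\<Sum>i<m. of_int (c i) * x ^ i)"
    using assms(1) by (auto simp: int_span_def)
  have "x * (x ^ i * z) = x ^ m * z" by (simp add: i)
  also have "\<dots> = (\<Sum>i<m. of_int (c i) * (x ^ i * z))"
    by (simp add: c sum_distrib_right mult.assoc)
  also have "\<dots> \<in> int_span I v"
    by (intro int_span_sum int_span_of_int_mult assms(3)) auto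
  finally show ?thesis .
qed

text \<open>The products \<open>x ^ i * y ^ j\<close> with exponents below the two degrees generate
  a module that both \<open>x\<close> and \<open>y\<close> map into itself.\<close>

lemma algebraic_int_add_mult:
  fixes x y :: complex
  assumes "algebraic_int x" "algebraic_int y"
  shows "algebraic_int (x + y) \<and> algebraic_int (x * y)"
proof -
  obtain m where m: "m > 0" "x ^ m \<in> int_span {..<m} (\<lambda>i. x ^ i)"
    using algebraic_int_power_int_span[OF assms(1)] .
  obtain n where n: "n > 0" "y ^ n \<in> int_span {..<n} (\<lambda>i. y ^ i)"
    using algebraic_int_power_int_span[OF assms(2)] .
  define I where "I = {..<m} \<times> {..<n}"
  define v where "v = (\<lambda>(i, j). x ^ i * y ^ j)"
  have fin: "finite I" by (simp add: I_def)
  have base: "x ^ i * y ^ j \<in> int_span I v" if "i < m" "j < n" for i j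
    using int_span_base[OF fin, of "(i, j)" v] that by (simp add: I_def v_def)
  have X: "x * v k \<in> int_span I v" and Y: "y * v k \<in> int_span I v" if "k \<in> I" for k
  proof -
    obtain i j where k: "k = (i, j)" by (cases k)
    then have ij: "i < m" "j < n" using that by (auto simp: I_def)
    have "x * (x ^ i * y ^ j) \<in> int_span I v"
      by (rule int_span_power_mult[OF m(2) ij(1) base[OF _ ij(2)]])
    then show "x * v k \<in> int_span I v" by (simp add: v_def k)
    have "y * (y ^ j * x ^ i) \<in> int_span I v"
      by (rule int_span_power_mult[OF n(2) ij(2)]) (use base[OF ij(1)] in \<open>simp add: mult.commute\<close>)
    then show "y * v k \<in> int_span I v" by (simp add: v_def k mult.commute)
  qed
  have "(0, 0) \<in> I" "v (0, 0) \<noteq> 0" using m n by (auto simp: I_def v_def)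
  moreover have "(x + y) * v k \<in> int_span I v" if "k \<in> I" for k
    using int_span_add[OF X[OF that] Y[OF that]] by (simp add: algebra_simps)
  moreover have "x * y * v k \<in> int_span I v" if "k \<in> I" for k
    using int_span_mult[OF X Y[OF that]] by (simp add: algebra_simps)
  ultimately show ?thesis using algebraic_int_int_span[OF fin] by blast
qed

lemma algebraic_int_plus [intro]: "algebraic_int x \<Longrightarrow> algebraic_int y \<Longrightarrow> algebraic_int (x + y :: complex)"
  and algebraic_int_times [intro]: "algebraic_int x \<Longrightarrow> algebraic_int y \<Longrightarrow> algebraic_int (x * y :: complex)"
  using algebraic_int_add_mult by blast+

lemma algebraic_int_power [intro]: "algebraic_int x \<Longrightarrow> algebraic_int (x ^ n :: complex)"
  by (induction n) auto

lemma algebraic_int_sum [intro]: "(\<And>i. i \<in> I \<Longrightarrow> algebraic_int (f i)) \<Longrightarrow> algebraic_int (sum f I :: complex)"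
  by (induction I rule: infinite_finite_induct) auto

text \<open>The algebraic integers are integrally closed, and \<open>x\<close> is a root of the
  monic polynomial T^n - x^n over them. Later this shows that the mixed terms of a binomial
  expansion are integral.\<close>

lemma algebraic_int_power_root:
  assumes "algebraic_int (x ^ n :: complex)" "n > 0"
  shows "algebraic_int x"
  by (rule algebraic_int_root[OF assms(1), of "monom 1 n"])
     (use assms(2) in \<open>auto simp: poly_monom degree_monom_eq\<close>)

text \<open>Multiplying a relation of degree n with leading coefficient \<open>a\<close> by a^(n-1)
  makes it monic in \<open>a * x\<close>; the exponent \<open>i\<close> below is n - 1.\<close>

lemma algebraic_imp_algebraic_int_multiple:
  assumes "algebraic (x :: complex)"
  obtains k :: int where "k > 0" "algebraic_int (of_int k * x)"
proof -
  obtain p where p: "p \<noteq> 0" "poly (map_poly of_int p) x = 0"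
    using algebraicE'[OF assms] .
  define n where "n = degree p"
  define a where "a = lead_coeff p"
  have a0: "a \<noteq> 0" using p by (simp add: a_def)
  have n0: "n > 0"
  proof (rule ccontr)
    assume "\<not> n > 0"
    then obtain c where "p = [:c:]" by (auto elim: degree_eq_zeroE simp: n_def)
    then show False using p by simp
  qed
  let ?x = "of_int a * x"
  have span: "?x ^ n \<in> int_span {..<n} (\<lambda>i. ?x ^ i)"
  proof -
    obtain i where n: "n = Suc i" using n0 by (cases n) auto
    have "0 = of_int (a ^ i) * (\<Sum>k\<le>n. of_int (coeff p k) * x ^ k)"
      using p(2) by (simp add: poly_altdef degree_map_poly coeff_map_poly n_def)
    also have "\<dots> = ?x ^ n + (\<Sum>k<n. of_int (a ^ i) * (of_int (coeff p k) * x ^ k))"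
      unfolding lessThan_Suc_atMost[symmetric] sum_distrib_left
      by (simp add: a_def[symmetric] n_def[symmetric] n power_mult_distrib mult_ac)
         (simp add: a_def n[symmetric] n_def)
    also have "(\<Sum>k<n. of_int (a ^ i) * (of_int (coeff p k) * x ^ k))
        = (\<Sum>k<n. of_int (a ^ (i - k) * coeff p k) * ?x ^ k)"
    proof (rule sum.cong[OF refl])
      fix k assume "k \<in> {..<n}"
      then have "a ^ i = a ^ (i - k) * a ^ k" using n by (simp flip: power_add)
      then show "of_int (a ^ i) * (of_int (coeff p k) * x ^ k) = of_int (a ^ (i - k) * coeff p k) * ?x ^ k"
        by (simp add: power_mult_distrib)
    qed
    finally have "?x ^ n = (\<Sum>k<n. of_int (- (a ^ (i - k) * coeff p k)) * ?x ^ k)"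
      by (simp add: sum_negf eq_neg_iff_add_eq_0)
    then show ?thesis by (rule int_spanI)
  qed
  have "algebraic_int ?x"
  proof (rule algebraic_int_int_span[where I = "{..<n}" and v = "\<lambda>i. ?x ^ i" and ?i0.0 = 0])
    fix i assume "i \<in> {..<n}"
    then show "?x * ?x ^ i \<in> int_span {..<n} (\<lambda>i. ?x ^ i)"
      using int_span_power_mult[OF span, of i 1 "{..<n}" "\<lambda>i. ?x ^ i"] int_span_base[of "{..<n}" _ "\<lambda>i. ?x ^ i"]
      by simp
  qed (use n0 in auto)
  then show thesis
  proof (cases "a > 0")
    case False
    assume "algebraic_int ?x"
    then have "algebraic_int (of_int (- a) * x)" by auto
    with False a0 show thesis by (intro that[of "- a"]) auto
  qed (rule that)
qed

lemma algebraic_int_multiple_imp_algebraic: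
  assumes "k \<noteq> 0" "algebraic (of_int k * x :: complex)"
  shows "algebraic x"
proof -
  obtain p where p: "\<forall>i. coeff p i \<in> \<int>" "p \<noteq> 0" "poly p (of_int k * x) = 0"
    using assms(2) unfolding algebraic_def by blast
  show ?thesis
  proof (rule algebraicI)
    show "poly (pcompose p [:0, of_int k:]) x = 0" using p(3) by (simp add: poly_pcompose mult.commute)
    show "pcompose p [:0, of_int k:] \<noteq> 0" using p(2) assms(1) by (simp add: pcompose_eq_0_iff)
    show "coeff (pcompose p [:0, of_int k:]) i \<in> \<int>" for i
      by (rule coeff_pcompose_semiring_closed) (auto simp: p(1) coeff_pCons split: nat.split)
  qed
qed

lemma algebraic_add_mult:
  assumes "algebraic (x :: complex)" "algebraic y"
  shows "algebraic (x + y) \<and> algebraic (x * y)"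
proof -
  obtain a where a: "a > 0" "algebraic_int (of_int a * x)"
    using algebraic_imp_algebraic_int_multiple[OF assms(1)] .
  obtain b where b: "b > 0" "algebraic_int (of_int b * y)"
    using algebraic_imp_algebraic_int_multiple[OF assms(2)] .
  have "algebraic_int (of_int b * (of_int a * x) + of_int a * (of_int b * y))"
    "algebraic_int ((of_int a * x) * (of_int b * y))"
    using a b by (auto intro!: algebraic_int_plus algebraic_int_times)
  then have "algebraic (of_int (a * b) * (x + y))" "algebraic (of_int (a * b) * (x * y))"
    by (auto simp: algebra_simps)
  then show ?thesis using a(1) b(1) algebraic_int_multiple_imp_algebraic[of "a * b"] by simp
qed

lemma is_subfield_algebraic: "is_subfield {x. algebraic x}"
  using algebraic_add_mult by (auto simp: is_subfield_def)

section \<open>Minimal polynomials and primitive elements\<close>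

lemma polys_over_Rats_imp_int_multiple:
  assumes "f \<in> polys_over \<rat>"
  shows "\<exists>c F. c > 0 \<and> Polynomial.smult (of_int c) f = map_poly of_int (F :: int poly)"
  using assms
proof (induction f)
  case 0
  then show ?case by (intro exI[of _ 1] exI[of _ 0]) auto
next
  case (pCons a f)
  have "a \<in> \<rat>" using polys_over_coeff[OF is_subfield_Rats pCons.prems, of 0] by simp
  then obtain m n where mn: "n > 0" "a = of_int m / of_int n" by (auto elim!: Rats_cases')
  have "coeff f i \<in> \<rat>" for i
    using polys_over_coeff[OF is_subfield_Rats pCons.prems, of "Suc i"] by simp
  then obtain c F where cF: "c > 0" "Polynomial.smult (of_int c) f = map_poly of_int (F :: int poly)"
    using pCons.IH by (auto simp: polys_over_def)
  have "Polynomial.smult (of_int (n * c)) (pCons a f)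
      = pCons (of_int (m * c)) (Polynomial.smult (of_int n) (Polynomial.smult (of_int c) f))"
    using mn by simp
  also have "\<dots> = map_poly of_int (pCons (m * c) (Polynomial.smult n F))"
    unfolding cF(2) by (simp add: map_poly_pCons poly_eq_iff coeff_map_poly coeff_pCons split: nat.split)
  finally show ?case using mn cF by (intro exI[of _ "n * c"] exI[of _ "pCons (m * c) (Polynomial.smult n F)"]) simp
qed

lemma map_poly_of_int_in_polys_over: "is_subfield K \<Longrightarrow> map_poly of_int F \<in> polys_over K"
  by (auto simp: polys_over_def coeff_map_poly subfield_of_int)

lemma map_poly_of_int_mult: "map_poly of_int (f * g) = (map_poly of_int f * map_poly of_int g :: complex poly)"
  by (simp add: poly_eq_iff coeff_map_poly coeff_mult)

lemma map_poly_of_int_smult: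
  "map_poly of_int (Polynomial.smult c f) = (Polynomial.smult (of_int c) (map_poly of_int f) :: complex poly)"
  by (simp add: poly_eq_iff coeff_map_poly)

lemma map_poly_of_int_eq_iff: "(map_poly of_int f :: complex poly) = map_poly of_int g \<longleftrightarrow> f = g"
  by (simp add: poly_eq_iff coeff_map_poly)

text \<open>An integer polynomial of least degree vanishing at \<open>x\<close> divides each
  rational one: a remainder, cleared of denominators, would be a smaller candidate. Passing to the
  primitive part prepares for Gauss's lemma.\<close>

lemma ex_primitive_minimal_poly:
  assumes "algebraic (x :: complex)"
  obtains p :: "int poly" where "p \<noteq> 0" "poly (map_poly of_int p) x = 0" "Polynomial.content p = 1" "degree p > 0"
    "\<forall>f\<in>polys_over \<rat>. poly f x = 0 \<longrightarrow> map_poly of_int p dvd f"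
proof -
  define P where "P q \<longleftrightarrow> q \<noteq> 0 \<and> poly (map_poly of_int q) x = 0" for q :: "int poly"
  have "\<exists>q. P q" using algebraicE'[OF assms] unfolding P_def by blast
  then obtain q where q: "P q" and qmin: "\<And>k. P k \<Longrightarrow> degree q \<le> degree k"
    using ex_has_least_nat[of P _ degree] by blast
  define p where "p = primitive_part q"
  have q0: "q \<noteq> 0" using q by (simp add: P_def)
  have qp: "q = Polynomial.smult (Polynomial.content q) p" by (simp add: p_def content_times_primitive_part)
  have p0: "p \<noteq> 0" using q0 by (simp add: p_def)
  have dp: "degree p = degree q" by (simp add: p_def)
  have cp: "Polynomial.content p = 1" using q0 by (simp add: p_def)
  have px: "poly (map_poly of_int p) x = 0"
  proof -
    have "poly (map_poly of_int (Polynomial.smult (Polynomial.content q) p)) x = 0"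
      using q qp by (simp add: P_def)
    then show ?thesis using q0 by (simp add: map_poly_of_int_smult)
  qed
  have dp0: "degree p > 0"
  proof (rule ccontr)
    assume "\<not> degree p > 0"
    then obtain c where "p = [:c:]" by (auto elim: degree_eq_zeroE)
    then show False using p0 px by simp
  qed
  have "map_poly of_int p dvd f" if f: "f \<in> polys_over \<rat>" "poly f x = 0" for f
  proof (rule ccontr)
    assume nd: "\<not> map_poly of_int p dvd f"
    let ?p = "map_poly of_int p :: complex poly"
    have pr: "?p \<in> polys_over \<rat>" by (rule map_poly_of_int_in_polys_over[OF is_subfield_Rats])
    have p0': "?p \<noteq> 0" using p0 map_poly_of_int_eq_iff[of p 0] by simp
    have "f mod ?p \<in> polys_over \<rat>" using polys_over_div_mod[OF is_subfield_Rats f(1) pr] by blast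
    then obtain c F where cF: "c > 0" "Polynomial.smult (of_int c) (f mod ?p) = map_poly of_int (F :: int poly)"
      using polys_over_Rats_imp_int_multiple by blast
    have ne: "f mod ?p \<noteq> 0" using nd by (simp add: dvd_eq_mod_eq_0)
    have "poly (f mod ?p) x = 0"
      using f(2) px by (metis add_0_left div_mult_mod_eq mult_zero_right poly_add poly_mult)
    then have "poly (map_poly of_int F) x = 0" unfolding cF(2)[symmetric] by simp
    moreover have "map_poly of_int F \<noteq> (0 :: complex poly)" unfolding cF(2)[symmetric] using cF(1) ne by simp
    ultimately have "P F" unfolding P_def by auto
    then have "degree q \<le> degree F" by (rule qmin)
    also have "degree F = degree (map_poly of_int F :: complex poly)" by (simp add: degree_map_poly)
    also have "\<dots> = degree (f mod ?p)" unfolding cF(2)[symmetric] using cF(1) by simp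
    also have "\<dots> < degree ?p" using degree_mod_less[OF p0', of f] ne by simp
    also have "\<dots> = degree q" by (simp add: degree_map_poly dp)
    finally show False by simp
  qed
  then show thesis using that p0 px cp dp0 by blast
qed

text \<open>\<open>min_int_poly\<close> is an arbitrary choice, so divisibility is shown for every
  irreducible integer polynomial vanishing at \<open>x\<close>. Gauss's lemma identifies
  \<open>g\<close> with the primitive minimal polynomial up to a unit.\<close>

lemma irreducible_int_poly_dvd:
  assumes "irreducible (g :: int poly)" "poly (map_poly of_int g) x = (0 :: complex)"
    "f \<in> polys_over \<rat>" "poly f x = 0"
  shows "map_poly of_int g dvd f"
proof -
  let ?c = "map_poly of_int :: int poly \<Rightarrow> complex poly"
  have g0: "g \<noteq> 0" using assms(1) by auto
  have "algebraic x"
    by (rule algebraicI[OF _ _ assms(2)]) (use g0 map_poly_of_int_eq_iff[of g 0] in \<open>auto simp: coeff_map_poly\<close>)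
  then obtain p :: "int poly" where p: "p \<noteq> 0" "Polynomial.content p = 1" "degree p > 0"
    "\<forall>f\<in>polys_over \<rat>. poly f x = 0 \<longrightarrow> ?c p dvd f"
    using ex_primitive_minimal_poly by metis
  have gr: "?c g \<in> polys_over \<rat>" and pr: "?c p \<in> polys_over \<rat>"
    by (rule map_poly_of_int_in_polys_over[OF is_subfield_Rats])+
  define h where "h = ?c g div ?c p"
  have h: "h \<in> polys_over \<rat>" unfolding h_def using polys_over_div_mod[OF is_subfield_Rats gr pr] by blast
  have gph: "?c g = ?c p * h" unfolding h_def using p(4) gr assms(2) by simp
  obtain c H where cH: "c > 0" "Polynomial.smult (of_int c) h = ?c H"
    using polys_over_Rats_imp_int_multiple[OF h] by blast
  have "?c (Polynomial.smult c g) = ?c (p * H)"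
    unfolding map_poly_of_int_mult map_poly_of_int_smult cH(2)[symmetric] gph by simp
  then have eq: "Polynomial.smult c g = p * H" using map_poly_of_int_eq_iff by blast
  \<comment> \<open>Contents are multiplicative and \<open>p\<close> is primitive, so the
    denominator \<open>c\<close> divides \<open>H\<close>: the factorisation of \<open>g\<close>
    takes place over the integers.\<close>
  have "Polynomial.content (Polynomial.smult c g) = Polynomial.content H"
    unfolding eq by (simp add: content_mult p(2))
  then have "c * Polynomial.content g = Polynomial.content H" using cH(1) by simp
  then have "c dvd Polynomial.content H" by (metis dvd_triv_left)
  then have "[:c:] dvd H" by (simp add: const_poly_dvd_iff_dvd_content)
  then obtain H' where H': "H = [:c:] * H'" by (auto elim: dvdE)
  have "Polynomial.smult c g = Polynomial.smult c (p * H')" using eq H' by simp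
  then have g: "g = p * H'" using cH(1) by (simp add: poly_eq_iff)
  have "\<not> p dvd 1"
    using p(3) by (auto simp: poly_dvd_1)
  then have "H' dvd 1" using assms(1) g unfolding irreducible_def by blast
  then obtain e where e: "H' * e = 1" by (auto elim!: dvdE)
  have "p = g * e" using e by (simp add: g mult.assoc)
  then have "?c p = ?c g * ?c e" by (simp add: map_poly_of_int_mult)
  then have "?c g dvd ?c p" by simp
  then show ?thesis using p(4) assms(3,4) dvd_trans by blast
qed

text \<open>Provides a witness for the choice in \<open>min_int_poly\<close>. Primitivity matters as
  much as minimality of the degree, because a constant other than 1 and -1 is a non-unit among
  integer polynomials.\<close>

lemma min_int_poly:
  assumes "algebraic x"
  shows "min_int_poly x \<noteq> 0" "poly (map_poly of_int (min_int_poly x)) x = 0"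
    "irreducible (min_int_poly x)" "lead_coeff (min_int_poly x) > 0"
proof -
  obtain p :: "int poly" where p: "p \<noteq> 0" "poly (map_poly of_int p) x = 0" "Polynomial.content p = 1" "degree p > 0"
    "\<forall>f\<in>polys_over \<rat>. poly f x = 0 \<longrightarrow> map_poly of_int p dvd f"
    using ex_primitive_minimal_poly[OF assms] .
  let ?c = "map_poly of_int :: int poly \<Rightarrow> complex poly"
  have unit: "b dvd 1" if ab: "p = a * b" "poly (?c a) x = 0" for a b
  proof -
    have ab0: "a \<noteq> 0" "b \<noteq> 0" using p(1) ab by auto
    have "?c p dvd ?c a" using p(5) map_poly_of_int_in_polys_over[OF is_subfield_Rats] ab(2) by blast
    then have "degree (?c p) \<le> degree (?c a)"
      using ab0 map_poly_of_int_eq_iff[of a 0] by (intro dvd_imp_degree_le) auto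
    then have "degree b = 0" using ab(1) ab0 by (simp add: degree_map_poly degree_mult_eq)
    then obtain c where c: "b = [:c:]" by (auto elim: degree_eq_zeroE)
    then have "[:c:] dvd p" using ab(1) by (metis dvd_triv_right)
    then have "c dvd 1" using p(3) by (simp add: const_poly_dvd_iff_dvd_content)
    then show ?thesis using c by (simp add: poly_dvd_1)
  qed
  have irr: "irreducible p"
    unfolding irreducible_def
  proof (intro conjI allI impI)
    fix a b assume ab: "p = a * b"
    then have "poly (?c a) x = 0 \<or> poly (?c b) x = 0" using p(2) by (simp add: map_poly_of_int_mult)
    then show "a dvd 1 \<or> b dvd 1" using unit[of a b] unit[of b a] ab by (auto simp: mult.commute)
  qed (use p in \<open>auto simp: poly_dvd_1\<close>)
  define q where "q = (if lead_coeff p > 0 then p else - p)"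
  have "q \<noteq> 0 \<and> poly (?c q) x = 0 \<and> irreducible q \<and> lead_coeff q > 0"
    using p irr map_poly_of_int_smult[of "-1" p] irreducible_mult_unit_left[of "-1" p] leading_coeff_0_iff[of p]
    by (auto simp: q_def not_less order_le_less simp del: leading_coeff_0_iff)
  then have "\<exists>p. p \<noteq> 0 \<and> poly (map_poly of_int p) x = 0 \<and> irreducible p \<and> lead_coeff p > 0" by blast
  from someI_ex[OF this] show "min_int_poly x \<noteq> 0" "poly (map_poly of_int (min_int_poly x)) x = 0"
    "irreducible (min_int_poly x)" "lead_coeff (min_int_poly x) > 0"
    unfolding min_int_poly_def by blast+
qed

definition min_poly :: "complex \<Rightarrow> complex poly" where
  "min_poly x = map_poly of_int (min_int_poly x)"

text \<open>The divisibility clause is stated for an arbitrary root \<open>y\<close>, since all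
  conjugates of \<open>x\<close> share its minimal polynomial.\<close>

lemma min_poly:
  assumes "algebraic x"
  shows "min_poly x \<in> polys_over \<rat>" "min_poly x \<noteq> 0" "poly (min_poly x) x = 0"
    "degree (min_poly x) = degree (min_int_poly x)" "degree (min_poly x) > 0"
    "poly (min_poly x) y = 0 \<Longrightarrow> f \<in> polys_over \<rat> \<Longrightarrow> poly f y = 0 \<Longrightarrow> min_poly x dvd f"
    "poly (min_poly x) y = 0 \<Longrightarrow> algebraic y"
proof -
  note m = min_int_poly[OF assms]
  show 0: "min_poly x \<in> polys_over \<rat>" "poly (min_poly x) x = 0" "degree (min_poly x) = degree (min_int_poly x)"
    using m by (simp_all add: min_poly_def map_poly_of_int_in_polys_over[OF is_subfield_Rats] degree_map_poly)
  show ne: "min_poly x \<noteq> 0" using m(1) map_poly_of_int_eq_iff[of "min_int_poly x" 0] by (simp add: min_poly_def)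
  show "degree (min_poly x) > 0"
  proof (rule ccontr)
    assume "\<not> degree (min_poly x) > 0"
    then obtain c where "min_poly x = [:c:]" by (auto elim: degree_eq_zeroE)
    then show False using ne 0(2) by simp
  qed
  show "poly (min_poly x) y = 0 \<Longrightarrow> f \<in> polys_over \<rat> \<Longrightarrow> poly f y = 0 \<Longrightarrow> min_poly x dvd f"
    unfolding min_poly_def by (rule irreducible_int_poly_dvd[OF m(3)])
  show "poly (min_poly x) y = 0 \<Longrightarrow> algebraic y"
    by (rule algebraicI[of "min_poly x"]) (use ne in \<open>auto simp: min_poly_def coeff_map_poly\<close>)
qed

section \<open>Simple extensions of the rationals and primitive elements\<close>

definition rat_adjoin :: "complex \<Rightarrow> complex set" where
  "rat_adjoin t = {poly f t | f. f \<in> polys_over \<rat>}"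

text \<open>For algebraic \<open>t\<close> the ring Q[t] is a field: if f(t) is nonzero, a greatest
  common divisor of f and the minimal polynomial does not vanish at \<open>t\<close>, hence is
  constant, and its Bezout relation inverts f(t).\<close>

lemma is_subfield_rat_adjoin:
  assumes "algebraic t"
  shows "is_subfield (rat_adjoin t)"
proof -
  note m = min_poly[OF assms]
  note R = is_subfield_Rats
  have "0 \<in> rat_adjoin t" "1 \<in> rat_adjoin t"
    unfolding rat_adjoin_def using polys_over_0[OF R] polys_over_1[OF R] by (force intro: exI[of _ 0] exI[of _ 1])+
  moreover have "x + y \<in> rat_adjoin t \<and> x * y \<in> rat_adjoin t"
    if xy: "x \<in> rat_adjoin t" "y \<in> rat_adjoin t" for x y
  proof -
    obtain f g where "x = poly f t" "y = poly g t" "f \<in> polys_over \<rat>" "g \<in> polys_over \<rat>"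
      using xy by (auto simp: rat_adjoin_def)
    then have "x + y = poly (f + g) t" "x * y = poly (f * g) t" "f + g \<in> polys_over \<rat>" "f * g \<in> polys_over \<rat>"
      by (auto intro: polys_over_add[OF R] polys_over_mult[OF R])
    then show ?thesis unfolding rat_adjoin_def by blast
  qed
  moreover have "- x \<in> rat_adjoin t" if "x \<in> rat_adjoin t" for x
    using that unfolding rat_adjoin_def by clarsimp (metis poly_minus polys_over_uminus[OF R])
  moreover have "inverse x \<in> rat_adjoin t" if xt: "x \<in> rat_adjoin t" for x
  proof (cases "x = 0")
    case False
    obtain f where f: "x = poly f t" "f \<in> polys_over \<rat>" using xt by (auto simp: rat_adjoin_def)
    obtain u v where uv: "u \<in> polys_over \<rat>" "v \<in> polys_over \<rat>"
      "u * min_poly t + v * f \<noteq> 0" "u * min_poly t + v * f dvd min_poly t" "u * min_poly t + v * f dvd f"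
      using polys_over_bezout[OF R m(1) f(2) m(2)] by blast
    define d where "d = u * min_poly t + v * f"
    have d: "d \<in> polys_over \<rat>" unfolding d_def
      by (intro polys_over_add[OF R] polys_over_mult[OF R] uv m f)
    have dt: "poly d t = poly v t * x" by (simp add: d_def m(3) f)
    have "poly d t \<noteq> 0"
      using uv(5) False unfolding f(1) d_def[symmetric] by (auto elim!: dvdE)
    obtain e where e: "min_poly t = d * e" using uv(4) unfolding d_def[symmetric] by (auto elim: dvdE)
    have e0: "e \<noteq> 0" using m(2) e by auto
    have "e = min_poly t div d" using e uv(3) unfolding d_def[symmetric] by simp
    then have er: "e \<in> polys_over \<rat>" using polys_over_div_mod[OF R m(1) d] by simp
    have "poly e t = 0" using m(3) e \<open>poly d t \<noteq> 0\<close> by simp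
    then have "min_poly t dvd e" by (rule m(6)[OF m(3) er])
    then have "degree (min_poly t) \<le> degree e" using e0 by (rule dvd_imp_degree_le)
    moreover have "degree (min_poly t) = degree d + degree e"
      unfolding e using uv(3) e0 unfolding d_def[symmetric] by (rule degree_mult_eq)
    ultimately have "degree d = 0" by simp
    then obtain c where c: "d = [:c:]" by (auto elim: degree_eq_zeroE)
    have "c \<in> \<rat>" using polys_over_coeff[OF R d, of 0] c by simp
    moreover have "inverse x = poly (Polynomial.smult (inverse c) v) t"
    proof -
      have pd: "poly d t = c" by (subst c) simp
      have c0: "c \<noteq> 0" using \<open>poly d t \<noteq> 0\<close> unfolding pd .
      then have "poly v t = c * inverse x" using pd False unfolding dt by (metis mult.assoc mult.right_neutral right_inverse)
      then show ?thesis using c0 by simp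
    qed
    moreover have "Polynomial.smult (inverse c) v \<in> polys_over \<rat>"
      using \<open>c \<in> \<rat>\<close> uv(2) by (intro polys_over_smult[OF R]) auto
    ultimately show ?thesis unfolding rat_adjoin_def by blast
  qed (use \<open>0 \<in> rat_adjoin t\<close> in simp)
  ultimately show ?thesis unfolding is_subfield_def by blast
qed

lemma rat_adjoin_self: "t \<in> rat_adjoin t"
  unfolding rat_adjoin_def
  by (rule CollectI, rule exI[of _ "[:0, 1:]"]) (auto simp: polys_over_def coeff_pCons split: nat.split)

lemma rat_adjoin_subset:
  assumes "algebraic t" "s \<in> rat_adjoin t"
  shows "rat_adjoin s \<subseteq> rat_adjoin t"
proof -
  note K = is_subfield_rat_adjoin[OF assms(1)]
  show ?thesis using polys_over_mono[OF Rats_subset_subfield[OF K]] polys_over_poly[OF K _ assms(2)]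
    by (auto simp: rat_adjoin_def[of s])
qed

text \<open>This lets \<open>b\<close> be recovered from a power of X - b by field operations, the
  exponent being invertible in characteristic 0.\<close>

lemma coeff_linear_power_pred: "coeff ([:a, 1:] ^ Suc k) k = of_nat (Suc k) * (a :: complex)"
proof (induction k)
  case (Suc k)
  have "coeff ([:a, 1:] ^ Suc k) (Suc k) = 1"
    using lead_coeff_power[of "[:a, 1:]" "Suc k"] degree_linear_power[of a "Suc k"] by simp
  then show ?case using Suc by (subst power_Suc) (simp add: algebra_simps del: power_Suc)
qed simp

text \<open>With \<open>f\<close>, \<open>g\<close> the minimal polynomials of \<open>a\<close>, \<open>b\<close> and \<open>t = a + c b\<close> for generic \<open>c\<close>, the greatest common
  divisor of \<open>g\<close> and \<open>f (t - c X)\<close> over \<open>\<rat>(t)\<close> is a power of \<open>X - b\<close>, so that \<open>b\<close> can be read off its second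
  coefficient.\<close>

lemma primitive_element:
  assumes "algebraic a" "algebraic b"
  obtains t where "algebraic t" "a \<in> rat_adjoin t" "b \<in> rat_adjoin t"
proof -
  define f where "f = min_poly a"
  define g where "g = min_poly b"
  note mf = min_poly[OF assms(1), folded f_def]
  note mg = min_poly[OF assms(2), folded g_def]
  \<comment> \<open>If a root z of \<open>g\<close> other than \<open>b\<close> made t - c z a root
    x of \<open>f\<close>, then c would be the slope (x - a) / (b - z). Avoiding these finitely many
    values leaves \<open>b\<close> as the only common root.\<close>
  define B where "B = (\<lambda>(x, y). (x - a) / (b - y)) ` ({x. poly f x = 0} \<times> {y. poly g y = 0})"
  have "finite B" unfolding B_def
    using poly_roots_finite[OF mf(2)] poly_roots_finite[OF mg(2)] by (intro finite_imageI finite_cartesian_product)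
  moreover have "infinite (range of_nat :: complex set)" by (intro range_inj_infinite) (simp add: inj_on_def)
  ultimately obtain n :: nat where n: "of_nat n \<notin> B" by (meson finite_subset image_subsetI)
  define c where "c = (of_nat n :: complex)"
  define t where "t = a + c * b"
  have ta: "algebraic t"
    using is_subfieldD[OF is_subfield_algebraic] assms by (simp add: t_def c_def)
  define K where "K = rat_adjoin t"
  have K: "is_subfield K" unfolding K_def by (rule is_subfield_rat_adjoin[OF ta])
  have cK: "c \<in> K" unfolding c_def by (rule subfield_of_nat[OF K])
  have tK: "t \<in> K" unfolding K_def by (rule rat_adjoin_self)
  have QK: "polys_over \<rat> \<subseteq> polys_over K" by (rule polys_over_mono[OF Rats_subset_subfield[OF K]])
  define F where "F = pcompose f [:t, - c:]"
  have FK: "F \<in> polys_over K" unfolding F_def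
    using mf(1) QK tK is_subfieldD(5)[OF K cK] by (intro polys_over_pcompose[OF K] polys_over_pCons[OF K] polys_over_0[OF K]) auto
  have gK: "g \<in> polys_over K" using mg(1) QK by auto
  obtain u v where uv: "u \<in> polys_over K" "v \<in> polys_over K" "u * g + v * F \<noteq> 0"
    "u * g + v * F dvd g" "u * g + v * F dvd F"
    using polys_over_bezout[OF K gK FK mg(2)] by blast
  define d where "d = u * g + v * F"
  have dK: "d \<in> polys_over K" unfolding d_def by (intro polys_over_add[OF K] polys_over_mult[OF K] uv FK gK)
  have "poly F b = 0" using mf(3) by (simp add: F_def poly_pcompose t_def mult.commute)
  then have db: "poly d b = 0" by (simp add: d_def mg(3))
  have roots: "z = b" if z: "poly d z = 0" for z
  proof (rule ccontr)
    assume ne: "z \<noteq> b"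
    have "poly g z = 0" "poly F z = 0" using uv(4,5) z unfolding d_def[symmetric] by (auto elim!: dvdE)
    then have "poly f (t - c * z) = 0" by (simp add: F_def poly_pcompose mult.commute)
    then have "(t - c * z - a) / (b - z) \<in> B" unfolding B_def using \<open>poly g z = 0\<close> by force
    also have "(t - c * z - a) / (b - z) = c" using ne by (simp add: t_def field_simps)
    finally show False using n c_def by simp
  qed
  have d0: "d \<noteq> 0" using uv(3) d_def by simp
  have "set_mset (proots d) \<subseteq> {b}" using roots d0 by auto
  then have "proots d = replicate_mset (degree d) b"
    by (metis set_mset_subset_singletonD size_proots_complex)
  then have dd: "d = Polynomial.smult (lead_coeff d) ([:-b, 1:] ^ degree d)"
    using complex_poly_decompose_multiset[of d] by simp
  have "degree d \<noteq> 0"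
  proof
    assume "degree d = 0"
    then obtain e where "d = [:e:]" by (auto elim: degree_eq_zeroE)
    then show False using d0 db by simp
  qed
  then obtain k where k: "degree d = Suc k" by (cases "degree d") auto
  have "coeff d k = lead_coeff d * (of_nat (Suc k) * (- b))"
    using arg_cong[OF dd, of "\<lambda>p. coeff p k"] unfolding coeff_smult k coeff_linear_power_pred by simp
  then have "b = - coeff d k / (lead_coeff d * of_nat (Suc k))"
    using d0 by (simp add: field_simps del: of_nat_Suc)
  also have "\<dots> \<in> K"
    by (intro is_subfieldD[OF K] polys_over_coeff[OF K dK] subfield_of_nat[OF K])
  finally have bK: "b \<in> K" .
  moreover have "a = t - c * b" by (simp add: t_def)
  then have "a \<in> K" using is_subfieldD[OF K] tK cK bK by auto
  ultimately show thesis using that ta unfolding K_def by blast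
qed

lemma primitive_element_finite:
  assumes "finite S" "\<And>s. s \<in> S \<Longrightarrow> algebraic s"
  obtains t where "algebraic t" "S \<subseteq> rat_adjoin t"
proof -
  have "\<exists>t. algebraic t \<and> S \<subseteq> rat_adjoin t"
    using assms
  proof (induction S)
    case (insert s S)
    then obtain r where r: "algebraic r" "S \<subseteq> rat_adjoin r" by auto
    obtain t where t: "algebraic t" "r \<in> rat_adjoin t" "s \<in> rat_adjoin t"
      using primitive_element[OF r(1)] insert.prems by blast
    then show ?case using rat_adjoin_subset[OF t(1,2)] r by blast
  qed (auto intro: exI[of _ 0])
  then show thesis using that by blast
qed

section \<open>Conjugates and embeddings\<close>

abbreviation root_poly :: "complex multiset \<Rightarrow> complex poly" where
  "root_poly X \<equiv> (\<Prod>x\<in>#X. [:-x, 1:])"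

abbreviation rev_root_poly :: "complex multiset \<Rightarrow> complex poly" where
  "rev_root_poly X \<equiv> (\<Prod>x\<in>#X. [:1, -x:])"

lemma root_poly_facts: "root_poly X \<noteq> 0" "degree (root_poly X) = size X"
  "proots (root_poly X) = X"
proof -
  show 0: "root_poly X \<noteq> 0" by (induction X) (auto simp del: mult_pCons_left)
  show 2: "proots (root_poly X) = X"
  proof (induction X)
    case (add x X)
    have "root_poly X \<noteq> 0" by (induction X) (auto simp del: mult_pCons_left)
    then show ?case using add by (simp add: proots_mult del: mult_pCons_left)
  qed simp
  show "degree (root_poly X) = size X" by (metis 2 size_proots_complex)
qed

lemma reflect_root_poly: "reflect_poly (root_poly X) = rev_root_poly X"
proof (induction X)
  case (add x X)
  have "reflect_poly [:-x, 1:] = [:1, -x:]" by (simp add: reflect_poly_def)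
  then show ?case using add by (simp add: reflect_poly_mult del: mult_pCons_left)
qed simp

text \<open>Both polynomials have the same coefficients in opposite order. The reversed one has
  constant term 1, where Newton's recursion starts.\<close>

lemma root_poly_in_Rats_iff: "root_poly X \<in> polys_over \<rat> \<longleftrightarrow> rev_root_poly X \<in> polys_over \<rat>"
proof -
  have c: "coeff (rev_root_poly X) i = (if i \<le> size X then coeff (root_poly X) (size X - i) else 0)" for i
    unfolding reflect_root_poly[symmetric] coeff_reflect_poly by (auto simp: root_poly_facts(2))
  show ?thesis
  proof
    assume "root_poly X \<in> polys_over \<rat>"
    then show "rev_root_poly X \<in> polys_over \<rat>" by (auto simp: polys_over_def c)
  next
    assume r: "rev_root_poly X \<in> polys_over \<rat>"
    have "coeff (root_poly X) i \<in> \<rat>" for i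
    proof (cases "i \<le> size X")
      case True
      then show ?thesis using polys_over_coeff[OF is_subfield_Rats r, of "size X - i"] by (simp add: c)
    next
      case False
      then show ?thesis by (simp add: coeff_eq_0 root_poly_facts(2))
    qed
    then show "root_poly X \<in> polys_over \<rat>" by (simp add: polys_over_def)
  qed
qed

text \<open>Newton's identities, as the logarithmic derivative of the product of the factors $1 - xT$.\<close>

lemma newton_identity:
  "of_nat (Suc n) * coeff (rev_root_poly X) (Suc n)
     = - (\<Sum>i\<le>n. coeff (rev_root_poly X) i * (\<Sum>x\<in>#X. x ^ Suc (n - i)))"
proof -
  define S where "S X = Abs_fps (\<lambda>k. \<Sum>x\<in>#X. x ^ Suc k)" for X :: "complex multiset"
  have "fps_deriv (fps_of_poly (rev_root_poly X)) = - fps_of_poly (rev_root_poly X) * S X"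
  proof (induction X)
    case empty
    then show ?case by (simp add: S_def fps_eq_iff)
  next
    case (add x X)
    let ?R = "fps_of_poly (rev_root_poly X)"
    let ?L = "fps_of_poly [:1, -x:]"
    define G where "G = Abs_fps (\<lambda>k. x ^ Suc k)"
    have L: "?L = 1 - fps_const x * fps_X"
      by (simp add: fps_eq_iff fps_of_poly_def coeff_pCons split: nat.split)
    have G: "?L * G = fps_const x"
    proof (rule fps_ext)
      fix n
      show "fps_nth (?L * G) n = fps_nth (fps_const x) n"
        unfolding L by (cases n) (auto simp: G_def algebra_simps)
    qed
    have S: "S (add_mset x X) = G + S X" by (simp add: S_def G_def fps_eq_iff)
    have dL: "fps_deriv ?L = - fps_const x" unfolding L by simp
    have "fps_deriv (fps_of_poly (rev_root_poly (add_mset x X))) = fps_deriv (?L * ?R)"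
      by (simp add: fps_of_poly_mult del: mult_pCons_left)
    also have "\<dots> = - fps_const x * ?R + ?L * (- ?R * S X)"
      by (simp only: fps_deriv_mult dL add) (simp add: algebra_simps)
    also have "\<dots> = - (?L * ?R) * (G + S X)"
      unfolding G[symmetric] by (simp add: algebra_simps)
    finally show ?case unfolding S by (simp add: fps_of_poly_mult del: mult_pCons_left)
  qed
  from arg_cong[OF this, of "\<lambda>F. fps_nth F n"] show ?thesis
    by (simp add: fps_mult_nth S_def atLeast0AtMost sum_negf del: of_nat_Suc power_Suc)
qed

text \<open>Newton's identities can be solved for one coefficient after the other, because the
  integer factor in front is invertible.\<close>

lemma power_sums_rational_imp:
  assumes "\<And>k. (\<Sum>x\<in>#X. x ^ k) \<in> \<rat>"
  shows "root_poly X \<in> polys_over \<rat>"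
proof -
  have "coeff (rev_root_poly X) n \<in> \<rat>" for n
  proof (induction n rule: less_induct)
    case (less n)
    show ?case
    proof (cases n)
      case 0
      have "poly (rev_root_poly X) 0 = 1" by (induction X) auto
      then show ?thesis using 0 by (simp add: poly_0_coeff_0)
    next
      case (Suc m)
      have "of_nat (Suc m) * coeff (rev_root_poly X) (Suc m) \<in> \<rat>"
        unfolding newton_identity
        by (intro Rats_minus_iff[THEN iffD2] subfield_sum[OF is_subfield_Rats] Rats_mult assms less) (auto simp: Suc)
      then have "of_nat (Suc m) * coeff (rev_root_poly X) (Suc m) / of_nat (Suc m) \<in> \<rat>"
        by (rule Rats_divide) (rule Rats_of_nat)
      then show ?thesis by (simp add: Suc del: of_nat_Suc)
    qed
  qed
  then show ?thesis unfolding root_poly_in_Rats_iff by (simp add: polys_over_def)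
qed

lemma root_poly_rational_imp_power_sums:
  assumes "root_poly X \<in> polys_over \<rat>"
  shows "(\<Sum>x\<in>#X. x ^ k) \<in> \<rat>"
proof (cases k)
  case 0
  then show ?thesis by simp
next
  case (Suc n)
  have R: "rev_root_poly X \<in> polys_over \<rat>" using assms root_poly_in_Rats_iff by blast
  have c: "coeff (rev_root_poly X) i \<in> \<rat>" for i using R by (simp add: polys_over_def)
  have c0: "coeff (rev_root_poly X) 0 = 1"
    by (simp flip: poly_0_coeff_0) (induction X, auto)
  have "(\<Sum>x\<in>#X. x ^ Suc n) \<in> \<rat>"
  proof (induction n rule: less_induct)
    case (less n)
    have split: "(\<Sum>i\<le>n. coeff (rev_root_poly X) i * (\<Sum>x\<in>#X. x ^ Suc (n - i)))
        = (\<Sum>x\<in>#X. x ^ Suc n) + (\<Sum>i\<in>{0<..n}. coeff (rev_root_poly X) i * (\<Sum>x\<in>#X. x ^ Suc (n - i)))"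
      by (subst sum.remove[of _ 0]) (auto simp: c0 atLeast0AtMost[symmetric] intro!: sum.cong)
    have "(\<Sum>x\<in>#X. x ^ Suc n) = - (of_nat (Suc n) * coeff (rev_root_poly X) (Suc n))
        - (\<Sum>i\<in>{0<..n}. coeff (rev_root_poly X) i * (\<Sum>x\<in>#X. x ^ Suc (n - i)))"
      unfolding newton_identity split by simp
    also have "\<dots> \<in> \<rat>"
      by (intro Rats_diff Rats_minus_iff[THEN iffD2] subfield_sum[OF is_subfield_Rats] Rats_mult less c) auto
    finally show ?case .
  qed
  then show ?thesis by (simp only: Suc)
qed

text \<open>Power sums replace general symmetric functions: those of the values of \<open>f\<close>
  are rational combinations of those of the roots of \<open>m\<close>.\<close>

lemma root_poly_image_rational:
  assumes "m \<in> polys_over \<rat>" "m \<noteq> 0" "f \<in> polys_over \<rat>"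
  shows "root_poly (image_mset (poly f) (proots m)) \<in> polys_over \<rat>"
proof (rule power_sums_rational_imp)
  fix k
  have "root_poly (proots m) = Polynomial.smult (inverse (lead_coeff m)) m"
    using assms(2) by (subst complex_poly_decompose_multiset[of m, symmetric], subst smult_smult) auto
  also have "\<dots> \<in> polys_over \<rat>"
    using polys_over_coeff[OF is_subfield_Rats assms(1)] by (intro polys_over_smult[OF is_subfield_Rats] assms) auto
  finally have ps: "(\<Sum>x\<in>#proots m. x ^ i) \<in> \<rat>" for i by (rule root_poly_rational_imp_power_sums)
  have fk: "f ^ k \<in> polys_over \<rat>" by (rule polys_over_power[OF is_subfield_Rats assms(3)])
  have "(\<Sum>x\<in>#image_mset (poly f) (proots m). x ^ k) = (\<Sum>x\<in>#proots m. \<Sum>i\<le>degree (f ^ k). coeff (f ^ k) i * x ^ i)"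
    by (simp add: image_mset.compositionality o_def poly_altdef[symmetric] poly_power)
  also have "\<dots> = (\<Sum>i\<le>degree (f ^ k). coeff (f ^ k) i * (\<Sum>x\<in>#proots m. x ^ i))"
  proof -
    have "(\<Sum>x\<in>#M. \<Sum>i\<le>n. c i * x ^ i) = (\<Sum>i\<le>n. c i * (\<Sum>x\<in>#M. x ^ i))"
      for M and n :: nat and c :: "nat \<Rightarrow> complex"
      by (induction M) (auto simp: sum.distrib distrib_left)
    then show ?thesis .
  qed
  also have "\<dots> \<in> \<rat>"
    using fk by (intro subfield_sum[OF is_subfield_Rats] Rats_mult ps) (auto simp: polys_over_def)
  finally show "(\<Sum>x\<in>#image_mset (poly f) (proots m). x ^ k) \<in> \<rat>" .
qed

text \<open>A monic rational polynomial whose roots are all conjugates of \<open>a\<close> is a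
  scalar multiple of a power of \<open>min_poly a\<close>. Splitting off one factor at a time shows
  that \<open>Y\<close> repeats the full multiset of conjugates.\<close>

lemma sum_over_conjugates:
  fixes F :: "complex \<Rightarrow> real"
  assumes "algebraic a" "root_poly Y \<in> polys_over \<rat>" "\<And>y. y \<in># Y \<Longrightarrow> poly (min_poly a) y = 0"
  shows "real (degree (min_poly a)) * (\<Sum>y\<in>#Y. F y) = real (size Y) * (\<Sum>x\<in>#proots (min_poly a). F x)"
  using assms(2,3)
proof (induction "size Y" arbitrary: Y rule: less_induct)
  case less
  note m = min_poly[OF assms(1)]
  show ?case
  proof (cases "Y = {#}")
    case False
    then obtain y where y: "y \<in># Y" by auto
    have "poly (root_poly Y) y = 0"
      using y set_count_proots[OF root_poly_facts(1), of Y] unfolding root_poly_facts(3) by blast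
    then have "min_poly a dvd root_poly Y" by (rule m(6)[OF less.prems(2)[OF y] less.prems(1)])
    then obtain h where h: "root_poly Y = min_poly a * h" by (elim dvdE)
    have h0: "h \<noteq> 0" using h root_poly_facts(1)[of Y] by (metis mult_zero_right)
    have "h = root_poly Y div min_poly a" unfolding h using m(2) by simp
    then have hr: "h \<in> polys_over \<rat>"
      using polys_over_div_mod[OF is_subfield_Rats less.prems(1) m(1)] by simp
    have "root_poly (image_mset (poly [:0, 1:]) (proots h)) \<in> polys_over \<rat>"
      by (rule root_poly_image_rational[OF hr h0])
         (auto simp: polys_over_def coeff_pCons split: nat.split)
    moreover have "poly [:0, 1:] = (\<lambda>x. x :: complex)" by (simp add: fun_eq_iff)
    ultimately have hp: "root_poly (proots h) \<in> polys_over \<rat>" by simp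
    have Y: "Y = proots (min_poly a) + proots h"
      using root_poly_facts(3)[of Y] proots_mult[OF m(2) h0] unfolding h by simp
    have sY: "size Y = degree (min_poly a) + size (proots h)"
      unfolding Y by (simp add: size_proots_complex)
    have IH: "real (degree (min_poly a)) * (\<Sum>y\<in>#proots h. F y) = real (size (proots h)) * (\<Sum>x\<in>#proots (min_poly a). F x)"
      by (rule less.hyps) (use sY m(5) hp less.prems(2) Y in auto)
    have "real (degree (min_poly a)) * (\<Sum>y\<in>#Y. F y) = real (degree (min_poly a)) * (\<Sum>y\<in>#proots (min_poly a). F y)
       + real (degree (min_poly a)) * (\<Sum>y\<in>#proots h. F y)"
      by (subst Y) (simp add: algebra_simps)
    also have "\<dots> = real (size Y) * (\<Sum>x\<in>#proots (min_poly a). F x)"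
      unfolding IH sY by (simp add: algebra_simps)
    finally show ?thesis .
  qed simp
qed

section \<open>Embeddings of a number field\<close>

definition is_embedding :: "complex set \<Rightarrow> (complex \<Rightarrow> complex) \<Rightarrow> bool" where
  "is_embedding K s \<longleftrightarrow> s 1 = 1 \<and> (\<forall>x\<in>K. \<forall>y\<in>K. s (x + y) = s x + s y \<and> s (x * y) = s x * s y)"

text \<open>\<open>K\<close> is Q(t) for a primitive element t, and the embeddings send t to its
  conjugates. The last clause is the link to Mahler measures: an average over the embeddings of
  \<open>K\<close> equals the average over the conjugates of the element, whatever its
  degree.\<close>

lemma ex_embeddings:
  assumes "finite S" "\<And>x. x \<in> S \<Longrightarrow> algebraic x"
  obtains K N and s :: "nat \<Rightarrow> complex \<Rightarrow> complex" where "is_subfield K" "S \<subseteq> K" "N > 0"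
    "\<And>x. x \<in> K \<Longrightarrow> algebraic x"
    "\<And>j. j < N \<Longrightarrow> is_embedding K (s j)"
    "\<And>j x. j < N \<Longrightarrow> x \<in> K \<Longrightarrow> poly (min_poly x) (s j x) = 0"
    "\<And>x F. x \<in> K \<Longrightarrow> real (degree (min_poly x)) * (\<Sum>j<N. F (s j x) :: real)
        = real N * (\<Sum>y\<in>#proots (min_poly x). F y)"
proof -
  obtain t where t: "algebraic t" "S \<subseteq> rat_adjoin t"
    using primitive_element_finite[OF assms] by blast
  note m = min_poly[OF t(1)]
  define K where "K = rat_adjoin t"
  have K: "is_subfield K" unfolding K_def by (rule is_subfield_rat_adjoin[OF t(1)])
  obtain ts where ts: "mset ts = proots (min_poly t)" using ex_mset by blast
  have root: "poly (min_poly t) r = 0" if "r \<in> set ts" for r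
  proof -
    have "set ts = {x. poly (min_poly t) x = 0}"
      unfolding set_mset_mset[symmetric] ts using m(2) by simp
    then show ?thesis using that by blast
  qed
  \<comment> \<open>An embedding evaluates a chosen polynomial expression in \<open>t\<close> at a
    conjugate of \<open>t\<close>; by \<open>transfer\<close> the value does not depend on the
    choice.\<close>
  define pick where "pick x = (SOME f. f \<in> polys_over \<rat> \<and> poly f t = x)" for x
  have pick: "pick x \<in> polys_over \<rat> \<and> poly (pick x) t = x" if "x \<in> K" for x
    unfolding pick_def by (rule someI_ex) (use that in \<open>auto simp: K_def rat_adjoin_def\<close>)
  have transfer: "poly f r = poly g r"
    if fg: "f \<in> polys_over \<rat>" "g \<in> polys_over \<rat>" "poly f t = poly g t" "r \<in> set ts" for f g r
  proof -
    have "min_poly t dvd f - g"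
      by (rule m(6)[OF m(3)]) (use fg polys_over_diff[OF is_subfield_Rats] in auto)
    then show ?thesis using root[OF fg(4)] by (auto elim!: dvdE simp: algebra_simps)
  qed
  define s where "s j x = poly (pick x) (ts ! j)" for j x
  define N where "N = length ts"
  have N: "N = degree (min_poly t)" unfolding N_def by (metis size_mset size_proots_complex ts)
  have emb: "is_embedding K (s j)" if "j < N" for j
  proof -
    have r: "ts ! j \<in> set ts" using that N_def by simp
    have "s j 1 = poly 1 (ts ! j)" unfolding s_def
      by (rule transfer[OF _ _ _ r]) (simp_all add: pick[OF is_subfieldD(2)[OF K]] polys_over_1[OF is_subfield_Rats])
    then have "s j 1 = 1" by simp
    moreover have "s j (x + y) = s j x + s j y \<and> s j (x * y) = s j x * s j y" if xy: "x \<in> K" "y \<in> K" for x y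
    proof -
      note px = pick[OF xy(1)] and py = pick[OF xy(2)]
      have "s j (x + y) = poly (pick x + pick y) (ts ! j)"
        unfolding s_def
        by (rule transfer[OF _ _ _ r]) (simp_all add: px py pick[OF is_subfieldD(3)[OF K xy]] polys_over_add[OF is_subfield_Rats])
      moreover have "s j (x * y) = poly (pick x * pick y) (ts ! j)"
        unfolding s_def
        by (rule transfer[OF _ _ _ r]) (simp_all add: px py pick[OF is_subfieldD(4)[OF K xy]] polys_over_mult[OF is_subfield_Rats])
      ultimately show ?thesis by (simp add: s_def)
    qed
    ultimately show ?thesis by (auto simp: is_embedding_def)
  qed
  have alg: "algebraic x" if "x \<in> K" for x
  proof -
    have "pick x \<in> polys_over {x. algebraic x}"
      using polys_over_mono[OF Rats_subset_subfield[OF is_subfield_algebraic]] pick[OF that] by blast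
    from polys_over_poly[OF is_subfield_algebraic this, of t] t(1) have "algebraic (poly (pick x) t)" by simp
    then show ?thesis using pick[OF that] by metis
  qed
  have conj: "poly (min_poly x) (s j x) = 0" if "j < N" "x \<in> K" for j x
  proof -
    have r: "ts ! j \<in> set ts" using that N_def by simp
    note px = pick[OF that(2)] and mx = min_poly[OF alg[OF that(2)]]
    have "poly (pcompose (min_poly x) (pick x)) (ts ! j) = poly 0 (ts ! j)"
      by (rule transfer[OF _ _ _ r])
        (simp_all add: px mx polys_over_pcompose[OF is_subfield_Rats] polys_over_0[OF is_subfield_Rats] poly_pcompose)
    then show ?thesis by (simp add: poly_pcompose s_def)
  qed
  have sum: "real (degree (min_poly x)) * (\<Sum>j<N. F (s j x)) = real N * (\<Sum>y\<in>#proots (min_poly x). F y)"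
    if x: "x \<in> K" for x and F :: "complex \<Rightarrow> real"
  proof -
    note px = pick[OF x]
    define Y where "Y = image_mset (poly (pick x)) (proots (min_poly t))"
    have Y': "Y = mset (map (poly (pick x)) ts)" by (simp add: Y_def ts[symmetric])
    have "real (degree (min_poly x)) * (\<Sum>y\<in>#Y. F y) = real (size Y) * (\<Sum>y\<in>#proots (min_poly x). F y)"
    proof (rule sum_over_conjugates[OF alg[OF x]])
      show "root_poly Y \<in> polys_over \<rat>" unfolding Y_def
        by (rule root_poly_image_rational) (use m px in auto)
      fix y assume "y \<in># Y"
      then obtain j where "j < N" "y = s j x" by (auto simp: Y' N_def s_def in_set_conv_nth)
      then show "poly (min_poly x) y = 0" using conj x by simp
    qed
    moreover have "(\<Sum>y\<in>#Y. F y) = (\<Sum>j<N. F (s j x))"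
      unfolding Y' N_def s_def mset_map[symmetric] sum_mset_sum_list
      by (simp add: sum_list_sum_nth atLeast0LessThan)
    moreover have "size Y = N" by (simp add: Y' N_def)
    ultimately show ?thesis by simp
  qed
  show thesis
    by (rule that[of K N s]) (use K t(2) m(5) N emb conj sum alg in \<open>auto simp: K_def\<close>)
qed

section \<open>Extending p-adic absolute values to the algebraic numbers\<close>

text \<open>A minimal seminorm is multiplicative, because \<open>g \<mapsto> lim N (f ^ n * g) / N f ^ n\<close> is a seminorm below \<open>N\<close>.
  The condition on \<open>N (p * x)\<close> keeps minimal seminorms from vanishing at \<open>p\<close>.\<close>

definition padic_seminorm :: "nat \<Rightarrow> (complex \<Rightarrow> real) \<Rightarrow> bool" where
  "padic_seminorm p N \<longleftrightarrow> (\<forall>x. \<not> algebraic_int x \<longrightarrow> N x = 0) \<and> N 1 = 1 \<and>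
     (\<forall>x. algebraic_int x \<longrightarrow> 0 \<le> N x \<and> N (of_nat p * x) = N x / p \<and> (\<forall>k. N (x ^ k) = N x ^ k)) \<and>
     (\<forall>x y. algebraic_int x \<longrightarrow> algebraic_int y \<longrightarrow> N (x + y) \<le> max (N x) (N y) \<and> N (x * y) \<le> N x * N y)"

lemma le_mult_cInf:
  fixes A B :: "real set"
  assumes "A \<noteq> {}" "B \<noteq> {}" "\<And>a. a \<in> A \<Longrightarrow> 0 \<le> a" "\<And>b. b \<in> B \<Longrightarrow> 0 \<le> b"
    and le: "\<And>a b. a \<in> A \<Longrightarrow> b \<in> B \<Longrightarrow> c \<le> a * b"
  shows "c \<le> Inf A * Inf B"
proof -
  have *: "c \<le> a * Inf B" if a: "a \<in> A" for a
  proof (cases "a = 0")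
    case True
    then show ?thesis using le[OF a] assms(2) by auto
  next
    case False
    then have "a > 0" using assms(3)[OF a] by simp
    then have "c / a \<le> Inf B" using le[OF a] by (intro cInf_greatest assms) (simp add: field_simps)
    then show ?thesis using \<open>a > 0\<close> by (simp add: field_simps)
  qed
  have B: "0 \<le> Inf B" using assms by (intro cInf_greatest)
  show ?thesis
  proof (cases "Inf B = 0")
    case True
    then show ?thesis using * assms(1) by auto
  next
    case False
    then have "Inf B > 0" using B by simp
    then have "c / Inf B \<le> Inf A" using * by (intro cInf_greatest assms) (simp add: field_simps)
    then show ?thesis using \<open>Inf B > 0\<close> by (simp add: field_simps)
  qed
qed

text \<open>Three constructions of seminorms, all as pointwise infima of sets of candidate values, are
  instances of the following lemma: the spectral seminorm, the lower bound of a chain and the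
  localisation of a seminorm at an element.\<close>

lemma padic_seminorm_Inf:
  fixes S :: "complex \<Rightarrow> real set"
  assumes p: "p > 0"
    and ne: "\<And>x. algebraic_int x \<Longrightarrow> S x \<noteq> {}"
    and nonneg: "\<And>x r. algebraic_int x \<Longrightarrow> r \<in> S x \<Longrightarrow> 0 \<le> r"
    and one: "\<And>r. r \<in> S 1 \<Longrightarrow> r = 1"
    and add: "\<And>x y r s. algebraic_int x \<Longrightarrow> algebraic_int y \<Longrightarrow> r \<in> S x \<Longrightarrow> s \<in> S y \<Longrightarrow> \<exists>t\<in>S (x + y). t \<le> max r s"
    and mult: "\<And>x y r s. algebraic_int x \<Longrightarrow> algebraic_int y \<Longrightarrow> r \<in> S x \<Longrightarrow> s \<in> S y \<Longrightarrow> \<exists>t\<in>S (x * y). t \<le> r * s"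
    and pow: "\<And>x r k. algebraic_int x \<Longrightarrow> k > 0 \<Longrightarrow> r \<in> S (x ^ k) \<Longrightarrow> \<exists>t\<in>S x. t ^ k \<le> r"
    and p1: "\<And>x r. algebraic_int x \<Longrightarrow> r \<in> S x \<Longrightarrow> \<exists>t\<in>S (of_nat p * x). t \<le> r / p"
    and p2: "\<And>x r. algebraic_int x \<Longrightarrow> r \<in> S (of_nat p * x) \<Longrightarrow> \<exists>t\<in>S x. t \<le> p * r"
  shows "padic_seminorm p (\<lambda>x. if algebraic_int x then Inf (S x) else 0)"
proof -
  define N where "N x = (if algebraic_int x then Inf (S x) else 0)" for x
  have bdd: "bdd_below (S x)" if "algebraic_int x" for x using nonneg[OF that] by (meson bdd_belowI)
  have lower: "N x \<le> r" if "algebraic_int x" "r \<in> S x" for x r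
    unfolding N_def using that cInf_lower[OF that(2) bdd] by simp
  have lower': "N x \<le> c" if "algebraic_int x" "\<exists>t\<in>S x. t \<le> c" for x c
    using lower that by force
  have greatest: "c \<le> N x" if "algebraic_int x" "\<And>r. r \<in> S x \<Longrightarrow> c \<le> r" for x c
    unfolding N_def using that cInf_greatest[OF ne] by simp
  have N0: "0 \<le> N x" if "algebraic_int x" for x using greatest nonneg that by blast
  have ai1: "algebraic_int (1 :: complex)" by simp
  obtain r1 where "r1 \<in> S 1" using ne[OF ai1] by auto
  then have N1: "N 1 = 1"
    using lower[OF ai1, of r1] greatest[OF ai1, of 1] one by force
  have Nmult: "N (x * y) \<le> N x * N y" if xy: "algebraic_int x" "algebraic_int y" for x y
  proof -
    have "N (x * y) \<le> Inf (S x) * Inf (S y)"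
      by (intro le_mult_cInf ne nonneg xy lower' algebraic_int_times mult) (use xy in auto)
    then show ?thesis using xy by (simp add: N_def)
  qed
  have Nadd: "N (x + y) \<le> max (N x) (N y)" if xy: "algebraic_int x" "algebraic_int y" for x y
  proof (rule ccontr)
    assume "\<not> N (x + y) \<le> max (N x) (N y)"
    then have lt: "Inf (S x) < N (x + y)" "Inf (S y) < N (x + y)" using xy by (auto simp: N_def)
    obtain r where r: "r \<in> S x" "r < N (x + y)" using cInf_lessD[OF ne[OF xy(1)] lt(1)] by blast
    obtain s where s: "s \<in> S y" "s < N (x + y)" using cInf_lessD[OF ne[OF xy(2)] lt(2)] by blast
    have "N (x + y) \<le> max r s" by (intro lower' algebraic_int_plus add xy r s)
    then show False using r s by simp
  qed
  have Npow: "N (x ^ k) = N x ^ k" if x: "algebraic_int x" for x k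
  proof (rule antisym)
    show "N (x ^ k) \<le> N x ^ k"
    proof (induction k)
      case (Suc k)
      have "N (x ^ Suc k) \<le> N x * N (x ^ k)" using Nmult[OF x algebraic_int_power[OF x]] by simp
      also have "\<dots> \<le> N x * N x ^ k" using Suc N0[OF x] by (intro mult_left_mono)
      finally show ?case by simp
    qed (simp add: N1)
    show "N x ^ k \<le> N (x ^ k)"
    proof (cases "k = 0")
      case False
      show ?thesis
      proof (rule greatest)
        fix r assume "r \<in> S (x ^ k)"
        then obtain t where t: "t \<in> S x" "t ^ k \<le> r" using pow[OF x] False by blast
        have "N x ^ k \<le> t ^ k" using lower[OF x t(1)] N0[OF x] by (intro power_mono)
        then show "N x ^ k \<le> r" using t by simp
      qed (use x in auto)
    qed (simp add: N1)
  qed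
  have Np: "N (of_nat p * x) = N x / p" if x: "algebraic_int x" for x
  proof (rule antisym)
    have px: "algebraic_int (of_nat p * x)" using x by auto
    have "p * N (of_nat p * x) \<le> N x"
    proof (rule greatest[OF x])
      fix r assume "r \<in> S x"
      then have "N (of_nat p * x) \<le> r / p" by (intro lower'[OF px] p1 x)
      then show "p * N (of_nat p * x) \<le> r" using p by (simp add: field_simps)
    qed
    then show "N (of_nat p * x) \<le> N x / p" using p by (simp add: field_simps)
    show "N x / p \<le> N (of_nat p * x)"
    proof (rule greatest[OF px])
      fix r assume "r \<in> S (of_nat p * x)"
      then have "N x \<le> p * r" by (intro lower'[OF x] p2 x)
      then show "N x / p \<le> r" using p by (simp add: field_simps)
    qed
  qed
  have "padic_seminorm p N"
    unfolding padic_seminorm_def using N0 N1 Nmult Nadd Npow Np by (simp add: N_def)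
  then show ?thesis by (simp add: N_def[abs_def])
qed

text \<open>The spectral seminorm of the p-adic filtration on the ring O of algebraic integers: the
  infimum of p^(-m/k) over all m and k > 0 with x^k in p^m O. Admitting all powers k makes it
  power-multiplicative.\<close>

lemma ex_padic_seminorm:
  assumes p: "p > (1 :: nat)"
  shows "\<exists>N. padic_seminorm p N"
proof -
  define S where "S x = {(1 / p) powr (m / k) | m k :: nat. k > 0 \<and> algebraic_int (x ^ k / of_nat p ^ m)}"
    for x :: complex
  have SI: "k > 0 \<Longrightarrow> algebraic_int (x ^ k / of_nat p ^ m) \<Longrightarrow> (1 / p) powr (real m / real k) \<in> S x" for x k m
    unfolding S_def by blast
  have common: "\<exists>m m' k. k > 0 \<and> r = (1 / p) powr (m / k) \<and> s = (1 / p) powr (m' / k) \<and>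
      algebraic_int (x ^ k / of_nat p ^ m) \<and> algebraic_int (y ^ k / of_nat p ^ m')"
    if rs: "r \<in> S x" "s \<in> S y" for x y r s
  proof -
    obtain m k :: nat where 1: "k > 0" "r = (1 / p) powr (m / k)" "algebraic_int (x ^ k / of_nat p ^ m)"
      using rs(1) by (auto simp: S_def)
    obtain m' k' :: nat where 2: "k' > 0" "s = (1 / p) powr (m' / k')" "algebraic_int (y ^ k' / of_nat p ^ m')"
      using rs(2) by (auto simp: S_def)
    have "algebraic_int ((x ^ k / of_nat p ^ m) ^ k')" "algebraic_int ((y ^ k' / of_nat p ^ m') ^ k)"
      using 1 2 by blast+
    then have "algebraic_int (x ^ (k * k') / of_nat p ^ (m * k'))" "algebraic_int (y ^ (k * k') / of_nat p ^ (m' * k))"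
      by (simp_all add: power_divide power_mult[symmetric] mult.commute)
    moreover have "real m / k = real (m * k') / real (k * k')" "real m' / k' = real (m' * k) / real (k * k')"
      using 1 2 by (auto simp: field_simps)
    ultimately show ?thesis using 1 2 by (intro exI[of _ "m * k'"] exI[of _ "m' * k"] exI[of _ "k * k'"]) auto
  qed
  have less: "algebraic_int (z / of_nat p ^ m')" if z: "algebraic_int (z / of_nat p ^ m)" and le: "m' \<le> m" for z :: complex and m m'
  proof -
    obtain e where "m = m' + e" using le by (metis le_Suc_ex)
    then have "z / of_nat p ^ m' = z / of_nat p ^ m * of_nat p ^ (m - m')"
      using p by (simp add: power_add)
    then show ?thesis using algebraic_int_times[OF z, of "of_nat p ^ (m - m')"] by (simp add: algebraic_int_power)
  qed
  have "padic_seminorm p (\<lambda>x. if algebraic_int x then Inf (S x) else 0)"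
  proof (rule padic_seminorm_Inf)
    fix x :: complex assume x: "algebraic_int x"
    have "(1 / p) powr (real 0 / real 1) \<in> S x" by (intro SI) (use x in auto)
    then have one: "1 \<in> S x" using p by simp
    then show "S x \<noteq> {}" by auto
    show "0 \<le> r" if "r \<in> S x" for r using that by (auto simp: S_def)
    fix r
    show "\<exists>t\<in>S (of_nat p * x). t \<le> r / p" if r: "r \<in> S x"
    proof -
      obtain m k :: nat where 1: "k > 0" "r = (1 / p) powr (m / k)" "algebraic_int (x ^ k / of_nat p ^ m)"
        using r by (auto simp: S_def)
      have "(of_nat p * x) ^ k / of_nat p ^ (m + k) = x ^ k / of_nat p ^ m"
        using p by (simp add: power_mult_distrib power_add)
      then have "(1 / p) powr (real (m + k) / k) \<in> S (of_nat p * x)" using 1 by (intro SI) simp_all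
      moreover have "(1 / p) powr (real (m + k) / k) = r / p"
        using 1 p by (simp add: add_divide_distrib powr_add)
      ultimately show ?thesis by auto
    qed
    show "\<exists>t\<in>S x. t \<le> p * r" if r: "r \<in> S (of_nat p * x)"
    proof -
      obtain m k :: nat where 1: "k > 0" "r = (1 / p) powr (m / k)" "algebraic_int ((of_nat p * x) ^ k / of_nat p ^ m)"
        using r by (auto simp: S_def)
      show ?thesis
      proof (cases "m \<ge> k")
        case True
        have "(of_nat p * x) ^ k / of_nat p ^ m = x ^ k / of_nat p ^ (m - k)"
          using p True by (simp add: power_mult_distrib field_simps flip: power_add)
        then have "(1 / p) powr (real (m - k) / k) \<in> S x" using 1 by (intro SI) simp_all
        moreover have "(1 / p) powr (real (m - k) / k) = p * r"
          using 1 p True by (simp add: of_nat_diff diff_divide_distrib powr_diff)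
        ultimately show ?thesis by auto
      next
        case False
        \<comment> \<open>For m < k the value is at least 1/p, and then the trivial candidate 1,
          coming from m = 0, is already small enough.\<close>
        have "(1 / p) powr 1 \<le> (1 / p) powr (m / k)"
          using False p by (intro powr_mono') auto
        then have "1 \<le> p * r" using 1 p by (simp add: field_simps)
        then show ?thesis using one by auto
      qed
    qed
    show "\<exists>t\<in>S x. t ^ j \<le> r" if r: "r \<in> S (x ^ j)" and j: "j > 0" for j
    proof -
      obtain m k :: nat where 1: "k > 0" "r = (1 / p) powr (m / k)" "algebraic_int ((x ^ j) ^ k / of_nat p ^ m)"
        using r by (auto simp: S_def)
      have "(1 / p) powr (m / real (j * k)) \<in> S x"
        using 1 j by (intro SI) (simp_all add: power_mult)
      moreover have "((1 / p) powr (m / real (j * k))) ^ j = r"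
        using 1 j p by (simp add: powr_realpow[symmetric] powr_powr)
      ultimately show ?thesis by auto
    qed
    fix y :: complex and s assume y: "algebraic_int y" and rs: "r \<in> S x" "s \<in> S y"
    from common[OF rs] obtain m m' k :: nat where c: "k > 0" "r = (1 / p) powr (m / k)" "s = (1 / p) powr (m' / k)"
      "algebraic_int (x ^ k / of_nat p ^ m)" "algebraic_int (y ^ k / of_nat p ^ m')" by blast
    show "\<exists>t\<in>S (x * y). t \<le> r * s"
    proof -
      have "algebraic_int ((x ^ k / of_nat p ^ m) * (y ^ k / of_nat p ^ m'))" using c by blast
      then have "algebraic_int ((x * y) ^ k / of_nat p ^ (m + m'))" by (simp add: power_mult_distrib power_add)
      then have "(1 / p) powr (real (m + m') / k) \<in> S (x * y)" by (intro SI c)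
      moreover have "(1 / p) powr (real (m + m') / k) = r * s" using c by (simp add: add_divide_distrib powr_add)
      ultimately show ?thesis by auto
    qed
    show "\<exists>t\<in>S (x + y). t \<le> max r s"
    proof -
      define n where "n = min m m'"
      have xn: "algebraic_int (x ^ k / of_nat p ^ n)" and yn: "algebraic_int (y ^ k / of_nat p ^ n)"
        using less c by (auto simp: n_def)
      \<comment> \<open>The ultrametric inequality rests on this: a mixed term is integral since its
        k-th power is a product of powers of two integral quotients.\<close>
      have summand: "algebraic_int (x ^ i * y ^ (k - i) / of_nat p ^ n)" if i: "i \<le> k" for i
      proof (rule algebraic_int_power_root[OF _ c(1)])
        have "algebraic_int ((x ^ k / of_nat p ^ n) ^ i * (y ^ k / of_nat p ^ n) ^ (k - i))"
          using xn yn by blast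
        also have "(x ^ k / of_nat p ^ n) ^ i * (y ^ k / of_nat p ^ n) ^ (k - i) = (x ^ i * y ^ (k - i) / of_nat p ^ n) ^ k"
        proof -
          have "i * n + n * (k - i) = k * n" using i by (simp flip: add_mult_distrib add: mult.commute[of n])
          then show ?thesis
            by (simp add: power_divide power_mult_distrib power_mult[symmetric] mult.commute flip: power_add)
        qed
        finally show "algebraic_int ((x ^ i * y ^ (k - i) / of_nat p ^ n) ^ k)" .
      qed
      have "(x + y) ^ k / of_nat p ^ n = (\<Sum>i\<le>k. of_nat (k choose i) * (x ^ i * y ^ (k - i) / of_nat p ^ n))"
        by (simp add: binomial_ring sum_divide_distrib mult.assoc)
      also have "algebraic_int \<dots>"
        by (intro algebraic_int_sum algebraic_int_times summand) auto
      finally have "(1 / p) powr (n / k) \<in> S (x + y)" by (intro SI c)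
      moreover have "(1 / p) powr (n / k) \<le> max r s"
        unfolding c n_def by (auto simp: min_def)
      ultimately show ?thesis by auto
    qed
  next
    fix r assume "r \<in> S 1"
    then obtain m k :: nat where 1: "k > 0" "r = (1 / p) powr (m / k)" "algebraic_int (1 / of_nat p ^ m :: complex)"
      by (auto simp: S_def)
    \<comment> \<open>A rational algebraic integer is an integer. So p is not a unit among the
      algebraic integers, and the seminorm does not collapse at 1.\<close>
    have "1 / of_nat p ^ m \<in> (\<rat> :: complex set)" by (intro Rats_divide Rats_power) auto
    with 1(3) have "1 / of_nat p ^ m \<in> (\<int> :: complex set)" by (rule rational_algebraic_int_is_int)
    then obtain i where "1 / of_nat p ^ m = (of_int i :: complex)" by (auto elim: Ints_cases)
    then have "of_int (i * int p ^ m) = (of_int 1 :: complex)" using p by (simp add: field_simps)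
    then have "i * int p ^ m = 1" by (simp only: of_int_eq_iff)
    then have "int p ^ m dvd 1" by (metis dvd_triv_right)
    then have "m = 0" using one_less_power[of "int p" m] p by (cases "m = 0") auto
    then show "r = 1" using 1 p by simp
  qed (use p in auto)
  then show ?thesis by blast
qed

lemma padic_seminormD:
  assumes "padic_seminorm p N"
  shows "\<not> algebraic_int x \<Longrightarrow> N x = 0" "N 1 = 1" "algebraic_int x \<Longrightarrow> 0 \<le> N x"
    "algebraic_int x \<Longrightarrow> N (of_nat p * x) = N x / p" "algebraic_int x \<Longrightarrow> N (x ^ k) = N x ^ k"
    "algebraic_int x \<Longrightarrow> algebraic_int y \<Longrightarrow> N (x + y) \<le> max (N x) (N y)"
    "algebraic_int x \<Longrightarrow> algebraic_int y \<Longrightarrow> N (x * y) \<le> N x * N y"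
  using assms unfolding padic_seminorm_def by auto

text \<open>Candidates taken from two members of the chain are compared at the smaller member; the
  total order thus makes the pointwise infimum a seminorm again.\<close>

lemma padic_seminorm_chain_lower_bound:
  assumes p: "p > 0" and C: "C \<noteq> {}" "\<And>N. N \<in> C \<Longrightarrow> padic_seminorm p N"
    and chain: "\<And>M N. M \<in> C \<Longrightarrow> N \<in> C \<Longrightarrow> M \<le> N \<or> N \<le> M"
  shows "\<exists>L. padic_seminorm p L \<and> (\<forall>N\<in>C. L \<le> N)"
proof -
  define S where "S x = (\<lambda>N. N x) ` C" for x :: complex
  have two: "\<exists>L\<in>C. L \<le> M \<and> L \<le> N" if "M \<in> C" "N \<in> C" for M N
    using chain[OF that] that by blast
  let ?L = "\<lambda>x. if algebraic_int x then Inf (S x) else 0"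
  have "padic_seminorm p ?L"
  proof (rule padic_seminorm_Inf[OF p])
    fix x y :: complex and r s assume xy: "algebraic_int x" "algebraic_int y" and rs: "r \<in> S x" "s \<in> S y"
    obtain M N where MN: "M \<in> C" "r = M x" "N \<in> C" "s = N y" using rs by (auto simp: S_def)
    obtain L where L: "L \<in> C" "L \<le> M" "L \<le> N" using two MN by blast
    note sL = padic_seminormD[OF C(2)[OF L(1)]]
    have le: "L x \<le> r" "L y \<le> s" using L MN by (auto simp: le_fun_def)
    have "L (x + y) \<le> max r s" using sL(6)[OF xy] le by auto
    then show "\<exists>t\<in>S (x + y). t \<le> max r s" using L(1) by (auto simp: S_def)
    have "L (x * y) \<le> r * s"
      using sL(7)[OF xy] mult_mono[OF le _ sL(3)[OF xy(2)]] sL(3)[OF xy(1)] le by auto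
    then show "\<exists>t\<in>S (x * y). t \<le> r * s" using L(1) by (auto simp: S_def)
  next
    fix x :: complex and r assume x: "algebraic_int x"
    show "S x \<noteq> {}" using C(1) by (simp add: S_def)
    show "0 \<le> r" if "r \<in> S x" using that padic_seminormD(3)[OF C(2) x] by (auto simp: S_def)
    show "\<exists>t\<in>S x. t ^ k \<le> r" if "r \<in> S (x ^ k)" for k
      using that padic_seminormD(5)[OF C(2) x] by (force simp: S_def)
    show "\<exists>t\<in>S (of_nat p * x). t \<le> r / p" if "r \<in> S x"
      using that padic_seminormD(4)[OF C(2) x] by (force simp: S_def)
    show "\<exists>t\<in>S x. t \<le> p * r" if "r \<in> S (of_nat p * x)"
      using that padic_seminormD(4)[OF C(2) x] p by (force simp: S_def)
  next
    show "r = 1" if "r \<in> S 1" for r using that padic_seminormD(2)[OF C(2)] by (auto simp: S_def)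
  qed
  moreover have "?L \<le> N" if N: "N \<in> C" for N
    unfolding le_fun_def
  proof
    fix x
    show "?L x \<le> N x"
    proof (cases "algebraic_int x")
      case True
      have "bdd_below (S x)" using padic_seminormD(3)[OF C(2) True] by (auto simp: S_def intro!: bdd_belowI[of _ 0])
      moreover have "N x \<in> S x" using N by (simp add: S_def)
      ultimately show ?thesis using True cInf_lower by auto
    next
      case False
      then show ?thesis using padic_seminormD(1)[OF C(2)[OF N]] by simp
    qed
  qed
  ultimately show ?thesis by blast
qed

text \<open>By submultiplicativity the quotients N(f^n g) / N(f)^n decrease in n, so their infimum
  is their limit. Exponents add up in products, and the power rule for \<open>N\<close> keeps the
  value 1 at g = 1.\<close>

lemma padic_seminorm_localise:
  assumes p: "p > 0" and N: "padic_seminorm p N" and f: "algebraic_int f" "N f > 0"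
  shows "\<exists>L. padic_seminorm p L \<and> L \<le> N \<and> (\<forall>g n. algebraic_int g \<longrightarrow> L g \<le> N (f ^ n * g) / N f ^ n)"
proof -
  define \<phi> where "\<phi> n x = N (f ^ n * x) / N f ^ n" for n x
  define S where "S x = range (\<lambda>n. \<phi> n x)" for x
  note sN = padic_seminormD[OF N]
  have ai: "algebraic_int (f ^ n * x)" if "algebraic_int x" for n x using that f by blast
  have dec1: "\<phi> (Suc n) x \<le> \<phi> n x" if x: "algebraic_int x" for n x
    using sN(7)[OF f(1) ai[OF x, of n]] f(2) by (simp add: \<phi>_def field_simps)
  have dec: "\<phi> m x \<le> \<phi> n x" if "algebraic_int x" "n \<le> m" for m n x
    using that(2) by (induction m rule: dec_induct) (use dec1[OF that(1)] order_trans in blast)+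
  have nonneg: "0 \<le> \<phi> n x" if "algebraic_int x" for n x
    using sN(3)[OF ai[OF that]] f(2) by (simp add: \<phi>_def)
  let ?L = "\<lambda>x. if algebraic_int x then Inf (S x) else 0"
  have "padic_seminorm p ?L"
  proof (rule padic_seminorm_Inf[OF p])
    fix x y :: complex and r s assume xy: "algebraic_int x" "algebraic_int y" and rs: "r \<in> S x" "s \<in> S y"
    obtain m n where mn: "r = \<phi> m x" "s = \<phi> n y" using rs by (auto simp: S_def)
    have "\<phi> (max m n) (x + y) \<le> max (\<phi> (max m n) x) (\<phi> (max m n) y)"
      using sN(6)[OF ai[OF xy(1), of "max m n"] ai[OF xy(2), of "max m n"]] f(2)
      by (auto simp: \<phi>_def distrib_left divide_right_mono le_max_iff_disj)
    also have "\<dots> \<le> max r s" using dec xy mn by (meson max.cobounded1 max.cobounded2 max.mono)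
    finally show "\<exists>t\<in>S (x + y). t \<le> max r s" by (auto simp: S_def)
    have "N (f ^ (m + n) * (x * y)) \<le> N (f ^ m * x) * N (f ^ n * y)"
      using sN(7)[OF ai[OF xy(1), of m] ai[OF xy(2), of n]] by (simp add: power_add mult_ac)
    then have "\<phi> (m + n) (x * y) \<le> r * s"
      using f(2) by (simp add: \<phi>_def mn power_add divide_right_mono)
    then show "\<exists>t\<in>S (x * y). t \<le> r * s" by (auto simp: S_def)
  next
    fix x :: complex and r assume x: "algebraic_int x"
    show "S x \<noteq> {}" by (simp add: S_def)
    show "0 \<le> r" if "r \<in> S x" using that nonneg[OF x] by (auto simp: S_def)
    show "\<exists>t\<in>S x. t ^ k \<le> r" if r: "r \<in> S (x ^ k)" and k: "k > 0" for k
    proof -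
      obtain m where m: "r = \<phi> m (x ^ k)" using r by (auto simp: S_def)
      have "\<phi> m x ^ k = N ((f ^ m * x) ^ k) / N f ^ (m * k)"
        by (simp add: \<phi>_def power_divide power_mult sN(5)[OF ai[OF x]])
      also have "\<dots> = \<phi> (m * k) (x ^ k)" by (simp add: \<phi>_def power_mult power_mult_distrib)
      also have "\<dots> \<le> \<phi> m (x ^ k)" using k x by (intro dec) auto
      finally show ?thesis using m by (auto simp: S_def)
    qed
    have pp: "\<phi> n (of_nat p * x) = \<phi> n x / p" for n
      using sN(4)[OF ai[OF x, of n]] by (simp add: \<phi>_def mult_ac)
    show "\<exists>t\<in>S (of_nat p * x). t \<le> r / p" if "r \<in> S x"
      using that pp by (force simp: S_def)
    show "\<exists>t\<in>S x. t \<le> p * r" if "r \<in> S (of_nat p * x)"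
      using that pp p by (force simp: S_def)
  next
    show "r = 1" if "r \<in> S 1" for r
      using that f sN(5)[OF f(1)] by (auto simp: S_def \<phi>_def)
  qed
  moreover have L: "?L g \<le> \<phi> n g" if g: "algebraic_int g" for g n
  proof -
    have "bdd_below (S g)" using nonneg[OF g] by (auto simp: S_def intro!: bdd_belowI[of _ 0])
    then show ?thesis using g cInf_lower[of "\<phi> n g" "S g"] by (auto simp: S_def)
  qed
  moreover have "?L \<le> N"
    unfolding le_fun_def
  proof
    fix x show "?L x \<le> N x"
      using L[of x 0] sN(1)[of x] by (cases "algebraic_int x") (auto simp: \<phi>_def)
  qed
  ultimately show ?thesis unfolding \<phi>_def by blast
qed

text \<open>Zorn's lemma for the reversed order yields a minimal seminorm. It coincides with its own
  localisation at \<open>x\<close>, whose bound for n = 1 is the missing inequality N x * N y <= N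
  (x * y).\<close>

lemma ex_multiplicative_padic_seminorm:
  assumes p: "p > (1 :: nat)"
  obtains N where "padic_seminorm p N" "\<forall>x y. algebraic_int x \<longrightarrow> algebraic_int y \<longrightarrow> N (x * y) = N x * N y"
proof -
  define A where "A = {N. padic_seminorm p N}"
  have "\<exists>m\<in>A. \<forall>a\<in>A. a \<le> m \<longrightarrow> a = m"
  proof (rule predicate_Zorn)
    show "partial_order_on A (relation_of (\<lambda>x y. y \<le> x) A)"
      by (intro partial_order_on_relation_ofI) auto
    fix C assume C: "C \<in> Chains (relation_of (\<lambda>x y. y \<le> x) A)"
    then have CA: "C \<subseteq> A" and ch: "\<And>M N. M \<in> C \<Longrightarrow> N \<in> C \<Longrightarrow> M \<le> N \<or> N \<le> M"
      unfolding Chains_def relation_of_def by blast+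
    show "\<exists>u\<in>A. \<forall>a\<in>C. u \<le> a"
    proof (cases "C = {}")
      case True
      then show ?thesis using ex_padic_seminorm[OF p] by (auto simp: A_def)
    next
      case False
      then show ?thesis using padic_seminorm_chain_lower_bound[of p C] p CA ch unfolding A_def by blast
    qed
  qed
  then obtain N where N: "padic_seminorm p N" and min: "\<And>L. padic_seminorm p L \<Longrightarrow> L \<le> N \<Longrightarrow> L = N"
    by (auto simp: A_def)
  note sN = padic_seminormD[OF N]
  have "N (x * y) = N x * N y" if xy: "algebraic_int x" "algebraic_int y" for x y
  proof (rule antisym)
    show "N x * N y \<le> N (x * y)"
    proof (cases "N x = 0")
      case False
      then have pos: "N x > 0" using sN(3)[OF xy(1)] by simp
      obtain L where L: "padic_seminorm p L" "L \<le> N"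
        "\<forall>g n. algebraic_int g \<longrightarrow> L g \<le> N (x ^ n * g) / N x ^ n"
        using padic_seminorm_localise[OF _ N xy(1) pos] p by auto
      have "L = N" using min L by blast
      then have "N y \<le> N (x ^ 1 * y) / N x ^ 1" using L(3) xy(2) by blast
      then show ?thesis using pos by (simp add: field_simps)
    qed (use sN(3)[of "x * y"] xy in auto)
  qed (rule sN(7)[OF xy])
  then show thesis using that N by blast
qed

section \<open>Absolute values on the algebraic numbers\<close>

text \<open>The constant is 2 for the archimedean absolute value and 1 for the ultrametric ones.\<close>

definition abs_value :: "complex set \<Rightarrow> real \<Rightarrow> (complex \<Rightarrow> real) \<Rightarrow> bool" where
  "abs_value K \<kappa> v \<longleftrightarrow> v 0 = 0 \<and> v 1 = 1 \<and> (\<forall>x\<in>K. 0 \<le> v x) \<and>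
     (\<forall>x\<in>K. \<forall>y\<in>K. v (x * y) = v x * v y \<and> v (x + y) \<le> \<kappa> * max (v x) (v y))"

text \<open>The multiplicative seminorm extends from algebraic integers to algebraic numbers by
  clearing integer denominators. Division is possible because p has value 1/p and integers prime to
  p have value 1, so nonzero integers have positive value.\<close>

lemma ex_padic_abs_value:
  assumes p: "prime (p :: nat)"
  shows "\<exists>w. abs_value {x. algebraic x} 1 w \<and> w (of_nat p) = 1 / p \<and> (\<forall>n. w (of_int n) \<le> 1)
    \<and> (\<forall>n. \<not> int p dvd n \<longrightarrow> w (of_int n) = 1)"
proof -
  have p1: "p > 1" using p prime_gt_1_nat by blast
  obtain N where N: "padic_seminorm p N"
    and Nm': "\<forall>x y. algebraic_int x \<longrightarrow> algebraic_int y \<longrightarrow> N (x * y) = N x * N y"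
    using ex_multiplicative_padic_seminorm[OF p1] .
  then have Nm: "\<And>x y. algebraic_int x \<Longrightarrow> algebraic_int y \<Longrightarrow> N (x * y) = N x * N y" by blast
  note sN = padic_seminormD[OF N]
  have N0: "N 0 = 0" using sN(4)[of 0] p1 by (simp add: field_simps)
  have Nneg1: "N (- 1) = 1"
  proof -
    have "N (- 1) ^ 2 = 1" using sN(5)[of "-1" 2] sN(2) by simp
    then show ?thesis using sN(3)[of "-1"] by (simp add: power2_eq_1_iff)
  qed
  have Nnat: "N (of_nat n) \<le> 1" for n
  proof (induction n)
    case (Suc n)
    then show ?case using sN(6)[of 1 "of_nat n"] sN(2) by simp
  qed (simp add: N0)
  have Nint: "N (of_int n) \<le> 1" for n
  proof (cases n)
    case (neg k)
    then have "of_int n = (- 1) * (of_nat (Suc k) :: complex)" by simp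
    moreover have "N ((- 1) * of_nat (Suc k)) = N (- 1) * N (of_nat (Suc k))" by (intro Nm) auto
    ultimately show ?thesis using Nneg1 Nnat[of "Suc k"] by (simp del: of_nat_Suc)
  qed (use Nnat in simp)
  have Np: "N (of_nat p) = 1 / p" using sN(4)[of 1] sN(2) by simp
  have Nunit: "N (of_int n) = 1" if n: "\<not> int p dvd n" for n
  proof (rule antisym[OF Nint])
    \<comment> \<open>In a p + b n = 1 the first term has value below 1, so by the ultrametric
      inequality the second one must reach 1.\<close>
    have "coprime (int p) n" using p n by (simp add: prime_imp_coprime)
    then obtain a b where ab: "a * int p + b * n = 1" using bezout_int[of "int p" n] by auto
    have "(1 :: complex) = of_int a * of_nat p + of_int b * of_int n"
      using arg_cong[OF ab, of "of_int :: int \<Rightarrow> complex"] by simp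
    then have "1 \<le> max (N (of_int a * of_nat p)) (N (of_int b * of_int n))"
      using sN(6)[of "of_int a * of_nat p" "of_int b * of_int n"] sN(2) by auto
    moreover have "N (of_int a * of_nat p) < 1"
    proof -
      have "N (of_int a * of_nat p) = N (of_int a) / p" using Nm[of "of_int a" "of_nat p"] Np by simp
      also have "\<dots> \<le> 1 / p" using Nint[of a] p1 by (intro divide_right_mono) auto
      also have "\<dots> < 1" using p1 by simp
      finally show ?thesis .
    qed
    moreover have "N (of_int b * of_int n) \<le> N (of_int n)"
      using Nm[of "of_int b" "of_int n"] Nint[of b] sN(3)[of "of_int n"] by (simp add: mult_left_le_one_le sN(3))
    ultimately show "1 \<le> N (of_int n)" by simp
  qed
  have Nnz: "N (of_int n) > 0" if "n \<noteq> 0" for n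
    using that
  proof (induction "nat \<bar>n\<bar>" arbitrary: n rule: less_induct)
    case less
    show ?case
    proof (cases "int p dvd n")
      case True
      then obtain k where k: "n = int p * k" by (elim dvdE)
      have "nat \<bar>k\<bar> < nat \<bar>n\<bar>" using less.prems p1 by (simp add: k abs_mult nat_mult_distrib)
      moreover have "k \<noteq> 0" using less.prems k by auto
      ultimately have "N (of_int k) > 0" using less.hyps by blast
      then show ?thesis using sN(4)[of "of_int k"] p1 by (simp add: k)
    qed (simp add: Nunit)
  qed
  define den where "den x = (SOME k :: int. k > 0 \<and> algebraic_int (of_int k * x))" for x :: complex
  have den: "den x > 0 \<and> algebraic_int (of_int (den x) * x)" if "algebraic x" for x
    unfolding den_def by (rule someI_ex) (use algebraic_imp_algebraic_int_multiple[OF that] in blast)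
  define w where "w x = N (of_int (den x) * x) / N (of_int (den x))" for x
  \<comment> \<open>Every integer denominator gives the same quotient, so sums and products can be
    evaluated over the common denominator \<open>k * l\<close>.\<close>
  have w: "w x = N (of_int k * x) / N (of_int k)" if x: "algebraic x" and k: "k \<noteq> 0" "algebraic_int (of_int k * x)" for x k
  proof -
    note d = den[OF x]
    have "N (of_int k) * N (of_int (den x) * x) = N (of_int (den x)) * N (of_int k * x)"
      using Nm[of "of_int k" "of_int (den x) * x"] Nm[of "of_int (den x)" "of_int k * x"] d k
      by (simp add: mult_ac)
    then show ?thesis using Nnz[of "den x"] Nnz[of k] d k by (simp add: w_def field_simps)
  qed
  have wint: "w x = N x" if "algebraic_int x" for x
    using w[of x 1] that sN(2) by auto
  have "abs_value {x. algebraic x} 1 w"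
    unfolding abs_value_def
  proof (intro conjI ballI)
    show "w 0 = 0" "w 1 = 1" using wint[of 0] wint[of 1] N0 sN(2) by auto
    fix x :: complex assume x: "x \<in> {x. algebraic x}"
    then show "0 \<le> w x" unfolding w_def using den[of x] sN(3) by (intro divide_nonneg_nonneg) auto
    fix y :: complex assume y: "y \<in> {x. algebraic x}"
    define k where "k = den x"
    define l where "l = den y"
    have k: "k > 0" "algebraic_int (of_int k * x)" using den x by (auto simp: k_def)
    have l: "l > 0" "algebraic_int (of_int l * y)" using den y by (auto simp: l_def)
    have xy: "algebraic (x * y)" "algebraic (x + y)" using algebraic_add_mult x y by auto
    have kl: "algebraic_int (of_int (k * l) * x)" "algebraic_int (of_int (k * l) * y)"
      using algebraic_int_times[OF _ k(2), of "of_int l"] algebraic_int_times[OF _ l(2), of "of_int k"]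
      by (auto simp: mult_ac)
    have 1: "algebraic_int (of_int (k * l) * (x * y))"
      using algebraic_int_times[OF k(2) l(2)] by (simp add: mult_ac)
    have 2: "algebraic_int (of_int (k * l) * (x + y))"
      using algebraic_int_plus[OF kl] by (simp add: algebra_simps)
    have kl0: "k * l \<noteq> 0" using k l by simp
    have "w (x * y) = N (of_int k * x) * N (of_int l * y) / (N (of_int k) * N (of_int l))"
      using w[OF xy(1) kl0 1] Nm[OF k(2) l(2)] Nm[of "of_int k" "of_int l"] by (simp add: mult_ac)
    then show "w (x * y) = w x * w y"
      using w[OF _ _ k(2)] w[OF _ _ l(2)] x y k l by simp
    have "w (x + y) = N (of_int (k * l) * x + of_int (k * l) * y) / N (of_int (k * l))"
      using w[OF xy(2) kl0 2] by (simp add: distrib_left)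
    also have "\<dots> \<le> max (N (of_int (k * l) * x)) (N (of_int (k * l) * y)) / N (of_int (k * l))"
      using Nnz[OF kl0] by (intro divide_right_mono sN(6) kl) auto
    also have "\<dots> = max (w x) (w y)"
      using w[OF _ kl0 kl(1)] w[OF _ kl0 kl(2)] x y Nnz[OF kl0]
      by (simp add: max_def divide_le_cancel)
    finally show "w (x + y) \<le> 1 * max (w x) (w y)" by simp
  qed
  moreover have "w (of_nat p) = 1 / p" using wint[of "of_nat p"] Np by simp
  ultimately show ?thesis using wint Nint Nunit by auto
qed

section \<open>Local decomposition of the Weil height\<close>

lemma abs_valueD:
  assumes "abs_value K \<kappa> v"
  shows "v 0 = 0" "v 1 = 1" "x \<in> K \<Longrightarrow> 0 \<le> v x" "x \<in> K \<Longrightarrow> y \<in> K \<Longrightarrow> v (x * y) = v x * v y"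
    "x \<in> K \<Longrightarrow> y \<in> K \<Longrightarrow> v (x + y) \<le> \<kappa> * max (v x) (v y)"
  using assms by (auto simp: abs_value_def)

context
  fixes K :: "complex set" and \<kappa> :: real and v :: "complex \<Rightarrow> real"
  assumes K: "is_subfield K" and v: "abs_value K \<kappa> v"
begin

lemma abs_value_minus: "x \<in> K \<Longrightarrow> v (- x) = v x"
proof -
  assume x: "x \<in> K"
  have m1: "- 1 \<in> K" using is_subfieldD(2,5)[OF K] by blast
  have "v (- 1) * v (- 1) = 1" using abs_valueD(4)[OF v m1 m1] abs_valueD(2)[OF v] by simp
  then have "v (- 1) = 1"
    using abs_valueD(3)[OF v m1] by (metis abs_of_nonneg power2_eq_1_iff power2_eq_square abs_1 abs_minus_cancel)
  then show ?thesis using abs_valueD(4)[OF v m1 x] by simp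
qed

lemma abs_value_pos: "x \<in> K \<Longrightarrow> x \<noteq> 0 \<Longrightarrow> 0 < v x"
  using abs_valueD(3,4)[OF v] is_subfieldD(6)[OF K, of x] abs_valueD(2)[OF v]
  by (metis less_eq_real_def mult_zero_left right_inverse zero_neq_one)

lemma abs_value_inverse: "x \<in> K \<Longrightarrow> v (inverse x) = inverse (v x)"
proof (cases "x = 0")
  case False
  assume "x \<in> K"
  then have "v x * v (inverse x) = 1"
    using False abs_valueD(2)[OF v] abs_valueD(4)[OF v _ is_subfieldD(6)[OF K], of x x] by simp
  then show ?thesis by (metis inverse_unique)
qed (simp add: abs_valueD[OF v])

lemma abs_value_divide: "x \<in> K \<Longrightarrow> y \<in> K \<Longrightarrow> v (x / y) = v x / v y"
  by (simp add: divide_inverse abs_valueD(4)[OF v] abs_value_inverse is_subfieldD(6)[OF K])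

lemma abs_value_power: "x \<in> K \<Longrightarrow> v (x ^ n) = v x ^ n"
  by (induction n) (auto simp: abs_valueD[OF v] subfield_power[OF K])

text \<open>The weak triangle inequality, applied to x = (x + y) + (- y): a term that wins by more
  than the factor \<kappa> cannot be cancelled. One formulation covers archimedean and ultrametric
  places.\<close>

lemma abs_value_dominant:
  assumes "x \<in> K" "y \<in> K" "\<kappa> * v y < v x"
  shows "v x \<le> \<kappa> * v (x + y)"
proof -
  have "v ((x + y) + (- y)) \<le> \<kappa> * max (v (x + y)) (v (- y))"
    using assms is_subfieldD[OF K] by (intro abs_valueD(5)[OF v]) auto
  then show ?thesis using assms by (auto simp: max_def abs_value_minus split: if_splits)
qed

end

text \<open>Gauss's lemma for one linear factor; \<open>G\<close> is the Gauss norm of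
  \<open>f\<close>, expressed as a bound that is attained. If |a| <= 1, the last coefficient of size
  \<open>G\<close> survives one place higher in the product; if |a| > 1, any coefficient of size
  \<open>G\<close> survives after multiplication by \<open>a\<close>.\<close>

lemma gauss_norm_mult_linear:
  assumes v: "abs_value {x. algebraic x} 1 v" and f: "f \<in> polys_over {x. algebraic x}" and a: "algebraic a"
    and G: "G > 0" "\<And>i. v (coeff f i) \<le> G" "\<exists>i. v (coeff f i) = G"
  shows "(\<forall>i. v (coeff ([:-a, 1:] * f) i) \<le> G * max 1 (v a)) \<and> (\<exists>i. v (coeff ([:-a, 1:] * f) i) = G * max 1 (v a))"
proof -
  note K = is_subfield_algebraic
  have fK: "algebraic (coeff f i)" for i using f by (simp add: polys_over_def)
  note vD = abs_valueD[OF v, unfolded mem_Collect_eq]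
  have aK: "algebraic (a * coeff f i)" "algebraic (- (a * coeff f i))" for i
    using is_subfieldD[OF K] a fK by simp_all
  have va: "v (- (a * coeff f i)) = v a * v (coeff f i)" for i
    using abs_value_minus[OF K v, of "a * coeff f i"] vD(4)[OF a fK] aK by simp
  have c0: "coeff ([:-a, 1:] * f) 0 = - (a * coeff f 0)" by simp
  have cS: "coeff ([:-a, 1:] * f) (Suc k) = coeff f k + - (a * coeff f (Suc k))" for k
    by simp
  have va0: "0 \<le> v a" using vD(3)[OF a] .
  have aG: "v a * v (coeff f i) \<le> G * max 1 (v a)" for i
  proof -
    have "v a * v (coeff f i) \<le> max 1 (v a) * G" using G va0 vD(3)[OF fK] by (intro mult_mono) auto
    then show ?thesis by (simp add: mult.commute)
  qed
  have G1: "G \<le> G * max 1 (v a)" using G(1) by simp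
  have le: "v (coeff ([:-a, 1:] * f) i) \<le> G * max 1 (v a)" for i
  proof (cases i)
    case 0
    show ?thesis unfolding 0 c0 va by (rule aG)
  next
    case (Suc k)
    have "v (coeff f k + - (a * coeff f (Suc k))) \<le> 1 * max (v (coeff f k)) (v (- (a * coeff f (Suc k))))"
      by (rule vD(5)[OF fK aK(2)])
    also have "\<dots> \<le> G * max 1 (v a)" using aG[of "Suc k"] G1 G(2)[of k] unfolding va by simp
    finally show ?thesis unfolding Suc cS .
  qed
  have "\<exists>i. G * max 1 (v a) \<le> v (coeff ([:-a, 1:] * f) i)"
  proof (cases "v a \<le> 1")
    case True
    have "finite {i. v (coeff f i) = G}"
      by (rule finite_subset[of _ "{..degree f}"])
         (use G(1) vD(1) in \<open>auto simp: not_le intro!: le_degree\<close>)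
    define k where "k = Max {i. v (coeff f i) = G}"
    have "k \<in> {i. v (coeff f i) = G}" unfolding k_def
      using \<open>finite _\<close> G(3) by (intro Max_in) auto
    then have k: "v (coeff f k) = G" by simp
    have "v (coeff f (Suc k)) \<noteq> G"
    proof
      assume "v (coeff f (Suc k)) = G"
      then have "Suc k \<le> k" unfolding k_def using \<open>finite _\<close> by (intro Max_ge) auto
      then show False by simp
    qed
    then have "v (coeff f (Suc k)) < G" using G(2)[of "Suc k"] by simp
    then have "v (- (a * coeff f (Suc k))) < v (coeff f k)"
      unfolding va k using True va0 vD(3)[OF fK, of "Suc k"] mult_left_le_one_le[of "v (coeff f (Suc k))" "v a"] by simp
    then have "v (coeff f k) \<le> 1 * v (coeff f k + - (a * coeff f (Suc k)))"
      using fK aK by (intro abs_value_dominant[OF K v]) auto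
    then show ?thesis using True k by (intro exI[of _ "Suc k"]) (simp del: mult_pCons_left add: cS)
  next
    case False
    obtain k where k: "v (coeff f k) = G" using G(3) by blast
    show ?thesis
    proof (cases k)
      case 0
      then show ?thesis using k False va[of 0] by (intro exI[of _ 0]) (simp del: mult_pCons_left add: c0)
    next
      case (Suc l)
      have "v (coeff f l) < v (- (a * coeff f k))"
        unfolding va k using G(2)[of l] False G(1) by (simp add: less_le_trans le_less_trans)
      then have "v (- (a * coeff f k)) \<le> 1 * v (- (a * coeff f k) + coeff f l)"
        using fK aK by (intro abs_value_dominant[OF K v]) auto
      then show ?thesis using False k va[of k] unfolding Suc
        by (intro exI[of _ "Suc l"]) (simp del: mult_pCons_left add: cS mult.commute)
    qed
  qed
  then show ?thesis using le by (meson antisym)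
qed

text \<open>Iteration over the roots gives the Gauss norm by the formula that defines the Mahler
  measure, with the p-adic value in place of the complex one.\<close>

lemma gauss_norm_root_poly:
  assumes v: "abs_value {x. algebraic x} 1 v" and X: "\<And>x. x \<in># X \<Longrightarrow> algebraic x" and c: "algebraic c" "c \<noteq> 0"
  shows "(\<forall>i. v (coeff (Polynomial.smult c (root_poly X)) i) \<le> v c * (\<Prod>x\<in>#X. max 1 (v x))) \<and>
    (\<exists>i. v (coeff (Polynomial.smult c (root_poly X)) i) = v c * (\<Prod>x\<in>#X. max 1 (v x)))"
  using X
proof (induction X)
  case empty
  have "v (coeff [:c:] i) \<le> v c" for i
    using abs_valueD(1,3)[OF v] c by (cases i) auto
  moreover have "v (coeff [:c:] 0) = v c" by simp
  ultimately show ?case by (auto simp del: coeff_pCons_0)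
next
  case (add a X)
  note K = is_subfield_algebraic
  have f: "Polynomial.smult c (root_poly X) \<in> polys_over {x. algebraic x}"
  proof -
    have "\<And>x. x \<in># X \<Longrightarrow> algebraic x" using add.prems by simp
    then have "root_poly X \<in> polys_over {x. algebraic x}"
    proof (induction X)
      case (add x X)
      have "[:- x, 1:] \<in> polys_over {x. algebraic x}"
        using add.prems is_subfieldD[OF K] by (intro polys_over_pCons[OF K] polys_over_0[OF K]) auto
      then show ?case using add polys_over_mult[OF K] by (simp del: mult_pCons_left)
    qed (simp add: polys_over_1[OF K])
    then show ?thesis using c by (intro polys_over_smult[OF K]) auto
  qed
  define G where "G = v c * (\<Prod>x\<in>#X. max 1 (v x))"
  have "v c > 0" using abs_value_pos[OF K v] c by simp
  moreover have "(\<Prod>x\<in>#X. max 1 (v x)) > 0" by (induction X) auto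
  ultimately have "G > 0" unfolding G_def by simp
  then have "(\<forall>i. v (coeff ([:-a, 1:] * Polynomial.smult c (root_poly X)) i) \<le> G * max 1 (v a)) \<and>
    (\<exists>i. v (coeff ([:-a, 1:] * Polynomial.smult c (root_poly X)) i) = G * max 1 (v a))"
    using add unfolding G_def by (intro gauss_norm_mult_linear[OF v f]) auto
  moreover have "[:-a, 1:] * Polynomial.smult c (root_poly X) = Polynomial.smult c (root_poly (add_mset a X))"
    by (simp add: mult_smult_right del: mult_pCons_left)
  moreover have "G * max 1 (v a) = v c * (\<Prod>x\<in>#add_mset a X. max 1 (v x))" by (simp add: G_def)
  ultimately show ?case by metis
qed

text \<open>The index 0 stands for the archimedean place. One extension per prime is fixed once and
  for all; other places above that prime arise by composing it with embeddings.\<close>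

definition place :: "nat \<Rightarrow> complex \<Rightarrow> real" where
  "place p = (if prime p then (SOME w. abs_value {x. algebraic x} 1 w \<and> w (of_nat p) = 1 / p \<and> (\<forall>n. w (of_int n) \<le> 1)
    \<and> (\<forall>n. \<not> int p dvd n \<longrightarrow> w (of_int n) = 1)) else norm)"

lemma place_prime:
  assumes "prime p"
  shows "abs_value {x. algebraic x} 1 (place p)" "place p (of_nat p) = 1 / p" "place p (of_int n) \<le> 1"
    "\<not> int p dvd n \<Longrightarrow> place p (of_int n) = 1"
  using someI_ex[OF ex_padic_abs_value[OF assms]] assms by (auto simp: place_def)

lemma place_0 [simp]: "place 0 = norm"
  by (simp add: place_def)

lemma abs_value_norm: "abs_value K 2 norm"
  by (auto simp: abs_value_def norm_mult intro: order_trans[OF norm_triangle_ineq])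

lemma abs_value_place:
  assumes "v = 0 \<or> prime v"
  shows "abs_value {x. algebraic x} (if v = 0 then 2 else 1) (place v)"
  using assms place_prime(1)[of v] abs_value_norm by (auto simp: not_prime_0)

text \<open>The product formula over the rationals, reduced to prime factors: a prime q contributes
  log q at the archimedean place, the negative of this at q and nothing elsewhere.\<close>

lemma sum_ln_place_int:
  assumes "finite P" "\<And>p. p \<in> P \<Longrightarrow> prime p" "n \<noteq> 0" "prime_factors (nat \<bar>n\<bar>) \<subseteq> P"
  shows "(\<Sum>v\<in>insert 0 P. ln (place v (of_int n))) = 0"
proof -
  have nz: "0 \<notin> P" using assms(2)[of 0] by auto
  have multi: "(\<Sum>v\<in>insert 0 P. ln (place v (of_nat (\<Prod>p\<in>#M. p)))) = 0"
    if "\<And>p. p \<in># M \<Longrightarrow> p \<in> P" for M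
    using that
  proof (induction M)
    case empty
    have "place v 1 = 1" if "v \<in> insert 0 P" for v
      using abs_valueD(2)[OF abs_value_place[of v]] that assms(2) by auto
    then show ?case by simp
  next
    case (add q M)
    have q: "prime q" "q \<in> P" using add.prems assms(2) by auto
    have M0: "(\<Prod>p\<in>#M. p) \<noteq> 0" using add.prems assms(2)[of 0] by (auto simp: prod_mset_zero_iff)
    have "ln (place v (of_nat (\<Prod>p\<in>#add_mset q M. p))) = ln (place v (of_nat q)) + ln (place v (of_nat (\<Prod>p\<in>#M. p)))"
      if v: "v \<in> insert 0 P" for v
    proof -
      have av: "abs_value {x. algebraic x} (if v = 0 then 2 else 1) (place v)"
        using v assms(2) by (intro abs_value_place) auto
      have "place v (of_nat q * of_nat (\<Prod>p\<in>#M. p)) = place v (of_nat q) * place v (of_nat (\<Prod>p\<in>#M. p))"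
        by (rule abs_valueD(4)[OF av]) auto
      moreover have "place v (of_nat q) > 0" "place v (of_nat (\<Prod>p\<in>#M. p)) > 0"
        using q M0 prime_gt_0_nat[OF q(1)] by (auto intro!: abs_value_pos[OF is_subfield_algebraic av])
      ultimately show ?thesis by (simp add: ln_mult)
    qed
    moreover have "(\<Sum>v\<in>insert 0 P. ln (place v (of_nat q))) = 0"
    proof -
      have "ln (place v (of_nat q)) = (if v = q then - ln (real q) else 0)" if "v \<in> P" for v
      proof (cases "v = q")
        case True
        then show ?thesis using place_prime(2)[OF q(1)] prime_gt_0_nat[OF q(1)] by (simp add: ln_div)
      next
        case False
        have "prime v" using that assms(2) by blast
        then have "\<not> int v dvd int q" using False q(1) primes_dvd_imp_eq[of v q] by auto
        from place_prime(4)[OF \<open>prime v\<close> this] show ?thesis using False by simp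
      qed
      then have "(\<Sum>v\<in>P. ln (place v (of_nat q))) = - ln (real q)"
        using assms(1) q(2) by (simp add: sum.delta)
      then show ?thesis using assms(1) nz by simp
    qed
    ultimately show ?case using add by (simp add: sum.distrib)
  qed
  define m where "m = nat \<bar>n\<bar>"
  have m: "(\<Prod>p\<in>#prime_factorization m. p) = m"
    using assms(3) by (simp add: m_def prod_mset_prime_factorization_nat)
  have "(\<Sum>v\<in>insert 0 P. ln (place v (of_nat m))) = 0"
    using multi[of "prime_factorization m"] assms(4) unfolding m by (auto simp: m_def)
  moreover have "place v (of_nat m) = place v (of_int n)" if v: "v \<in> insert 0 P" for v
  proof -
    have av: "abs_value {x. algebraic x} (if v = 0 then 2 else 1) (place v)"
      using v assms(2) by (intro abs_value_place) auto
    show ?thesis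
    proof (cases "n \<ge> 0")
      case False
      then have "of_nat m = - (of_int n :: complex)" by (simp add: m_def)
      then show ?thesis using abs_value_minus[OF is_subfield_algebraic av, of "of_int n"] by simp
    qed (simp add: m_def)
  qed
  ultimately show ?thesis by simp
qed

lemma ln_prod_mset_eq:
  fixes F :: "'a \<Rightarrow> real"
  shows "(\<And>x. x \<in># X \<Longrightarrow> F x > 0) \<Longrightarrow> ln (\<Prod>x\<in>#X. F x) = (\<Sum>x\<in>#X. ln (F x)) \<and> (\<Prod>x\<in>#X. F x) > 0"
proof (induction X)
  case (add x X)
  then have "F x > 0" "ln (\<Prod>x\<in>#X. F x) = (\<Sum>x\<in>#X. ln (F x))" "(\<Prod>x\<in>#X. F x) > 0" by auto
  then show ?case by (simp add: ln_mult_pos)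
qed simp

lemma min_poly_decompose:
  assumes "algebraic x"
  shows "min_poly x = Polynomial.smult (of_int (lead_coeff (min_int_poly x))) (root_poly (proots (min_poly x)))"
    "\<And>y. y \<in># proots (min_poly x) \<Longrightarrow> algebraic y"
  using complex_poly_decompose_multiset[of "min_poly x"] min_poly[OF assms]
  by (auto simp: min_poly_def coeff_map_poly degree_map_poly)

lemma degree_mult_weil_height:
  assumes "algebraic x"
  shows "real (degree (min_poly x)) * weil_height x
    = ln (of_int (lead_coeff (min_int_poly x))) + (\<Sum>y\<in>#proots (min_poly x). ln (max 1 (norm y)))"
proof -
  note m = min_poly[OF assms]
  have a: "lead_coeff (min_int_poly x) > 0" using min_int_poly[OF assms] by blast
  have "(\<Prod>y\<in>{y. poly (min_poly x) y = 0}. max 1 (norm y) ^ order y (min_poly x)) = (\<Prod>y\<in>#proots (min_poly x). max 1 (norm y))"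
    by (subst image_prod_mset_multiplicity) (simp_all add: m)
  moreover have "norm (lead_coeff (min_poly x)) = of_int (lead_coeff (min_int_poly x))"
    using a by (simp add: min_poly_def coeff_map_poly degree_map_poly)
  ultimately have "mahler_measure (min_poly x)
      = of_int (lead_coeff (min_int_poly x)) * (\<Prod>y\<in>#proots (min_poly x). max 1 (norm y))"
    by (simp add: mahler_measure_def)
  moreover have "ln (\<Prod>y\<in>#proots (min_poly x). max 1 (norm y)) = (\<Sum>y\<in>#proots (min_poly x). ln (max 1 (norm y)))
      \<and> (\<Prod>y\<in>#proots (min_poly x). max 1 (norm y)) > 0"
    by (rule ln_prod_mset_eq) auto
  moreover have "(of_int (lead_coeff (min_int_poly x)) :: real) > 0" using a by simp
  ultimately have "ln (mahler_measure (min_poly x))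
    = ln (of_int (lead_coeff (min_int_poly x))) + (\<Sum>y\<in>#proots (min_poly x). ln (max 1 (norm y)))"
    by (metis ln_mult_pos)
  then show ?thesis using m(4,5) by (simp add: weil_height_def min_poly_def[symmetric])
qed

lemma irreducible_int_poly_content:
  assumes "irreducible (g :: int poly)" "degree g > 0"
  shows "Polynomial.content g = 1"
proof -
  have g: "g = [:Polynomial.content g:] * primitive_part g" by simp
  have "\<not> primitive_part g dvd 1" using assms(2) by (auto simp: poly_dvd_1)
  then have "[:Polynomial.content g:] dvd 1" using assms(1) g unfolding irreducible_def by blast
  then have "Polynomial.content g dvd 1" by (simp add: poly_dvd_1)
  then show ?thesis by (metis is_unit_normalize normalize_content)
qed

text \<open>\<open>min_int_poly x\<close> is primitive, so its p-adic Gauss norm is 1; written in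
  terms of the roots, this norm relates the leading coefficient to the product of the max(1,
  |y|).\<close>

lemma local_height_prime:
  assumes "algebraic x" "prime p"
  shows "(\<Sum>y\<in>#proots (min_poly x). ln (max 1 (place p y))) = - ln (place p (of_int (lead_coeff (min_int_poly x))))"
proof -
  define g where "g = min_int_poly x"
  note mg = min_int_poly[OF assms(1), folded g_def]
  have dg: "degree g > 0" using min_poly(4,5)[OF assms(1)] by (simp add: g_def)
  define G where "G = place p (of_int (lead_coeff g)) * (\<Prod>y\<in>#proots (min_poly x). max 1 (place p y))"
  have coeffs: "coeff (min_poly x) i = of_int (coeff g i)" for i
    by (simp add: min_poly_def g_def coeff_map_poly)
  have "(\<forall>i. place p (coeff (min_poly x) i) \<le> G) \<and> (\<exists>i. place p (coeff (min_poly x) i) = G)"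
    using gauss_norm_root_poly[OF place_prime(1)[OF assms(2)], of "proots (min_poly x)" "of_int (lead_coeff g)"]
      min_poly_decompose[OF assms(1), folded g_def] mg(1) unfolding G_def by simp
  then have G: "\<And>i. place p (of_int (coeff g i)) \<le> G" "\<exists>i. place p (of_int (coeff g i)) = G"
    unfolding coeffs by auto
  have "\<exists>i. \<not> int p dvd coeff g i"
  proof (rule ccontr)
    assume "\<not> ?thesis"
    then have "[:int p:] dvd g" by (simp add: const_poly_dvd_iff)
    then have "int p dvd 1" using irreducible_int_poly_content[OF mg(3) dg] by (simp add: const_poly_dvd_iff_dvd_content)
    then show False using assms(2) by auto
  qed
  then have "1 \<le> G" using G(1) place_prime(4)[OF assms(2)] by metis
  moreover have "G \<le> 1" using G(2) place_prime(3)[OF assms(2)] by metis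
  ultimately have "G = 1" by simp
  have "place p (of_int (lead_coeff g)) > 0"
    using abs_value_pos[OF is_subfield_algebraic place_prime(1)[OF assms(2)]] mg(1) by simp
  moreover have "ln (\<Prod>y\<in>#proots (min_poly x). max 1 (place p y)) = (\<Sum>y\<in>#proots (min_poly x). ln (max 1 (place p y)))
      \<and> (\<Prod>y\<in>#proots (min_poly x). max 1 (place p y)) > 0"
    by (rule ln_prod_mset_eq) auto
  ultimately have "ln G = ln (place p (of_int (lead_coeff g))) + (\<Sum>y\<in>#proots (min_poly x). ln (max 1 (place p y)))"
    unfolding G_def by (metis ln_mult_pos)
  then show ?thesis using \<open>G = 1\<close> by (simp add: g_def)
qed

text \<open>The product formula distributes the logarithm of the leading coefficient in the Mahler
  measure over the primes, where Gauss's lemma turns it into sums over the conjugates.\<close>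

lemma weil_height_eq_sum_local:
  assumes "algebraic x" "finite P" "\<And>p. p \<in> P \<Longrightarrow> prime p"
    "prime_factors (nat \<bar>lead_coeff (min_int_poly x)\<bar>) \<subseteq> P"
  shows "(\<Sum>v\<in>insert 0 P. \<Sum>y\<in>#proots (min_poly x). ln (max 1 (place v y))) = real (degree (min_poly x)) * weil_height x"
proof -
  define a where "a = lead_coeff (min_int_poly x)"
  have a: "a > 0" using min_int_poly(4)[OF assms(1)] by (simp add: a_def)
  have nz: "0 \<notin> P" using assms(3)[of 0] by auto
  have "(\<Sum>v\<in>insert 0 P. ln (place v (of_int a))) = 0"
    using assms a unfolding a_def by (intro sum_ln_place_int) (use min_int_poly(1)[OF assms(1)] in auto)
  then have "(\<Sum>v\<in>P. - ln (place v (of_int a))) = ln (of_int a)"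
    using nz assms(2) a by (simp add: sum_negf)
  moreover have "(\<Sum>v\<in>P. \<Sum>y\<in>#proots (min_poly x). ln (max 1 (place v y))) = (\<Sum>v\<in>P. - ln (place v (of_int a)))"
    using local_height_prime[OF assms(1)] assms(3) by (intro sum.cong) (auto simp: a_def)
  ultimately show ?thesis
    using nz assms(2) degree_mult_weil_height[OF assms(1)] by (simp add: a_def)
qed

text \<open>Primes missing from \<open>P\<close> omit only nonnegative terms.\<close>

lemma sum_local_le_weil_height:
  assumes "algebraic x" "finite P" "\<And>p. p \<in> P \<Longrightarrow> prime p"
  shows "(\<Sum>v\<in>insert 0 P. \<Sum>y\<in>#proots (min_poly x). ln (max 1 (place v y))) \<le> real (degree (min_poly x)) * weil_height x"
proof -
  define Q where "Q = P \<union> prime_factors (nat \<bar>lead_coeff (min_int_poly x)\<bar>)"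
  have Q: "finite Q" "\<And>p. p \<in> Q \<Longrightarrow> prime p" using assms by (auto simp: Q_def)
  have "0 \<le> (\<Sum>y\<in>#Y. ln (max 1 (place v y)))" for v Y
    by (induction Y) auto
  then have "(\<Sum>v\<in>insert 0 P. \<Sum>y\<in>#proots (min_poly x). ln (max 1 (place v y)))
      \<le> (\<Sum>v\<in>insert 0 Q. \<Sum>y\<in>#proots (min_poly x). ln (max 1 (place v y)))"
    using Q by (intro sum_mono2) (auto simp: Q_def)
  also have "\<dots> = real (degree (min_poly x)) * weil_height x"
    by (intro weil_height_eq_sum_local assms(1) Q) (auto simp: Q_def)
  finally show ?thesis .
qed

text \<open>The product of the conjugates of \<open>x\<close> is, up to sign, the quotient of the
  constant and the leading coefficient of its minimal polynomial, so the product formula for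
  integers suffices. \<open>P0\<close> consists of the primes dividing one of the two.\<close>

lemma sum_local_ln_place:
  assumes "algebraic x" "x \<noteq> 0"
  shows "\<exists>P0. finite P0 \<and> (\<forall>p\<in>P0. prime p) \<and> (\<forall>P. finite P \<longrightarrow> P0 \<subseteq> P \<longrightarrow> (\<forall>p\<in>P. prime p)
    \<longrightarrow> (\<Sum>v\<in>insert 0 P. \<Sum>y\<in>#proots (min_poly x). ln (place v y)) = 0)"
proof -
  define g where "g = min_int_poly x"
  define a where "a = lead_coeff g"
  define X where "X = proots (min_poly x)"
  note K = is_subfield_algebraic
  note m = min_poly[OF assms(1)]
  have a: "a \<noteq> 0" using min_int_poly(1)[OF assms(1)] by (simp add: a_def g_def)
  note dec = min_poly_decompose[OF assms(1), folded g_def X_def, folded a_def]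
  have nz: "0 \<notin># X"
  proof
    assume "0 \<in># X"
    then have 0: "poly (min_poly x) 0 = 0" using m(2) by (simp add: X_def)
    have "min_poly x dvd [:0, 1:]"
      by (rule m(6)[OF 0]) (auto simp: polys_over_def coeff_pCons split: nat.split)
    then have "poly [:0, 1:] x = 0" using m(3) by (metis dvdE mult_zero_left poly_mult)
    then show False using assms(2) by simp
  qed
  have c0: "of_int (coeff g 0) = of_int a * (\<Prod>y\<in>#X. - y)"
  proof -
    have "of_int (coeff g 0) = poly (min_poly x) 0"
      by (simp add: poly_0_coeff_0 min_poly_def g_def coeff_map_poly)
    also have "\<dots> = of_int a * (\<Prod>y\<in>#X. - y)"
      by (subst dec(1)) (simp add: poly_prod_mset)
    finally show ?thesis .
  qed
  have g0: "coeff g 0 \<noteq> 0"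
  proof
    assume "coeff g 0 = 0"
    then have "of_int a * (\<Prod>y\<in>#X. - y) = 0" using c0 by simp
    then show False using a nz by (auto simp: prod_mset_zero_iff)
  qed
  have loc: "(\<Sum>y\<in>#X. ln (place v y)) = ln (place v (of_int (coeff g 0))) - ln (place v (of_int a))"
    if v: "v = 0 \<or> prime v" for v
  proof -
    note av = abs_value_place[OF v]
    have pos: "place v y > 0" if "algebraic y" "y \<noteq> 0" for y
      using abs_value_pos[OF K av] that by simp
    have pY: "place v (\<Prod>y\<in>#Y. - y) = (\<Prod>y\<in>#Y. place v y) \<and> algebraic (\<Prod>y\<in>#Y. - y)"
      if "\<And>y. y \<in># Y \<Longrightarrow> algebraic y" for Y
      using that
    proof (induction Y)
      case (add y Y)
      have IH: "place v (\<Prod>y\<in>#Y. - y) = (\<Prod>y\<in>#Y. place v y)" "algebraic (\<Prod>y\<in>#Y. - y)"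
      proof -
        have "\<And>y. y \<in># Y \<Longrightarrow> algebraic y" using add.prems by simp
        from add.IH[OF this] show "place v (\<Prod>y\<in>#Y. - y) = (\<Prod>y\<in>#Y. place v y)" "algebraic (\<Prod>y\<in>#Y. - y)"
          by blast+
      qed
      have 1: "algebraic (- y)" "algebraic (\<Prod>y\<in>#Y. - y)" using add.prems[of y] IH by simp_all
      then have "algebraic (- y * (\<Prod>y\<in>#Y. - y))" using algebraic_add_mult by blast
      moreover have "place v (- y * (\<Prod>y\<in>#Y. - y)) = place v (- y) * place v (\<Prod>y\<in>#Y. - y)"
        using 1 by (intro abs_valueD(4)[OF av]) auto
      moreover have "place v (- y) = place v y" using abs_value_minus[OF K av] 1 by simp
      ultimately show ?case using IH(1) by simp
    qed (use abs_valueD(2)[OF av] in auto)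
    have pX: "place v (\<Prod>y\<in>#X. - y) = (\<Prod>y\<in>#X. place v y)" "algebraic (\<Prod>y\<in>#X. - y)"
      using pY[of X, OF dec(2)] by simp_all
    have "place v (of_int (coeff g 0)) = place v (of_int a) * (\<Prod>y\<in>#X. place v y)"
      unfolding c0 using abs_valueD(4)[OF av, of "of_int a" "\<Prod>y\<in>#X. - y"] pX by simp
    moreover have "ln (\<Prod>y\<in>#X. place v y) = (\<Sum>y\<in>#X. ln (place v y)) \<and> (\<Prod>y\<in>#X. place v y) > 0"
      using dec(2) nz by (intro ln_prod_mset_eq pos) auto
    moreover have "place v (of_int a) > 0" using a by (intro pos) auto
    ultimately have "ln (place v (of_int (coeff g 0))) = ln (place v (of_int a)) + (\<Sum>y\<in>#X. ln (place v y))"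
      by (metis ln_mult_pos)
    then show ?thesis by simp
  qed
  define P0 where "P0 = prime_factors (nat \<bar>a\<bar>) \<union> prime_factors (nat \<bar>coeff g 0\<bar>)"
  have "(\<Sum>v\<in>insert 0 P. \<Sum>y\<in>#X. ln (place v y)) = 0"
    if P: "finite P" "P0 \<subseteq> P" "\<forall>p\<in>P. prime p" for P
  proof -
    have "(\<Sum>v\<in>insert 0 P. \<Sum>y\<in>#X. ln (place v y))
        = (\<Sum>v\<in>insert 0 P. ln (place v (of_int (coeff g 0))) - ln (place v (of_int a)))"
      using P loc by (intro sum.cong) auto
    also have "\<dots> = 0"
      using P a g0 unfolding sum_subtractf
      by (subst (1 2) sum_ln_place_int) (auto simp: P0_def)
    finally show ?thesis .
  qed
  then show ?thesis unfolding X_def by (intro exI[of _ P0]) (auto simp: P0_def)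
qed

section \<open>Places of a number field\<close>

text \<open>The index set consists of pairs of an embedding of \<^term>\<open>K\<close> and a place of the rationals
  (0 for the archimedean one). Since only finitely many places are included, the product formula and the
  exact value of the height are only available on the finite set \<^term>\<open>X\<close>.\<close>

definition height_places ::
  "complex set \<Rightarrow> complex set \<Rightarrow> (nat \<times> nat) set \<Rightarrow> (nat \<times> nat \<Rightarrow> complex \<Rightarrow> real) \<Rightarrow> (nat \<times> nat \<Rightarrow> real) \<Rightarrow> real \<Rightarrow> bool" where
  "height_places K X I av \<kappa> N \<longleftrightarrow> finite I \<and> N > 0 \<and>
       (\<forall>i\<in>I. abs_value K (\<kappa> i) (av i) \<and> 1 \<le> \<kappa> i) \<and> (\<Sum>i\<in>I. ln (\<kappa> i)) = N * ln 2 \<and>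
       (\<forall>x\<in>K. (\<Sum>i\<in>I. ln (max 1 (av i x))) \<le> N * weil_height x) \<and>
       (\<forall>x\<in>X. (\<Sum>i\<in>I. ln (max 1 (av i x))) = N * weil_height x \<and> (x \<noteq> 0 \<longrightarrow> (\<Sum>i\<in>I. ln (av i x)) = 0))"

lemma height_placesD:
  assumes "height_places K X I av \<kappa> N"
  shows "finite I" "N > 0" "\<forall>i\<in>I. abs_value K (\<kappa> i) (av i) \<and> 1 \<le> \<kappa> i" "(\<Sum>i\<in>I. ln (\<kappa> i)) = N * ln 2"
    "\<forall>x\<in>K. (\<Sum>i\<in>I. ln (max 1 (av i x))) \<le> N * weil_height x"
    "\<forall>x\<in>X. (\<Sum>i\<in>I. ln (max 1 (av i x))) = N * weil_height x \<and> (x \<noteq> 0 \<longrightarrow> (\<Sum>i\<in>I. ln (av i x)) = 0)"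
  using assms unfolding height_places_def by blast+

text \<open>\<open>K\<close> depends on \<open>S\<close> alone, whereas the finite set of places is
  adapted to \<open>X\<close> afterwards: the whole orbit lies in one field, but each of its points
  brings its own primes.\<close>

lemma ex_places:
  assumes "finite S" "\<And>x. x \<in> S \<Longrightarrow> algebraic x"
  obtains K where "is_subfield K" "S \<subseteq> K" "\<And>x. x \<in> K \<Longrightarrow> algebraic x"
    "\<And>X. finite X \<Longrightarrow> X \<subseteq> K \<Longrightarrow> \<exists>I av \<kappa> N. height_places K X I av \<kappa> N"
proof -
  obtain K N and s :: "nat \<Rightarrow> complex \<Rightarrow> complex" where K: "is_subfield K" "S \<subseteq> K" "N > 0"
    and alg: "\<And>x. x \<in> K \<Longrightarrow> algebraic x"
    and emb: "\<And>j. j < N \<Longrightarrow> is_embedding K (s j)"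
    and conj: "\<And>j x. j < N \<Longrightarrow> x \<in> K \<Longrightarrow> poly (min_poly x) (s j x) = 0"
    and avg: "\<And>x F. x \<in> K \<Longrightarrow> real (degree (min_poly x)) * (\<Sum>j<N. F (s j x) :: real)
        = real N * (\<Sum>y\<in>#proots (min_poly x). F y)"
    by (rule ex_embeddings[OF assms]) blast+
  have salg: "algebraic (s j x)" if "j < N" "x \<in> K" for j x
    using min_poly(7)[OF alg[OF that(2)] conj[OF that]] .
  have s0: "s j 0 = 0" if "j < N" for j
  proof -
    have "s j (0 + 0) = s j 0 + s j 0" using emb[OF that] is_subfieldD(1)[OF K(1)] unfolding is_embedding_def by blast
    then show ?thesis by simp
  qed
  show thesis
  proof (rule that[OF K(1,2) alg])
    fix X assume X: "finite X" "X \<subseteq> K"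
    define good where "good x P0 \<longleftrightarrow> finite P0 \<and> (\<forall>p\<in>P0. prime p) \<and> (\<forall>P. finite P \<longrightarrow> P0 \<subseteq> P \<longrightarrow> (\<forall>p\<in>P. prime p)
      \<longrightarrow> (\<Sum>v\<in>insert 0 P. \<Sum>y\<in>#proots (min_poly x). ln (place v y)) = 0)" for x P0
    have "\<exists>P0. good x P0" if x: "x \<in> X - {0}" for x
      unfolding good_def by (rule sum_local_ln_place) (use x X(2) alg in auto)
    then obtain P0 where P0': "\<And>x. x \<in> X - {0} \<Longrightarrow> good x (P0 x)" by metis
    have P0: "finite (P0 x)" "\<forall>p\<in>P0 x. prime p" if "x \<in> X - {0}" for x
      using P0'[OF that] unfolding good_def by - (elim conjE, assumption)+
    \<comment> \<open>The first union serves the product formula on \<open>X\<close>, the second one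
      makes the heights of the elements of \<open>X\<close> exact.\<close>
    define P where "P = (\<Union>x\<in>X - {0}. P0 x) \<union> (\<Union>x\<in>X. prime_factors (nat \<bar>lead_coeff (min_int_poly x)\<bar>))"
    have P: "finite P" unfolding P_def using X(1) P0(1) by (intro finite_UN_I finite_UnI finite_set_mset finite_Diff)
    have P': "prime p" if "p \<in> P" for p
      using that P0(2) in_prime_factors_imp_prime unfolding P_def by blast
    note P = P P'
    have nz: "0 \<notin> P" using P(2)[of 0] by auto
    define I where "I = {..<N} \<times> insert 0 P"
    define av where "av = (\<lambda>(j, v) x. place v (s j x))"
    define \<kappa> where "\<kappa> = (\<lambda>(j :: nat, v :: nat). if v = 0 then 2 else 1 :: real)"
    have avK: "abs_value K (\<kappa> i) (av i) \<and> 1 \<le> \<kappa> i" if i: "i \<in> I" for i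
    proof -
      obtain j v where jv: "i = (j, v)" "j < N" "v = 0 \<or> prime v" using i P(2) unfolding I_def by blast
      note a = abs_value_place[OF jv(3)] and e = emb[OF jv(2), unfolded is_embedding_def]
      have "abs_value K (\<kappa> i) (av i)"
        unfolding abs_value_def jv(1) av_def \<kappa>_def prod.case
        using abs_valueD[OF a] e salg[OF jv(2)] s0[OF jv(2)] by auto
      then show ?thesis by (simp add: \<kappa>_def jv)
    qed
    have sumI: "real (degree (min_poly x)) * (\<Sum>i\<in>I. F (av i x))
        = real N * (\<Sum>v\<in>insert 0 P. \<Sum>y\<in>#proots (min_poly x). F (place v y))"
      if x: "x \<in> K" for x and F :: "real \<Rightarrow> real"
    proof -
      have "(\<Sum>i\<in>I. F (av i x)) = (\<Sum>v\<in>insert 0 P. \<Sum>j<N. F (place v (s j x)))"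
        unfolding I_def av_def by (subst sum.swap) (simp only: sum.cartesian_product' prod.case)
      moreover have "real (degree (min_poly x)) * (\<Sum>j<N. F (place v (s j x)))
          = real N * (\<Sum>y\<in>#proots (min_poly x). F (place v y))" for v
        using avg[OF x, of "\<lambda>y. F (place v y)"] .
      ultimately show ?thesis by (simp only: sum_distrib_left)
    qed
    have dpos: "real (degree (min_poly x)) > 0" if "x \<in> K" for x
      using min_poly(5)[OF alg[OF that]] by simp
    have lnk: "(\<Sum>i\<in>I. ln (\<kappa> i)) = real N * ln 2"
    proof -
      have "(\<Sum>i\<in>I. ln (\<kappa> i)) = (\<Sum>j<N. \<Sum>v\<in>insert 0 P. ln (\<kappa> (j, v)))"
        unfolding I_def by (simp only: sum.cartesian_product')
      moreover have "(\<Sum>v\<in>insert 0 P. ln (\<kappa> (j, v))) = ln 2" for j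
      proof -
        have "(\<Sum>v\<in>P. ln (\<kappa> (j, v))) = 0" using nz by (intro sum.neutral) (auto simp: \<kappa>_def intro!: gr0I)
        then show ?thesis using P(1) nz by (simp add: \<kappa>_def)
      qed
      ultimately show ?thesis by (simp only: sum_constant card_lessThan)
    qed
    have le: "(\<Sum>i\<in>I. ln (max 1 (av i x))) \<le> real N * weil_height x" if x: "x \<in> K" for x
    proof -
      have "real (degree (min_poly x)) * (\<Sum>i\<in>I. ln (max 1 (av i x)))
          \<le> real N * (real (degree (min_poly x)) * weil_height x)"
        unfolding sumI[OF x, of "\<lambda>r. ln (max 1 r)"]
        by (intro mult_left_mono sum_local_le_weil_height alg x P) auto
      then show ?thesis using dpos[OF x] by (simp add: mult.left_commute)
    qed
    have eq: "(\<Sum>i\<in>I. ln (max 1 (av i x))) = real N * weil_height x" if x: "x \<in> X" for x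
    proof -
      have xK: "x \<in> K" using x X by auto
      have "real (degree (min_poly x)) * (\<Sum>i\<in>I. ln (max 1 (av i x)))
          = real N * (real (degree (min_poly x)) * weil_height x)"
        unfolding sumI[OF xK, of "\<lambda>r. ln (max 1 r)"]
        by (subst weil_height_eq_sum_local[OF alg[OF xK] P]) (use x in \<open>auto simp: P_def\<close>)
      then show ?thesis using dpos[OF xK] by (simp add: mult.left_commute)
    qed
    have prod: "(\<Sum>i\<in>I. ln (av i x)) = 0" if x: "x \<in> X" "x \<noteq> 0" for x
    proof -
      have xK: "x \<in> K" using x X by auto
      have "real (degree (min_poly x)) * (\<Sum>i\<in>I. ln (av i x)) = 0"
        unfolding sumI[OF xK, of ln]
      proof -
        have "P0 x \<subseteq> P" using x unfolding P_def by blast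
        moreover have "\<forall>p\<in>P. prime p" using P(2) by blast
        moreover have "good x (P0 x)" using P0' x by blast
        ultimately have "(\<Sum>v\<in>insert 0 P. \<Sum>y\<in>#proots (min_poly x). ln (place v y)) = 0"
          using P(1) unfolding good_def by presburger
        then show "real N * (\<Sum>v\<in>insert 0 P. \<Sum>y\<in>#proots (min_poly x). ln (place v y)) = 0" by simp
      qed
      then show ?thesis using dpos[OF xK] by simp
    qed
    show "\<exists>I av \<kappa> N. height_places K X I av \<kappa> N"
      unfolding height_places_def using avK lnk le eq prod K(3) P(1)
      by (intro exI[of _ I] exI[of _ av] exI[of _ \<kappa>] exI[of _ "real N"]) (auto simp: I_def)
  qed
qed

section \<open>Local analysis of the orbit\<close>

text \<open>An abstract place: \<open>a\<close>, \<open>b\<close> and \<open>lam\<close> stand for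
  the absolute values of the two coordinates and of the parameter. \<open>dominant\<close> says that
  a sufficiently large term does not cancel, and \<open>crude\<close> is the lower bound provided by
  the resultant of the two forms.\<close>

locale escape =
  fixes a b :: "nat \<Rightarrow> real" and lam \<kappa> :: real and d :: nat
  assumes d: "d \<ge> 2" and nonneg: "\<And>n. 0 \<le> a n" "\<And>n. 0 \<le> b n" and lam: "lam > 0" and \<kappa>: "\<kappa> \<ge> 1"
    and a_le: "\<And>n. a (Suc n) \<le> \<kappa> * max (a n ^ d) (lam * b n ^ d)"
    and b_Suc: "\<And>n. b (Suc n) = a n * b n ^ (d - 1)"
    and dominant: "\<And>n. \<kappa> * (lam * b n ^ d) < a n ^ d \<Longrightarrow> a n ^ d \<le> \<kappa> * a (Suc n)"
    and crude: "\<And>n. min 1 lam * max (a n) (b n) ^ d \<le> \<kappa> * max 1 lam * max (a (Suc n)) (b (Suc n))"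
begin

abbreviation "L \<equiv> max 1 lam"
definition "\<mu> = min 1 lam / (\<kappa> * L)"

lemma \<mu>: "0 < \<mu>" "\<mu> \<le> 1"
proof -
  have "\<kappa> * L \<ge> 1 * 1" using \<kappa> by (intro mult_mono) auto
  then show "0 < \<mu>" "\<mu> \<le> 1" using lam \<kappa> by (auto simp: \<mu>_def divide_le_eq)
qed

lemma mu_step: "\<mu> * max (a n) (b n) ^ d \<le> max (a (Suc n)) (b (Suc n))"
proof -
  have "\<kappa> * L > 0" using \<kappa> by auto
  then show ?thesis using crude[of n] by (simp add: \<mu>_def field_simps)
qed

text \<open>Carrying one factor \<mu> along makes the bound reproduce itself: d >= 2 and \<mu> <= 1
  give \<mu>^d <= \<mu>^2, of which one factor pays for the step and the other is kept. Any number
  of crude steps thus costs only this one factor at the start.\<close>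

lemma mu_iterate:
  assumes "N \<le> n" "0 \<le> t" "t \<le> \<mu> * max (a N) (b N)"
  shows "t ^ d ^ (n - N) \<le> \<mu> * max (a n) (b n)"
  using assms(1)
proof (induction n rule: dec_induct)
  case base
  then show ?case using assms by simp
next
  case (step n)
  define m where "m = max (a n) (b n)"
  have m0: "0 \<le> m" using nonneg by (auto simp: m_def le_max_iff_disj)
  have "t ^ d ^ (Suc n - N) = (t ^ d ^ (n - N)) ^ d"
    using step.hyps by (simp add: Suc_diff_le power_mult[symmetric] mult.commute)
  also have "\<dots> \<le> (\<mu> * m) ^ d"
    using step.IH assms(2) by (intro power_mono) (auto simp: m_def)
  also have "\<dots> = \<mu> ^ d * m ^ d" by (rule power_mult_distrib)
  also have "\<dots> \<le> \<mu> ^ 2 * m ^ d"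
    using \<mu> d m0 by (intro mult_right_mono power_decreasing) auto
  also have "\<dots> = \<mu> * (\<mu> * m ^ d)" by (simp add: power2_eq_square)
  also have "\<dots> \<le> \<mu> * max (a (Suc n)) (b (Suc n))"
    using mu_step[of n] \<mu>(1) by (intro mult_left_mono) (auto simp: m_def)
  finally show ?case .
qed

lemma lower_medium:
  assumes "0 \<le> t" "t \<le> max (a 0) (b 0)"
  shows "(\<mu> * t) ^ d ^ n \<le> max (a n) (b n)"
proof -
  have "(\<mu> * t) ^ d ^ (n - 0) \<le> \<mu> * max (a n) (b n)"
    using assms \<mu>(1) by (intro mu_iterate) auto
  also have "\<dots> \<le> max (a n) (b n)"
    using nonneg[of n] \<mu> mult_right_mono[OF \<mu>(2), of "max (a n) (b n)"] by (simp add: le_max_iff_disj)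
  finally show ?thesis by simp
qed

text \<open>The normalisation by \<kappa>, and by \<open>L\<close> for the second coordinate, turns
  the recursion into q -> q^d. The factor \<open>L\<close> pays for the parameter since lam <= L^d,
  and d >= 2 gives \<kappa>^2 <= \<kappa>^d.\<close>

lemma upper:
  assumes "\<kappa> * a 0 \<le> Q" "\<kappa> * (L * b 0) \<le> Q"
  shows "\<kappa> * a n \<le> Q ^ d ^ n \<and> \<kappa> * (L * b n) \<le> Q ^ d ^ n"
proof (induction n)
  case (Suc n)
  define q where "q = Q ^ d ^ n"
  have IH: "\<kappa> * a n \<le> q" "\<kappa> * (L * b n) \<le> q" using Suc by (auto simp: q_def)
  have qS: "Q ^ d ^ Suc n = q ^ d" by (simp add: q_def power_mult[symmetric] mult.commute)
  have k2: "\<kappa> * \<kappa> \<le> \<kappa> ^ d" using power_increasing[OF d \<kappa>] by (simp add: power2_eq_square)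
  have Ld: "lam \<le> L ^ d" using power_increasing[of 1 d L] d by simp
  have kL: "\<kappa> * L \<ge> 1" using mult_mono[of 1 \<kappa> 1 L] \<kappa> by simp
  have A: "\<kappa> * \<kappa> * a n ^ d \<le> q ^ d"
  proof -
    have "\<kappa> * \<kappa> * a n ^ d \<le> \<kappa> ^ d * a n ^ d" using k2 nonneg by (intro mult_right_mono) auto
    also have "\<dots> = (\<kappa> * a n) ^ d" by (simp add: power_mult_distrib)
    also have "\<dots> \<le> q ^ d" using IH \<kappa> nonneg by (intro power_mono) auto
    finally show ?thesis .
  qed
  have B: "\<kappa> * \<kappa> * (lam * b n ^ d) \<le> q ^ d"
  proof -
    have "\<kappa> * \<kappa> * (lam * b n ^ d) \<le> \<kappa> ^ d * (L ^ d * b n ^ d)"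
      using k2 Ld nonneg lam \<kappa> by (intro mult_mono) auto
    also have "\<dots> = (\<kappa> * (L * b n)) ^ d" by (simp add: power_mult_distrib)
    also have "\<dots> \<le> q ^ d" using IH \<kappa> nonneg by (intro power_mono) auto
    finally show ?thesis .
  qed
  have "\<kappa> * a (Suc n) \<le> \<kappa> * (\<kappa> * max (a n ^ d) (lam * b n ^ d))"
    using a_le[of n] \<kappa> by (intro mult_left_mono) auto
  also have "\<dots> = max (\<kappa> * \<kappa> * a n ^ d) (\<kappa> * \<kappa> * (lam * b n ^ d))"
    using \<kappa> by (simp add: max_mult_distrib_left mult.assoc)
  also have "\<dots> \<le> q ^ d" using A B by simp
  finally have 1: "\<kappa> * a (Suc n) \<le> q ^ d" .
  have "\<kappa> * (L * b (Suc n)) = (\<kappa> * L) * (a n * b n ^ (d - 1))" by (simp add: b_Suc)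
  also have "\<dots> \<le> (\<kappa> * (\<kappa> * L) ^ (d - 1)) * (a n * b n ^ (d - 1))"
  proof (intro mult_right_mono)
    have "\<kappa> * L \<le> (\<kappa> * L) ^ (d - 1)" using power_increasing[OF _ kL, of 1 "d - 1"] d by simp
    also have "\<dots> \<le> \<kappa> * (\<kappa> * L) ^ (d - 1)"
      using mult_right_mono[OF \<kappa>, of "(\<kappa> * L) ^ (d - 1)"] kL by simp
    finally show "\<kappa> * L \<le> \<kappa> * (\<kappa> * L) ^ (d - 1)" .
  qed (use nonneg in auto)
  also have "\<dots> = (\<kappa> * a n) * (\<kappa> * (L * b n)) ^ (d - 1)" by (simp add: power_mult_distrib)
  also have "\<dots> \<le> q * q ^ (d - 1)"
    using IH \<kappa> nonneg by (intro mult_mono power_mono) (auto intro: order_trans[OF _ IH(1)])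
  also have "\<dots> = q ^ d" using d by (simp add: power_Suc[symmetric] del: power_Suc)
  finally show ?case using 1 unfolding qS by simp
qed (use assms in auto)

text \<open>\<rho> and \<rho> s are the lower and upper scale at the start. While a^d dominates,
  nothing is lost. At the first failure N, with S = s^(d^N), the two scales force 1/\<mu> <= S^d, so
  all later crude steps together cost no more than the factor s^d measured at time 0.\<close>

lemma lower:
  assumes \<rho>: "0 < \<rho>" "\<kappa> * \<rho> \<le> a 0" and s: "s \<ge> 1"
    and Q: "\<kappa> * a 0 \<le> \<rho> * s" "\<kappa> * (L * b 0) \<le> \<rho> * s"
  shows "(\<rho> / s ^ d) ^ d ^ n \<le> max (a n) (b n)"
proof -
  \<comment> \<open>The additional \<kappa> reproduces itself: its d-th power contains one factor to
    spend on \<open>dominant\<close> and one to keep.\<close>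
  have grow: "\<kappa> * \<rho> ^ d ^ n \<le> a n" if "\<And>k. k < n \<Longrightarrow> \<kappa> * (lam * b k ^ d) < a k ^ d" for n
    using that
  proof (induction n)
    case (Suc n)
    then have IH: "\<kappa> * \<rho> ^ d ^ n \<le> a n" and dom: "\<kappa> * (lam * b n ^ d) < a n ^ d" by auto
    have "\<kappa> * (\<kappa> * \<rho> ^ d ^ Suc n) = \<kappa> ^ 2 * (\<rho> ^ d ^ n) ^ d"
      by (simp add: power2_eq_square power_mult[symmetric] mult.commute)
    also have "\<dots> \<le> \<kappa> ^ d * (\<rho> ^ d ^ n) ^ d"
      using \<rho> by (intro mult_right_mono power_increasing d \<kappa>) auto
    also have "\<dots> = (\<kappa> * \<rho> ^ d ^ n) ^ d" by (simp add: power_mult_distrib)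
    also have "\<dots> \<le> a n ^ d" using IH \<kappa> \<rho> by (intro power_mono) auto
    also have "\<dots> \<le> \<kappa> * a (Suc n)" by (rule dominant[OF dom])
    finally show ?case using \<kappa> by simp
  qed (use \<rho> in simp)
  show ?thesis
  proof (cases "\<forall>k<n. \<kappa> * (lam * b k ^ d) < a k ^ d")
    case True
    have "(\<rho> / s ^ d) ^ d ^ n \<le> \<rho> ^ d ^ n"
      using \<rho> s by (intro power_mono) (auto simp: divide_le_eq one_le_power)
    also have "\<dots> \<le> \<kappa> * \<rho> ^ d ^ n" using mult_right_mono[OF \<kappa>, of "\<rho> ^ d ^ n"] \<rho> by simp
    also have "\<dots> \<le> a n" using grow True by blast
    finally show ?thesis by simp
  next
    case False
    define N where "N = (LEAST k. \<not> \<kappa> * (lam * b k ^ d) < a k ^ d)"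
    obtain k where k: "k < n" "\<not> \<kappa> * (lam * b k ^ d) < a k ^ d" using False by blast
    have N: "\<not> \<kappa> * (lam * b N ^ d) < a N ^ d" unfolding N_def by (rule LeastI[of _ k]) (rule k)
    have "N \<le> k" unfolding N_def by (rule Least_le) (rule k)
    then have Nn: "N \<le> n" using k by simp
    have aN: "\<kappa> * \<rho> ^ d ^ N \<le> a N"
      by (rule grow) (use not_less_Least N_def in blast)
    define q where "q = \<rho> ^ d ^ N"
    define S where "S = s ^ d ^ N"
    have q: "q > 0" using \<rho> by (simp add: q_def)
    have S: "S \<ge> 1" using s by (simp add: S_def one_le_power)
    have bN: "\<kappa> * (L * b N) \<le> q * S"
      using upper[OF Q, of N] by (simp add: q_def S_def power_mult_distrib)
    \<comment> \<open>Failure at N bounds a_N^d by \<kappa> lam b_N^d. The lower bound for a_N and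
      the upper bound for b_N eliminate both coordinates and leave a condition on
      \<open>lam\<close>.\<close>
    have "\<kappa> * L ^ d * q ^ d \<le> lam * S ^ d * q ^ d"
    proof -
      have "\<kappa> ^ d * q ^ d \<le> a N ^ d"
        using aN \<kappa> q by (simp add: power_mult_distrib[symmetric] q_def power_mono)
      also have "\<dots> \<le> \<kappa> * (lam * b N ^ d)" using N by simp
      finally have "(\<kappa> * L) ^ d * (\<kappa> ^ d * q ^ d) \<le> (\<kappa> * L) ^ d * (\<kappa> * (lam * b N ^ d))"
        using \<kappa> by (intro mult_left_mono) auto
      also have "\<dots> = \<kappa> * lam * (\<kappa> * (L * b N)) ^ d" by (simp add: power_mult_distrib)
      also have "\<dots> \<le> \<kappa> * lam * (q * S) ^ d"
        using bN \<kappa> lam nonneg by (intro mult_left_mono power_mono) auto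
      finally have 1: "\<kappa> * (\<kappa> ^ (d - 1) * \<kappa> ^ d * L ^ d * q ^ d) \<le> \<kappa> * (lam * S ^ d * q ^ d)"
        using d by (cases d) (auto simp: power_mult_distrib mult_ac)
      have "\<kappa> * (L ^ d * q ^ d) \<le> (\<kappa> ^ (d - 1) * \<kappa> ^ d) * (L ^ d * q ^ d)"
      proof (rule mult_right_mono)
        show "\<kappa> \<le> \<kappa> ^ (d - 1) * \<kappa> ^ d"
        proof -
          have "\<kappa> ^ 1 \<le> \<kappa> ^ (d - 1 + d)" using d \<kappa> by (intro power_increasing) auto
          then show ?thesis by (simp only: power_add power_one_right)
        qed
      qed (use q in auto)
      also have "\<dots> \<le> lam * S ^ d * q ^ d" using 1 \<kappa> by (simp add: mult_ac)
      finally show ?thesis by (simp add: mult_ac)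
    qed
    then have key: "\<kappa> * L ^ d \<le> lam * S ^ d" using q by simp
    \<comment> \<open>For lam <= 1 the condition bounds 1/lam, for lam > 1 it bounds lam itself. In
      the second case d >= 2 ensures that a power of lam remains on the left after
      cancellation.\<close>
    have Sd: "1 \<le> \<mu> * S ^ d"
    proof (cases "lam \<le> 1")
      case True
      then show ?thesis using key \<kappa> by (simp add: \<mu>_def field_simps)
    next
      case False
      then have "\<kappa> * lam ^ d \<le> lam * S ^ d" using key by simp
      moreover have "\<kappa> * lam ^ 2 \<le> \<kappa> * lam ^ d"
        using False \<kappa> d by (intro mult_left_mono power_increasing) auto
      ultimately have "lam * (\<kappa> * lam) \<le> lam * S ^ d" by (simp add: power2_eq_square mult_ac)
      then have "\<kappa> * lam \<le> S ^ d" using lam by simp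
      then show ?thesis using False \<kappa> lam by (simp add: \<mu>_def field_simps)
    qed
    have "q \<le> \<kappa> * q" using mult_right_mono[OF \<kappa>, of q] q by simp
    then have "q \<le> max (a N) (b N)" using aN by (simp add: q_def)
    then have "\<mu> * q \<le> \<mu> * max (a N) (b N)" using \<mu>(1) by (intro mult_left_mono) auto
    moreover have "q / S ^ d \<le> \<mu> * q"
      using mult_right_mono[OF Sd, of q] q S by (simp add: field_simps)
    ultimately have "(q / S ^ d) ^ d ^ (n - N) \<le> \<mu> * max (a n) (b n)"
      using q S by (intro mu_iterate Nn) auto
    also have "\<dots> \<le> max (a n) (b n)"
      using nonneg[of n] mult_right_mono[OF \<mu>(2), of "max (a n) (b n)"] by (simp add: le_max_iff_disj)
    also have "q / S ^ d = (\<rho> / s ^ d) ^ d ^ N"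
      by (simp add: q_def S_def power_divide power_mult[symmetric] mult.commute)
    also have "\<dots> ^ d ^ (n - N) = (\<rho> / s ^ d) ^ d ^ n"
      using Nn by (simp add: power_mult[symmetric] power_add[symmetric])
    finally show ?thesis .
  qed
qed

end

text \<open>Horner's scheme: an addition costs a factor \<kappa>, a multiplication by
  \<open>x\<close> a factor max(1, |x|).\<close>

lemma abs_value_poly_le:
  assumes K: "is_subfield K" and v: "abs_value K \<kappa> v" and \<kappa>: "\<kappa> \<ge> 1"
    and f: "f \<in> polys_over K" and x: "x \<in> K" and M: "\<And>i. v (coeff f i) \<le> M" and n: "degree f \<le> n"
  shows "v (poly f x) \<le> M * \<kappa> ^ Suc n * max 1 (v x) ^ n"
  using f M n
proof (induction n arbitrary: f)
  case 0
  then obtain c where c: "f = [:c:]" by (auto elim: degree_eq_zeroE)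
  then have "v c \<le> M" "0 \<le> M"
    using 0(2)[of 0] 0(2)[of 1] abs_valueD(1)[OF v] by auto
  then show ?case using c \<kappa> mult_left_mono[OF \<kappa>, of M] by simp
next
  case (Suc n)
  obtain c g where f: "f = pCons c g" by (cases f)
  have g: "g \<in> polys_over K" and c: "c \<in> K"
    using Suc.prems(1) polys_over_coeff[OF K Suc.prems(1), of 0] polys_over_coeff[OF K Suc.prems(1), of "Suc _"]
    by (auto simp: f polys_over_def)
  have Mg: "v (coeff g i) \<le> M" for i using Suc.prems(2)[of "Suc i"] by (simp add: f)
  have Mc: "v c \<le> M" using Suc.prems(2)[of 0] by (simp add: f)
  have "degree g \<le> n" using Suc.prems(3) by (auto simp: f split: if_splits)
  from Suc.IH[OF g Mg this] have IH: "v (poly g x) \<le> M * \<kappa> ^ Suc n * max 1 (v x) ^ n" .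
  have M0: "0 \<le> M" using Mc abs_valueD(3)[OF v c] by simp
  have gx: "poly g x \<in> K" by (rule polys_over_poly[OF K g x])
  have xg: "x * poly g x \<in> K" by (rule is_subfieldD(4)[OF K x gx])
  have "v (x * poly g x) = v x * v (poly g x)" by (rule abs_valueD(4)[OF v x gx])
  also have "\<dots> \<le> max 1 (v x) * (M * \<kappa> ^ Suc n * max 1 (v x) ^ n)"
    using IH abs_valueD(3)[OF v gx] by (intro mult_mono) auto
  finally have 1: "v (x * poly g x) \<le> M * \<kappa> ^ Suc n * max 1 (v x) ^ Suc n" by (simp add: mult_ac)
  have "1 * 1 \<le> \<kappa> ^ Suc n * max 1 (v x) ^ Suc n"
    using \<kappa> by (intro mult_mono one_le_power) auto
  from mult_left_mono[OF this M0] have 2: "v c \<le> M * \<kappa> ^ Suc n * max 1 (v x) ^ Suc n"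
    using Mc by (simp add: mult.assoc)
  have "v (c + x * poly g x) \<le> \<kappa> * max (v c) (v (x * poly g x))"
    by (rule abs_valueD(5)[OF v c xg])
  also have "\<dots> \<le> \<kappa> * (M * \<kappa> ^ Suc n * max 1 (v x) ^ Suc n)"
    using 1 2 \<kappa> by (intro mult_left_mono) auto
  finally show ?case by (simp add: f mult_ac)
qed

section \<open>The orbit of a polynomial starting pair at one place\<close>

context
  fixes K \<kappa> v a b lam d
  assumes K: "is_subfield K" and v: "abs_value K \<kappa> v" and \<kappa>: "\<kappa> \<ge> 1" and d: "d \<ge> 2"
    and lam: "lam \<in> K" "lam \<noteq> 0" and ab0: "a 0 \<in> K" "b 0 \<in> K"
    and aS: "\<And>n. a (Suc n) = a n ^ d + lam * b n ^ d" and bS: "\<And>n. b (Suc n) = a n * b n ^ (d - 1)"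
begin

lemma orbit_in_subfield: "a n \<in> K" "b n \<in> K"
proof -
  have "a n \<in> K \<and> b n \<in> K"
    by (induction n) (auto simp: ab0 aS bS intro!: is_subfieldD[OF K] subfield_power[OF K] lam)
  then show "a n \<in> K" "b n \<in> K" by auto
qed

text \<open>Only \<open>crude\<close> needs more than the rules for absolute values. Two elimination
  identities recover lam b^(2d-1) and a^(2d-1) from the next pair; the one belonging to the larger
  coordinate is used, so that a power of this coordinate can be cancelled.\<close>

lemma escape_abs_value: "escape (\<lambda>n. v (a n)) (\<lambda>n. v (b n)) (v lam) \<kappa> d"
proof
  note inK = orbit_in_subfield lam(1) subfield_power[OF K orbit_in_subfield(1)] subfield_power[OF K orbit_in_subfield(2)]
  note vm = abs_valueD(4)[OF v] and vp = abs_value_power[OF K v]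
  have lbK: "lam * b n ^ d \<in> K" for n by (intro is_subfieldD(4)[OF K] inK)
  have vlb: "v (lam * b n ^ d) = v lam * v (b n) ^ d" for n by (simp add: vm vp inK)
  show "0 < v lam" by (rule abs_value_pos[OF K v lam])
  show "0 \<le> v (a n)" "0 \<le> v (b n)" for n using abs_valueD(3)[OF v] inK by auto
  show "v (a (Suc n)) \<le> \<kappa> * max (v (a n) ^ d) (v lam * v (b n) ^ d)" for n
    unfolding aS using abs_valueD(5)[OF v inK(4)[of n d] lbK[of n]] by (simp add: vlb vp inK)
  show "v (b (Suc n)) = v (a n) * v (b n) ^ (d - 1)" for n
    unfolding bS by (simp add: vm vp inK)
  show "v (a n) ^ d \<le> \<kappa> * v (a (Suc n))" if "\<kappa> * (v lam * v (b n) ^ d) < v (a n) ^ d" for n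
    unfolding aS using abs_value_dominant[OF K v inK(4)[of n d] lbK[of n]] that by (simp add: vlb vp inK)
  show "min 1 (v lam) * max (v (a n)) (v (b n)) ^ d \<le> \<kappa> * max 1 (v lam) * max (v (a (Suc n))) (v (b (Suc n)))" for n
  proof -
    define X where "X = v (a n)"
    define Y where "Y = v (b n)"
    define m' where "m' = max (v (a (Suc n))) (v (b (Suc n)))"
    have XY0: "0 \<le> X" "0 \<le> Y" using abs_valueD(3)[OF v] inK by (auto simp: X_def Y_def)
    have m': "v (a (Suc n)) \<le> m'" "v (b (Suc n)) \<le> m'" "0 \<le> m'"
      using abs_valueD(3)[OF v] inK(1)[of "Suc n"] by (auto simp: m'_def le_max_iff_disj)
    have v0: "0 \<le> v (a (Suc n))" "0 \<le> v (b (Suc n))" using abs_valueD(3)[OF v] inK by auto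
    have lam0: "0 \<le> v lam" using abs_valueD(3)[OF v lam(1)] .
    obtain e where e: "d = Suc (Suc e)" using d by (metis add_2_eq_Suc le_Suc_ex)
    show ?thesis
    proof (cases "X \<le> Y")
      case True
      show ?thesis
      proof (cases "Y = 0")
        case False
        have id: "lam * b n ^ d * b n ^ (d - 1) = b n ^ (d - 1) * a (Suc n) + - (a n ^ (d - 1) * b (Suc n))"
          unfolding aS bS e by (simp add: algebra_simps)
        have "v lam * Y ^ d * Y ^ (d - 1) = v (lam * b n ^ d * b n ^ (d - 1))"
          by (simp add: vm vp inK lbK Y_def)
        also have "\<dots> \<le> \<kappa> * max (v (b n ^ (d - 1) * a (Suc n))) (v (- (a n ^ (d - 1) * b (Suc n))))"
          unfolding id by (intro abs_valueD(5)[OF v] is_subfieldD[OF K] inK)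
        also have "\<dots> = \<kappa> * max (Y ^ (d - 1) * v (a (Suc n))) (X ^ (d - 1) * v (b (Suc n)))"
          by (subst abs_value_minus[OF K v]) (simp_all add: vm vp inK is_subfieldD(4)[OF K] X_def Y_def)
        also have "\<dots> \<le> \<kappa> * (Y ^ (d - 1) * m')"
          using \<kappa> m' True XY0 v0 by (intro mult_left_mono max.boundedI mult_mono power_mono) auto
        finally have "(v lam * Y ^ d) * Y ^ (d - 1) \<le> (\<kappa> * m') * Y ^ (d - 1)" by (simp add: mult_ac)
        moreover have "Y ^ (d - 1) > 0" using False XY0 by simp
        ultimately have 1: "v lam * Y ^ d \<le> \<kappa> * m'" by (simp only: mult_le_cancel_right_pos)
        have "min 1 (v lam) * Y ^ d \<le> v lam * Y ^ d" using XY0 by (intro mult_right_mono) auto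
        also have "\<dots> \<le> 1 * (\<kappa> * m')" using 1 by simp
        also have "\<dots> \<le> max 1 (v lam) * (\<kappa> * m')" using \<kappa> m' by (intro mult_right_mono) auto
        finally show ?thesis using True by (simp add: X_def Y_def m'_def mult_ac max_absorb2)
      next
        case Y: True
        then have "max X Y = 0" using True XY0 by simp
        then have "max X Y ^ d = 0" using d by (simp add: power_0_left)
        then have "min 1 (v lam) * max X Y ^ d = 0" by (simp only: mult_zero_right)
        then have "min 1 (v lam) * max X Y ^ d \<le> \<kappa> * max 1 (v lam) * m'" using \<kappa> m' by (simp only:) simp
        then show ?thesis by (simp only: X_def Y_def m'_def)
      qed
    next
      case False
      then have X0: "X > 0" using XY0 by simp
      have id: "a n ^ d * a n ^ (d - 1) = a n ^ (d - 1) * a (Suc n) + - (lam * (a n ^ (d - 2) * b n) * b (Suc n))"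
        unfolding aS bS e by (simp add: algebra_simps)
      have "X ^ d * X ^ (d - 1) = v (a n ^ d * a n ^ (d - 1))"
        by (simp add: vm vp inK X_def)
      also have "\<dots> \<le> \<kappa> * max (v (a n ^ (d - 1) * a (Suc n))) (v (- (lam * (a n ^ (d - 2) * b n) * b (Suc n))))"
        unfolding id by (intro abs_valueD(5)[OF v] is_subfieldD[OF K] inK)
      also have "\<dots> = \<kappa> * max (X ^ (d - 1) * v (a (Suc n))) (v lam * (X ^ (d - 2) * Y) * v (b (Suc n)))"
        by (subst abs_value_minus[OF K v]) (simp_all add: vm vp inK is_subfieldD(4)[OF K] X_def Y_def)
      also have "\<dots> \<le> \<kappa> * (max 1 (v lam) * X ^ (d - 1) * m')"
      proof (intro mult_left_mono max.boundedI)
        show "X ^ (d - 1) * v (a (Suc n)) \<le> max 1 (v lam) * X ^ (d - 1) * m'"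
          using XY0 m' v0 mult_right_mono[of 1 "max 1 (v lam)" "X ^ (d - 1)"] by (intro mult_mono) auto
        have "X ^ (d - 2) * Y \<le> X ^ (d - 2) * X" using False XY0 by (intro mult_left_mono) auto
        also have "\<dots> = X ^ (d - 1)" by (simp add: e)
        finally show "v lam * (X ^ (d - 2) * Y) * v (b (Suc n)) \<le> max 1 (v lam) * X ^ (d - 1) * m'"
          using XY0 m' lam0 abs_valueD(3)[OF v inK(2)[of "Suc n"]] by (intro mult_mono) auto
      qed (use \<kappa> in auto)
      finally have "X ^ d * X ^ (d - 1) \<le> (\<kappa> * max 1 (v lam) * m') * X ^ (d - 1)" by (simp add: mult_ac)
      moreover have "X ^ (d - 1) > 0" using X0 by simp
      ultimately have 1: "X ^ d \<le> \<kappa> * max 1 (v lam) * m'" by (simp only: mult_le_cancel_right_pos)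
      have "min 1 (v lam) * X ^ d \<le> 1 * X ^ d" using XY0 by (intro mult_right_mono) auto
      then show ?thesis using 1 False by (simp add: X_def Y_def m'_def max_absorb1)
    qed
  qed
qed (use \<kappa> d in auto)

end

text \<open>With T = M \<kappa>, the constant term of A dominates for |lam| below T^-(D+3) and the
  leading term for |lam| above T^(D+3); both ranges lead to \<open>escape.lower\<close>. In between,
  the Bezout relation bounds the starting pair from below and \<open>escape.lower_medium\<close>
  applies. The exponent \<open>c\<close> adds up the losses of all ranges and depends only on d, D
  and E.\<close>

lemma local_bounds:
  fixes A B U V :: "complex poly" and a b :: "nat \<Rightarrow> complex" and D E d n :: nat
  defines "c \<equiv> 2 + d * (D + 5) + ((D + 3) * D + (2 * D + 7) + (E + 3 + (D + 3) * E))"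
  assumes K: "is_subfield K" and v: "abs_value K \<kappa> v" and \<kappa>: "\<kappa> \<ge> 1" and d: "d \<ge> 2"
    and lam: "lam \<in> K" "lam \<noteq> 0"
    and polys: "A \<in> polys_over K" "B \<in> polys_over K" "U \<in> polys_over K" "V \<in> polys_over K"
    and degs: "degree A = D" "degree B < D" "degree U \<le> E" "degree V \<le> E"
    and bezout: "U * A + V * B = 1"
    and M: "M \<ge> 1" "\<And>i. v (coeff A i) \<le> M" "\<And>i. v (coeff B i) \<le> M" "\<And>i. v (coeff U i) \<le> M" "\<And>i. v (coeff V i) \<le> M"
      "1 \<le> M * v (lead_coeff A)" "1 \<le> M * v (coeff A 0)"
    and a0: "a 0 = poly A lam" "b 0 = poly B lam"
    and aS: "\<And>n. a (Suc n) = a n ^ d + lam * b n ^ d" and bS: "\<And>n. b (Suc n) = a n * b n ^ (d - 1)"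
  shows "max (v (a n)) (v (b n)) \<le> (max 1 (v lam) ^ D * (M * \<kappa>) ^ c) ^ d ^ n"
    and "(max 1 (v lam) ^ D / (M * \<kappa>) ^ c) ^ d ^ n \<le> max (v (a n)) (v (b n))"
proof -
  note vm = abs_valueD(4)[OF v] and vn = abs_valueD(3)[OF v]
  define T where "T = M * \<kappa>"
  define L where "L = max 1 (v lam)"
  have T: "T \<ge> 1" "M \<le> T" "\<kappa> \<le> T"
    using mult_mono[of 1 M 1 \<kappa>] mult_left_mono[OF \<kappa>, of M] mult_right_mono[OF M(1), of \<kappa>] M(1) \<kappa>
    by (auto simp: T_def)
  have L: "L \<ge> 1" "v lam \<le> L" by (auto simp: L_def)
  have Tp: "T ^ i \<le> T ^ j" if "i \<le> j" for i j using that T by (intro power_increasing)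
  have T1: "1 \<le> T ^ i" for i using T by (simp add: one_le_power)
  have pb: "v (poly f lam) \<le> T ^ (k + 2) * L ^ k"
    if f: "f \<in> polys_over K" "\<And>i. v (coeff f i) \<le> M" "degree f \<le> k" for f k
  proof -
    have "v (poly f lam) \<le> M * \<kappa> ^ Suc k * L ^ k"
      unfolding L_def by (rule abs_value_poly_le[OF K v \<kappa> f(1) lam(1) f(2,3)])
    also have "\<dots> \<le> T * T ^ Suc k * L ^ k"
      using T M \<kappa> L by (intro mult_right_mono mult_mono power_mono) auto
    also have "\<dots> = T ^ (k + 2) * L ^ k" by simp
    finally show ?thesis .
  qed
  have inK0: "a 0 \<in> K" "b 0 \<in> K" unfolding a0 by (intro polys_over_poly[OF K] polys lam)+
  interpret esc: escape "\<lambda>n. v (a n)" "\<lambda>n. v (b n)" "v lam" \<kappa> d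
    by (rule escape_abs_value[OF K v \<kappa> d lam inK0 aS bS])
  have D: "D > 0" using degs by simp
  have A0: "v (a 0) \<le> T ^ (D + 2) * L ^ D" unfolding a0 by (rule pb) (use polys M degs in auto)
  have B0: "v (b 0) \<le> T ^ (D + 1) * L ^ (D - 1)"
  proof -
    have "v (poly B lam) \<le> T ^ (D - 1 + 2) * L ^ (D - 1)" by (rule pb) (use polys M degs in auto)
    also have "D - 1 + 2 = D + 1" using D by simp
    finally show ?thesis by (simp add: a0)
  qed
  \<comment> \<open>The strict inequality deg B < deg A pays for the factor \<open>L\<close> that
    \<open>escape.upper\<close> demands for the second coordinate.\<close>
  have LB0: "L * v (b 0) \<le> T ^ (D + 2) * L ^ D"
  proof -
    have "L * v (b 0) \<le> L * (T ^ (D + 1) * L ^ (D - 1))" using B0 L by (intro mult_left_mono) auto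
    also have "\<dots> = T ^ (D + 1) * L ^ D" using D by (cases D) auto
    also have "\<dots> \<le> T ^ (D + 2) * L ^ D" using L T by (intro mult_right_mono Tp) auto
    finally show ?thesis .
  qed
  define W where "W = T ^ (D + 3) * L ^ D"
  have kW: "\<kappa> * x \<le> W" if "x \<le> T ^ (D + 2) * L ^ D" "0 \<le> x" for x
  proof -
    have "\<kappa> * x \<le> T * (T ^ (D + 2) * L ^ D)" using that T \<kappa> by (intro mult_mono) auto
    also have "\<dots> = T ^ Suc (D + 2) * L ^ D" by (simp only: power_Suc mult.assoc)
    finally show ?thesis by (simp add: W_def numeral_3_eq_3 del: power_Suc)
  qed
  have W: "\<kappa> * v (a 0) \<le> W" "\<kappa> * (L * v (b 0)) \<le> W"
    using kW[OF A0] kW[OF LB0] vn inK0 L by auto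
  have W0: "0 \<le> W" using T L by (simp add: W_def)
  have up: "\<kappa> * v (a n) \<le> W ^ d ^ n" "\<kappa> * (L * v (b n)) \<le> W ^ d ^ n"
    using esc.upper[OF W[unfolded L_def]] by (auto simp: L_def)
  note inK = orbit_in_subfield[OF K v \<kappa> d lam inK0 aS bS]
  have "v (a n) \<le> \<kappa> * v (a n)" using mult_right_mono[OF \<kappa>, of "v (a n)"] vn inK by simp
  moreover have "v (b n) \<le> \<kappa> * (L * v (b n))"
  proof -
    have "1 * 1 \<le> \<kappa> * L" using \<kappa> L by (intro mult_mono) auto
    from mult_right_mono[OF this, of "v (b n)"] show ?thesis using vn inK by (simp add: mult.assoc)
  qed
  ultimately have "max (v (a n)) (v (b n)) \<le> W ^ d ^ n" using up by linarith
  also have "\<dots> \<le> (L ^ D * T ^ c) ^ d ^ n"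
  proof (intro power_mono W0)
    have "1 * (D + 3) \<le> d * (D + 5)" using d by (intro mult_le_mono) auto
    then have "T ^ (D + 3) \<le> T ^ c" by (intro Tp) (simp add: c_def)
    then show "W \<le> L ^ D * T ^ c" unfolding W_def using L by (subst mult.commute) (intro mult_left_mono, auto)
  qed
  finally show "max (v (a n)) (v (b n)) \<le> (max 1 (v lam) ^ D * (M * \<kappa>) ^ c) ^ d ^ n"
    by (simp only: L_def T_def)
  have weaken: "(L ^ D / T ^ c) ^ d ^ n \<le> max (v (a n)) (v (b n))"
    if "(L ^ D / T ^ k) ^ d ^ n \<le> max (v (a n)) (v (b n))" "k \<le> c" for k
  proof -
    have "(L ^ D / T ^ c) ^ d ^ n \<le> (L ^ D / T ^ k) ^ d ^ n"
      using L T that(2) T1[of k] T1[of c] by (intro power_mono divide_left_mono Tp) auto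
    then show ?thesis using that by simp
  qed
  \<comment> \<open>In both outer ranges the first coordinate is as large as its degree permits, up
    to one factor \<open>T\<close>. A second \<open>T\<close> covers the \<kappa> demanded by
    \<open>escape.lower\<close>, whence T^2 in \<rho>; comparison with the upper scale
    \<open>W\<close> gives s = T^(D+5).\<close>
  have low: "(L ^ D / T ^ c) ^ d ^ n \<le> max (v (a n)) (v (b n))" if big: "L ^ D \<le> T * v (a 0)"
  proof -
    define \<rho> where "\<rho> = L ^ D / T ^ 2"
    have \<rho>0: "\<rho> > 0" using L T by (simp add: \<rho>_def)
    have "\<kappa> * \<rho> \<le> T * \<rho>" using T \<rho>0 by (intro mult_right_mono) auto
    also have "\<dots> = L ^ D / T" using T by (simp add: \<rho>_def power2_eq_square)
    also have "\<dots> \<le> v (a 0)" using big T by (simp add: divide_le_eq mult.commute)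
    finally have 1: "\<kappa> * \<rho> \<le> v (a 0)" .
    have 2: "\<rho> * T ^ (D + 5) = W"
    proof -
      have "T ^ (D + 5) = T ^ (D + 3) * T ^ 2" by (simp add: numeral_eq_Suc)
      then show ?thesis using T by (simp add: \<rho>_def W_def)
    qed
    have "(\<rho> / (T ^ (D + 5)) ^ d) ^ d ^ n \<le> max (v (a n)) (v (b n))"
      by (rule esc.lower[OF \<rho>0 1 T1]) (use W 2 in \<open>auto simp: L_def\<close>)
    moreover have "\<rho> / (T ^ (D + 5)) ^ d = L ^ D / T ^ (2 + d * (D + 5))"
    proof -
      have "T ^ (2 + d * (D + 5)) = T ^ 2 * (T ^ (D + 5)) ^ d"
        by (simp only: power_add power_mult mult.commute[of d])
      then show ?thesis by (simp add: \<rho>_def)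
    qed
    ultimately show ?thesis by (intro weaken[of "2 + d * (D + 5)"]) (auto simp: c_def)
  qed
  have lcK: "lead_coeff A \<in> K" "coeff A 0 \<in> K" using polys_over_coeff[OF K polys(1)] by auto
  show "(max 1 (v lam) ^ D / (M * \<kappa>) ^ c) ^ d ^ n \<le> max (v (a n)) (v (b n))"
    unfolding L_def[symmetric] T_def[symmetric]
  \<comment> \<open>The threshold is chosen such that \<kappa> times the largest possible size of
    the nonconstant part of A stays below 1/M, a lower bound for |A(0)|.\<close>
  proof (cases "v lam * T ^ (D + 3) < 1")
    case True
    then have "v lam < 1" using mult_left_mono[OF T1[of "D + 3"] abs_valueD(3)[OF v lam(1)]] by simp
    then have L1: "L = 1" by (simp add: L_def)
    obtain e p where A: "A = pCons e p" by (cases A)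
    have p: "p \<in> polys_over K" "\<And>i. v (coeff p i) \<le> M" "degree p \<le> D"
      using polys(1) M(2)[of "Suc _"] degs(1) by (auto simp: A polys_over_def split: if_splits dest: spec[of _ "Suc _"])
    have px: "poly p lam \<in> K" by (rule polys_over_poly[OF K p(1) lam(1)])
    have "\<kappa> * v (lam * poly p lam) = v lam * (\<kappa> * v (poly p lam))" using vm[OF lam(1) px] by simp
    also have "\<dots> \<le> v lam * (\<kappa> * T ^ (D + 2))"
      using pb[OF p] L1 \<kappa> abs_valueD(3)[OF v lam(1)] by (intro mult_left_mono) auto
    finally have 1: "\<kappa> * v (lam * poly p lam) \<le> v lam * (\<kappa> * T ^ (D + 2))" .
    have "M * (\<kappa> * v (lam * poly p lam)) \<le> M * (v lam * (\<kappa> * T ^ (D + 2)))"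
      using 1 M by (intro mult_left_mono) auto
    also have "\<dots> = v lam * T ^ (D + 3)" by (simp add: T_def numeral_3_eq_3 mult_ac)
    also have "\<dots> < 1" by (rule True)
    also have "1 \<le> M * v e" using M(7) by (simp add: A)
    finally have "\<kappa> * v (lam * poly p lam) < v e" using M by simp
    then have "v e \<le> \<kappa> * v (e + lam * poly p lam)"
      using lcK(2) px by (intro abs_value_dominant[OF K v]) (auto simp: A intro: is_subfieldD(4)[OF K lam(1)])
    then have "M * v e \<le> T * v (a 0)" using M by (simp add: a0 A T_def mult.assoc)
    then have "L ^ D \<le> T * v (a 0)" using M(7) L1 by (simp add: A)
    then show "(L ^ D / T ^ c) ^ d ^ n \<le> max (v (a n)) (v (b n))" by (rule low)
  next
    case small: False
    show "(L ^ D / T ^ c) ^ d ^ n \<le> max (v (a n)) (v (b n))"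
    proof (cases "v lam > T ^ (D + 3)")
      case True
      then have Lv: "L = v lam" using T1[of "D + 3"] by (simp add: L_def)
      define R where "R = A - monom (lead_coeff A) D"
      have RK: "R \<in> polys_over K" unfolding R_def
        by (intro polys_over_diff[OF K] polys_over_monom[OF K] polys lcK)
      have Rc: "coeff R i = (if i = D then 0 else coeff A i)" for i
        using degs by (simp add: R_def)
      have Rd: "degree R \<le> D - 1"
        by (rule degree_le) (use degs D in \<open>auto simp: Rc coeff_eq_0\<close>)
      have Rx: "poly R lam \<in> K" by (rule polys_over_poly[OF K RK lam(1)])
      have "v (poly R lam) \<le> T ^ (D - 1 + 2) * L ^ (D - 1)"
        by (rule pb[OF RK _ Rd]) (use M abs_valueD(1)[OF v] in \<open>auto simp: Rc\<close>)
      also have "D - 1 + 2 = D + 1" using D by simp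
      finally have 1: "v (poly R lam) \<le> T ^ (D + 1) * L ^ (D - 1)" .
      have lx: "lead_coeff A * lam ^ D \<in> K" by (intro is_subfieldD(4)[OF K] lcK subfield_power[OF K] lam)
      have vlx: "v (lead_coeff A * lam ^ D) = v (lead_coeff A) * L ^ D"
        using vm[OF lcK(1) subfield_power[OF K lam(1)]] abs_value_power[OF K v lam(1)] Lv by simp
      have "1 * L ^ D \<le> M * v (lead_coeff A) * L ^ D" using M(6) L by (intro mult_right_mono) auto
      then have lcL: "L ^ D \<le> M * v (lead_coeff A * lam ^ D)" unfolding vlx by (simp only: mult.assoc mult_1)
      have "M * (\<kappa> * v (poly R lam)) = T * v (poly R lam)" by (simp add: T_def)
      also have "\<dots> \<le> T * (T ^ (D + 1) * L ^ (D - 1))"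
        using 1 T(1) by (intro mult_left_mono) auto
      also have "\<dots> = T ^ (D + 2) * L ^ (D - 1)" by simp
      also have "\<dots> \<le> T ^ (D + 3) * L ^ (D - 1)" using L by (intro mult_right_mono Tp) auto
      also have "\<dots> < L * L ^ (D - 1)" using True L Lv by (intro mult_strict_right_mono) auto
      also have "\<dots> = L ^ D" using D by (cases D) auto
      also have "\<dots> \<le> M * v (lead_coeff A * lam ^ D)" by (rule lcL)
      finally have "\<kappa> * v (poly R lam) < v (lead_coeff A * lam ^ D)" using M by simp
      then have "v (lead_coeff A * lam ^ D) \<le> \<kappa> * v (lead_coeff A * lam ^ D + poly R lam)"
        by (rule abs_value_dominant[OF K v lx Rx])
      also have "lead_coeff A * lam ^ D + poly R lam = a 0" by (simp add: a0 R_def poly_monom)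
      finally have "M * v (lead_coeff A * lam ^ D) \<le> T * v (a 0)" using M by (simp add: T_def mult.assoc)
      with lcL have "L ^ D \<le> T * v (a 0)" by simp
      then show ?thesis by (rule low)
    next
      \<comment> \<open>Here |lam| and its inverse are bounded by powers of \<open>T\<close>, so
        crude steps are affordable from the start.\<close>
      case large: False
      have LT: "L \<le> T ^ (D + 3)" using large T1[of "D + 3"] by (simp add: L_def)
      define F where "F = E + 3 + (D + 3) * E"
      define m0 where "m0 = max (v (a 0)) (v (b 0))"
      have m00: "0 \<le> m0" using vn inK0 by (auto simp: m0_def le_max_iff_disj)
      have UV: "poly U lam \<in> K" "poly V lam \<in> K" by (intro polys_over_poly[OF K] polys lam)+
      have "v (poly U lam * a 0 + poly V lam * b 0) = 1"
        using bezout abs_valueD(2)[OF v] unfolding a0 by (simp add: poly_mult[symmetric] poly_add[symmetric] del: poly_mult poly_add)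
      then have "1 \<le> \<kappa> * max (v (poly U lam * a 0)) (v (poly V lam * b 0))"
        using abs_valueD(5)[OF v is_subfieldD(4)[OF K UV(1) inK0(1)] is_subfieldD(4)[OF K UV(2) inK0(2)]] by simp
      also have "\<dots> \<le> \<kappa> * (T ^ (E + 2) * L ^ E * m0)"
        using pb[OF polys(3) M(4) degs(3)] pb[OF polys(4) M(5) degs(4)] vm[OF UV(1) inK0(1)] vm[OF UV(2) inK0(2)]
          vn UV inK0 \<kappa> T L m00
        by (intro mult_left_mono max.boundedI) (auto simp: m0_def intro!: mult_mono)
      also have "\<dots> \<le> T * (T ^ (E + 2) * (T ^ (D + 3)) ^ E * m0)"
        using T L LT m00 \<kappa> by (intro mult_mono power_mono) auto
      also have "\<dots> = T ^ F * m0"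
      proof -
        have "F = 1 + ((E + 2) + (D + 3) * E)" by (simp add: F_def)
        then show ?thesis by (simp only: power_add power_mult power_one_right mult.assoc)
      qed
      finally have m0: "1 \<le> T ^ F * m0" .
      \<comment> \<open>The exponent is (D + 4) + (D + 3): \<kappa> L is at most T^(D+4), and min(1,
        |lam|) is at least T^-(D+3).\<close>
      have mu: "1 \<le> T ^ (2 * D + 7) * esc.\<mu>"
      proof -
        have small': "1 \<le> T ^ (D + 3) * min 1 (v lam)" using small T1[of "D + 3"] by (simp add: min_def mult.commute)
        have "\<kappa> * L \<le> T ^ (D + 4)"
          using mult_mono[OF T(3) LT] T L by (simp add: numeral_eq_Suc)
        also have "T ^ (D + 4) * 1 \<le> T ^ (D + 4) * (T ^ (D + 3) * min 1 (v lam))"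
          using T1[of "D + 4"] by (intro mult_left_mono small') auto
        also have "\<dots> = T ^ (2 * D + 7) * min 1 (v lam)"
        proof -
          have "2 * D + 7 = (D + 4) + (D + 3)" by simp
          then show ?thesis by (simp only: power_add mult.assoc)
        qed
        finally show ?thesis using \<kappa> L unfolding esc.\<mu>_def L_def[symmetric] by (simp add: le_divide_eq)
      qed
      have "L ^ D / T ^ ((D + 3) * D + (2 * D + 7) + F) \<le> esc.\<mu> * m0"
      proof -
        have "L ^ D \<le> (T ^ (D + 3)) ^ D" using LT L by (intro power_mono) auto
        also have "\<dots> * 1 \<le> (T ^ (D + 3)) ^ D * ((T ^ (2 * D + 7) * esc.\<mu>) * (T ^ F * m0))"
          using T mult_mono[OF mu m0] esc.\<mu> by (intro mult_left_mono) auto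
        also have "\<dots> = T ^ ((D + 3) * D + (2 * D + 7) + F) * (esc.\<mu> * m0)"
        proof -
          have "T ^ ((D + 3) * D + (2 * D + 7) + F) = (T ^ (D + 3)) ^ D * T ^ (2 * D + 7) * T ^ F"
            by (simp only: power_add[of T "(D + 3) * D + (2 * D + 7)" F] power_add[of T "(D + 3) * D" "2 * D + 7"]
                power_mult[of T "D + 3" D])
          then show ?thesis by (simp only: mult_ac)
        qed
        finally show ?thesis using T by (simp add: divide_le_eq mult.commute)
      qed
      then have "(L ^ D / T ^ ((D + 3) * D + (2 * D + 7) + F)) ^ d ^ n \<le> (esc.\<mu> * m0) ^ d ^ n"
        using L T by (intro power_mono) auto
      also have "\<dots> \<le> max (v (a n)) (v (b n))"
        by (rule esc.lower_medium) (use m00 in \<open>auto simp: m0_def\<close>)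
      finally show ?thesis by (rule weaken) (simp add: c_def F_def)
    qed
  qed
qed

section \<open>From local to global heights\<close>

definition proj_point :: "complex \<Rightarrow> complex \<Rightarrow> complex option" where
  "proj_point a b = (if b = 0 then None else Some (a / b))"

lemma proj_point_scale: "k \<noteq> 0 \<Longrightarrow> proj_point (k * a) (k * b) = proj_point a b"
  by (simp add: proj_point_def)

lemma f_map_proj_point:
  assumes "d \<ge> 2" "lam \<noteq> 0" "a \<noteq> 0 \<or> b \<noteq> 0"
  shows "f_map d lam (proj_point a b) = proj_point (a ^ d + lam * b ^ d) (a * b ^ (d - 1))"
proof -
  obtain e where e: "d = Suc (Suc e)" using assms(1) by (metis add_2_eq_Suc le_Suc_ex)
  show ?thesis using assms by (auto simp: proj_point_def e field_simps)
qed

text \<open>max(|a|, |b|) = max(1, |a/b|) |b|, and the product formula removes |b|. At infinity the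
  product formula for \<open>a\<close> gives the height 0.\<close>

lemma height_proj_point:
  assumes K: "is_subfield K" and ab: "a \<in> K" "b \<in> K" "a \<noteq> 0 \<or> b \<noteq> 0"
    and places: "height_places K X I av \<kappa> N" "{a, b, a / b} \<subseteq> X"
  shows "(\<Sum>i\<in>I. ln (max (av i a) (av i b))) = N * height_P1 (proj_point a b)"
proof -
  have I: "abs_value K (\<kappa> i) (av i)" if "i \<in> I" for i using height_placesD(3)[OF places(1)] that by blast
  have zero: "x \<noteq> 0 \<Longrightarrow> (\<Sum>i\<in>I. ln (av i x)) = 0" if "x \<in> {a, b}" for x
    using height_placesD(6)[OF places(1)] places(2) that by blast
  have eq: "(\<Sum>i\<in>I. ln (max 1 (av i (a / b)))) = N * weil_height (a / b)"
    using height_placesD(6)[OF places(1)] places(2) by blast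
  show ?thesis
  proof (cases "b = 0")
    case True
    then have "max (av i a) (av i b) = av i a" if "i \<in> I" for i
      using abs_valueD(1,3)[OF I[OF that]] ab(1) by simp
    then show ?thesis using True zero ab(3) by (simp add: proj_point_def)
  next
    case False
    have "ln (max (av i a) (av i b)) = ln (max 1 (av i (a / b))) + ln (av i b)" if i: "i \<in> I" for i
    proof -
      have pos: "av i b > 0" by (rule abs_value_pos[OF K I[OF i] ab(2) False])
      have "max 1 (av i (a / b)) * av i b = max (av i a) (av i b)"
        using pos by (simp add: abs_value_divide[OF K I[OF i] ab(1,2)] max_mult_distrib_right max.commute)
      moreover have "max 1 (av i (a / b)) > 0" by simp
      ultimately show ?thesis using pos by (metis ln_mult_pos)
    qed
    then show ?thesis using False eq zero by (simp add: sum.distrib proj_point_def)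
  qed
qed

section \<open>Convergence of the canonical height for a fixed parameter\<close>

context
  fixes lam :: complex and d :: nat and a b :: "nat \<Rightarrow> complex"
  assumes d: "d \<ge> 2" and lam: "lam \<noteq> 0" and ab0: "a 0 \<noteq> 0 \<or> b 0 \<noteq> 0"
    and aS: "\<And>n. a (Suc n) = a n ^ d + lam * b n ^ d" and bS: "\<And>n. b (Suc n) = a n * b n ^ (d - 1)"
begin

lemma orbit_nonzero: "a n \<noteq> 0 \<or> b n \<noteq> 0"
proof (induction n)
  case (Suc n)
  obtain e where e: "d = Suc (Suc e)" using d by (metis add_2_eq_Suc le_Suc_ex)
  show ?case using Suc lam by (cases "a n = 0") (auto simp: aS bS e)
qed (use ab0 in simp)

lemma f_map_funpow: "(f_map d lam ^^ n) (proj_point (a 0) (b 0)) = proj_point (a n) (b n)"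
  by (induction n) (simp_all add: f_map_proj_point[OF d lam orbit_nonzero] aS bS)

text \<open>This bound grows with the height of the parameter; it serves to prove convergence for
  one parameter at a time, not uniformity.\<close>

lemma height_step_bound:
  assumes "algebraic lam" "algebraic (a 0)" "algebraic (b 0)"
  shows "\<bar>height_P1 (proj_point (a (Suc n)) (b (Suc n))) - d * height_P1 (proj_point (a n) (b n))\<bar>
    \<le> ln 2 + weil_height lam + weil_height (inverse lam)"
proof -
  obtain K where K: "is_subfield K" "{lam, a 0, b 0} \<subseteq> K" "\<And>x. x \<in> K \<Longrightarrow> algebraic x"
    and places: "\<And>X. finite X \<Longrightarrow> X \<subseteq> K \<Longrightarrow> \<exists>I av \<kappa> N. height_places K X I av \<kappa> N"
    by (rule ex_places[of "{lam, a 0, b 0}"]) (use assms in auto)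
  have inK: "a n \<in> K \<and> b n \<in> K" for n
    by (induction n) (use K(2) in \<open>auto simp: aS bS intro!: is_subfieldD[OF K(1)] subfield_power[OF K(1)]\<close>)
  have ab0K: "a 0 \<in> K" "b 0 \<in> K" using K(2) by auto
  define X where "X = {a n, b n, a n / b n, a (Suc n), b (Suc n), a (Suc n) / b (Suc n)}"
  have "finite X" "X \<subseteq> K"
    using inK[of n] inK[of "Suc n"] is_subfieldD(8)[OF K(1)] by (auto simp: X_def)
  from places[OF this] obtain I av \<kappa> N where places_X: "height_places K X I av \<kappa> N" by blast
  note I = height_placesD[OF this]
  define m where "m k i = max (av i (a k)) (av i (b k))" for k i
  have ht: "(\<Sum>i\<in>I. ln (m k i)) = N * height_P1 (proj_point (a k) (b k))" if k: "k = n \<or> k = Suc n" for k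
    unfolding m_def
    by (rule height_proj_point[OF K(1) _ _ orbit_nonzero places_X]) (use inK k in \<open>auto simp: X_def\<close>)
  have lamK: "lam \<in> K" "inverse lam \<in> K" using K(2) is_subfieldD(6)[OF K(1)] by auto
  have loc: "\<bar>ln (m (Suc n) i) - d * ln (m n i)\<bar> \<le> ln (\<kappa> i) + ln (max 1 (av i lam)) + ln (max 1 (av i (inverse lam)))"
    if i: "i \<in> I" for i
  proof -
    have v: "abs_value K (\<kappa> i) (av i)" and k1: "1 \<le> \<kappa> i" using I(3) i by auto
    interpret esc: escape "\<lambda>n. av i (a n)" "\<lambda>n. av i (b n)" "av i lam" "\<kappa> i" d
      by (rule escape_abs_value[where a = a and b = b, OF K(1) v k1 d lamK(1) lam ab0K aS bS])
    have mpos: "m k i > 0" for k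
      using orbit_nonzero[of k] inK[of k] abs_value_pos[OF K(1) v] by (auto simp: m_def less_max_iff_disj)
    define l where "l = av i lam"
    have l: "l > 0" unfolding l_def by (rule esc.lam)
    have pos: "\<kappa> i > 0" "max 1 l > 0" "max 1 (inverse l) > 0" "m n i ^ d > 0" using k1 mpos by auto
    have up: "m (Suc n) i \<le> (\<kappa> i * max 1 l) * m n i ^ d"
    proof -
      have 1: "av i (a n) ^ d \<le> m n i ^ d" "av i (b n) ^ d \<le> m n i ^ d"
        using esc.nonneg by (auto simp: m_def intro!: power_mono)
      have "max (av i (a n) ^ d) (l * av i (b n) ^ d) \<le> max 1 l * m n i ^ d"
      proof (rule max.boundedI)
        show "av i (a n) ^ d \<le> max 1 l * m n i ^ d"
          using mult_mono[of 1 "max 1 l" "av i (a n) ^ d" "m n i ^ d"] 1 esc.nonneg pos by simp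
        show "l * av i (b n) ^ d \<le> max 1 l * m n i ^ d"
          using 1 esc.nonneg l by (intro mult_mono) auto
      qed
      then have "\<kappa> i * max (av i (a n) ^ d) (l * av i (b n) ^ d) \<le> \<kappa> i * (max 1 l * m n i ^ d)"
        using pos by (intro mult_left_mono) auto
      then have A: "av i (a (Suc n)) \<le> (\<kappa> i * max 1 l) * m n i ^ d"
        using esc.a_le[of n] by (simp add: l_def mult.assoc)
      have "av i (b (Suc n)) \<le> m n i * m n i ^ (d - 1)"
        unfolding esc.b_Suc using esc.nonneg mpos[of n] by (intro mult_mono power_mono) (auto simp: m_def)
      also have "\<dots> = 1 * m n i ^ d" using d by (simp add: power_Suc[symmetric] del: power_Suc)
      also have "\<dots> \<le> (\<kappa> i * max 1 l) * m n i ^ d"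
        using mult_mono[of 1 "\<kappa> i" 1 "max 1 l"] k1 pos by (intro mult_right_mono) auto
      finally show ?thesis using A by (simp add: m_def)
    qed
    have low: "m n i ^ d \<le> (\<kappa> i * max 1 l * max 1 (inverse l)) * m (Suc n) i"
    proof -
      have 1: "1 = min 1 l * max 1 (inverse l)" using l by (auto simp: min_def max_def field_simps)
      have "m n i ^ d = max 1 (inverse l) * (min 1 l * m n i ^ d)" using 1 by (simp add: mult_ac)
      also have "\<dots> \<le> max 1 (inverse l) * (\<kappa> i * max 1 l * m (Suc n) i)"
        using esc.crude[of n] by (intro mult_left_mono) (auto simp: m_def l_def)
      finally show ?thesis by (simp add: mult_ac)
    qed
    have "ln (m (Suc n) i) \<le> ln (\<kappa> i * max 1 l * m n i ^ d)" using up mpos pos by simp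
    also have "\<dots> = ln (\<kappa> i) + ln (max 1 l) + d * ln (m n i)"
      using pos mpos[of n] by (simp add: ln_mult_pos ln_realpow)
    finally have 1: "ln (m (Suc n) i) - d * ln (m n i) \<le> ln (\<kappa> i) + ln (max 1 l)" by simp
    have "d * ln (m n i) = ln (m n i ^ d)" using mpos[of n] by (simp add: ln_realpow)
    also have "\<dots> \<le> ln ((\<kappa> i * max 1 l * max 1 (inverse l)) * m (Suc n) i)"
      using low pos mpos by (subst ln_le_cancel_iff) auto
    also have "\<dots> = ln (\<kappa> i) + ln (max 1 l) + ln (max 1 (inverse l)) + ln (m (Suc n) i)"
      using pos mpos[of "Suc n"] by (simp add: ln_mult_pos)
    finally have 2: "d * ln (m n i) - ln (m (Suc n) i) \<le> ln (\<kappa> i) + ln (max 1 l) + ln (max 1 (inverse l))" by simp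
    have "0 \<le> ln (max 1 (inverse l))" by simp
    then show ?thesis using 1 2 unfolding abs_value_inverse[OF K(1) v lamK(1)] l_def[symmetric] by linarith
  qed
  have "N * \<bar>height_P1 (proj_point (a (Suc n)) (b (Suc n))) - d * height_P1 (proj_point (a n) (b n))\<bar>
      = \<bar>N * height_P1 (proj_point (a (Suc n)) (b (Suc n))) - d * (N * height_P1 (proj_point (a n) (b n)))\<bar>"
    using I(2) by (simp add: right_diff_distrib[symmetric] abs_mult mult.left_commute)
  also have "\<dots> = \<bar>\<Sum>i\<in>I. ln (m (Suc n) i) - d * ln (m n i)\<bar>"
    by (simp add: ht[symmetric] sum_subtractf sum_distrib_left)
  also have "\<dots> \<le> (\<Sum>i\<in>I. ln (\<kappa> i) + ln (max 1 (av i lam)) + ln (max 1 (av i (inverse lam))))"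
    by (intro order_trans[OF sum_abs] sum_mono loc)
  also have "\<dots> \<le> N * ln 2 + N * weil_height lam + N * weil_height (inverse lam)"
    unfolding sum.distrib using I(4,5) lamK by (intro add_mono) auto
  also have "\<dots> = N * (ln 2 + weil_height lam + weil_height (inverse lam))" by (simp add: algebra_simps)
  finally show ?thesis using I(2) by simp
qed

text \<open>Consecutive differences are dominated by a geometric series of ratio 1/2. Only with
  convergence does the \<open>lim\<close> in \<open>canonical_height\<close> carry
  information.\<close>

lemma height_convergent:
  assumes "algebraic lam" "algebraic (a 0)" "algebraic (b 0)"
  shows "convergent (\<lambda>n. height_P1 (proj_point (a n) (b n)) / real d ^ n)"
proof -
  define h where "h n = height_P1 (proj_point (a n) (b n))" for n
  define C where "C = ln 2 + weil_height lam + weil_height (inverse lam)"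
  define x where "x n = h n / real d ^ n" for n
  have d0: "real d > 0" using d by simp
  have diff: "norm (x (Suc n) - x n) \<le> C * (1 / 2) ^ n" for n
  proof -
    have b: "\<bar>h (Suc n) - d * h n\<bar> \<le> C" unfolding h_def C_def by (rule height_step_bound[OF assms])
    then have C0: "0 \<le> C" by linarith
    have "x (Suc n) - x n = (h (Suc n) - d * h n) / real d ^ Suc n"
      using d0 by (simp add: x_def field_simps)
    then have "norm (x (Suc n) - x n) = \<bar>h (Suc n) - d * h n\<bar> / real d ^ Suc n" by (simp add: abs_divide)
    also have "\<dots> \<le> C / 2 ^ n"
    proof (intro frac_le b C0)
      have "(2 :: real) ^ n \<le> real d ^ n" using d by (intro power_mono) auto
      also have "\<dots> \<le> real d ^ Suc n" using d by (intro power_increasing) auto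
      finally show "(2 :: real) ^ n \<le> real d ^ Suc n" .
    qed auto
    finally show ?thesis by (simp add: power_divide)
  qed
  have "summable (\<lambda>n. C * (1 / 2 :: real) ^ n)" by (intro summable_mult summable_geometric) simp
  then have "summable (\<lambda>n. x (Suc n) - x n)"
    using diff by (rule summable_comparison_test'[where N = 0])
  then have "convergent (\<lambda>n. \<Sum>k<n. x (Suc k) - x k)" by (simp add: summable_iff_convergent)
  then have "convergent (\<lambda>n. x n - x 0)" by (simp add: sum_lessThan_telescope)
  then have "convergent (\<lambda>n. x n - x 0 + x 0)" by (intro convergent_add convergent_const)
  then show ?thesis by (simp add: x_def h_def)
qed

end

text \<open>The constant is uniform although field and places are chosen after lam and n: summed
  over the places, the local constants give at most heights of elements of the fixed set
  \<open>S\<close>, and the normalisation N d^n cancels.\<close>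

lemma height_orbit_bound:
  fixes A B U V :: "complex poly"
  assumes d: "d \<ge> 2"
    and polys: "A \<in> polys_over {x. algebraic x}" "B \<in> polys_over {x. algebraic x}"
      "U \<in> polys_over {x. algebraic x}" "V \<in> polys_over {x. algebraic x}"
    and degs: "degree B < degree A" and bezout: "U * A + V * B = 1" and A0: "coeff A 0 \<noteq> 0"
  shows "\<exists>C. \<forall>lam a b n. algebraic lam \<longrightarrow> lam \<noteq> 0 \<longrightarrow> a 0 = poly A lam \<longrightarrow> b 0 = poly B lam \<longrightarrow>
     (\<forall>n. a (Suc n) = a n ^ d + lam * b n ^ d) \<longrightarrow> (\<forall>n. b (Suc n) = a n * b n ^ (d - 1)) \<longrightarrow>
     \<bar>height_P1 (proj_point (a n) (b n)) / real d ^ n - real (degree A) * weil_height lam\<bar> \<le> C"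
proof -
  \<comment> \<open>The two inverses provide the lower bounds for the outer coefficients of A in
    \<open>local_bounds\<close>, and 0 accounts for coefficients beyond the degree.\<close>
  define S where "S = {0, inverse (lead_coeff A), inverse (coeff A 0)} \<union> (\<Union>f\<in>{A, B, U, V}. coeff f ` {..degree f})"
  have S: "finite S" by (simp add: S_def)
  have Salg: "algebraic s" if "s \<in> S" for s
    using that polys by (auto simp: S_def polys_over_def)
  have coeffS: "coeff f i \<in> S" if "f \<in> {A, B, U, V}" for f i
  proof (cases "i \<le> degree f")
    case True
    then show ?thesis using that unfolding S_def by blast
  next
    case False
    then show ?thesis by (simp add: S_def coeff_eq_0)
  qed
  define D where "D = degree A"
  define E where "E = max (degree U) (degree V)"
  define c where "c = 2 + d * (D + 5) + ((D + 3) * D + (2 * D + 7) + (E + 3 + (D + 3) * E))"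
  have "\<bar>height_P1 (proj_point (a n) (b n)) / real d ^ n - real D * weil_height lam\<bar>
      \<le> c * ((\<Sum>s\<in>S. weil_height s) + ln 2)"
    if lam: "algebraic lam" "lam \<noteq> 0" and a0: "a 0 = poly A lam" "b 0 = poly B lam"
      and aS: "\<And>n. a (Suc n) = a n ^ d + lam * b n ^ d" and bS: "\<And>n. b (Suc n) = a n * b n ^ (d - 1)" for lam a b n
  proof -
    obtain K where K: "is_subfield K" "insert lam S \<subseteq> K" "\<And>x. x \<in> K \<Longrightarrow> algebraic x"
      and places: "\<And>X. finite X \<Longrightarrow> X \<subseteq> K \<Longrightarrow> \<exists>I av \<kappa> N. height_places K X I av \<kappa> N"
      by (rule ex_places[of "insert lam S"]) (use S Salg lam in auto)
    have pK: "A \<in> polys_over K" "B \<in> polys_over K" "U \<in> polys_over K" "V \<in> polys_over K"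
      using coeffS K(2) unfolding polys_over_def by blast+
    have lamK: "lam \<in> K" using K(2) by simp
    have ab0K: "a 0 \<in> K" "b 0 \<in> K" unfolding a0 by (intro polys_over_poly[OF K(1)] pK lamK)+
    have inK: "a n \<in> K \<and> b n \<in> K" for n
      by (induction n) (use ab0K lamK in \<open>auto simp: aS bS intro!: is_subfieldD[OF K(1)] subfield_power[OF K(1)]\<close>)
    have nz0: "a 0 \<noteq> 0 \<or> b 0 \<noteq> 0"
    proof (rule ccontr)
      assume "\<not> ?thesis"
      then have "poly (U * A + V * B) lam = 0" using a0 by simp
      then show False by (simp add: bezout)
    qed
    have nz: "a n \<noteq> 0 \<or> b n \<noteq> 0" by (rule orbit_nonzero[OF d lam(2) nz0 aS bS])
    \<comment> \<open>Exact heights and the product formula are required for the n-th point and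
      exact height for lam; for the elements of \<open>S\<close> the upper bound valid on all of
      \<open>K\<close> is enough.\<close>
    define X where "X = {a n, b n, a n / b n, lam}"
    have "finite X" "X \<subseteq> K" using inK[of n] is_subfieldD(8)[OF K(1)] lamK by (auto simp: X_def)
    from places[OF this] obtain I av \<kappa> N where places_X: "height_places K X I av \<kappa> N" by blast
  note I = height_placesD[OF this]
    define m where "m i = max (av i (a n)) (av i (b n))" for i
    have ht: "(\<Sum>i\<in>I. ln (m i)) = N * height_P1 (proj_point (a n) (b n))"
      unfolding m_def
      by (rule height_proj_point[OF K(1) _ _ nz places_X]) (use inK in \<open>auto simp: X_def\<close>)
    \<comment> \<open>A product rather than a maximum: its logarithm is a sum over \<open>S\<close>,
      and each summand adds up over the places to at most a height.\<close>
    define M where "M i = (\<Prod>s\<in>S. max 1 (av i s))" for i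
    have M1: "M i \<ge> 1" for i unfolding M_def by (intro prod_ge_1) auto
    have MS: "av i s \<le> M i" if "s \<in> S" for i s
    proof -
      have "max 1 (av i s) \<le> max 1 (av i s) * (\<Prod>s\<in>S - {s}. max 1 (av i s))"
        using mult_left_mono[OF prod_ge_1[of "S - {s}" "\<lambda>s. max 1 (av i s)"], of "max 1 (av i s)"] by simp
      also have "\<dots> = M i" unfolding M_def using S that by (simp add: prod.remove)
      finally show ?thesis by simp
    qed
    have inv: "1 \<le> M i * av i x" if i: "i \<in> I" and x: "x \<noteq> 0" "x \<in> S" "inverse x \<in> S" for i x
    proof -
      have v: "abs_value K (\<kappa> i) (av i)" using I(3) i by auto
      have xK: "x \<in> K" using x K(2) by auto
      have pos: "av i x > 0" by (rule abs_value_pos[OF K(1) v xK x(1)])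
      have "inverse (av i x) \<le> M i" using MS[OF x(3), of i] abs_value_inverse[OF K(1) v xK] by simp
      then show ?thesis using pos by (simp add: field_simps)
    qed
    have An: "A \<noteq> 0" using A0 by auto
    have loc: "\<bar>ln (m i) - real d ^ n * (real D * ln (max 1 (av i lam)))\<bar> \<le> real d ^ n * (c * (ln (M i) + ln (\<kappa> i)))"
      if i: "i \<in> I" for i
    proof -
      have v: "abs_value K (\<kappa> i) (av i)" and k1: "1 \<le> \<kappa> i" using I(3) i by auto
      have co: "av i (coeff f j) \<le> M i" if "f \<in> {A, B, U, V}" for f j by (rule MS[OF coeffS[OF that]])
      have lcS: "inverse (lead_coeff A) \<in> S" "inverse (coeff A 0) \<in> S" by (auto simp: S_def)
      note bounds = local_bounds[where E = E and n = n and a = a and b = b,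
          OF K(1) v k1 d lamK lam(2) pK D_def[symmetric] _ _ _ bezout M1 _ _ _ _ _ _ a0 aS bS, folded c_def]
      define Lm where "Lm = max 1 (av i lam)"
      define T where "T = M i * \<kappa> i"
      have T: "T > 0" using M1[of i] k1 by (simp add: T_def)
      have up: "m i \<le> (Lm ^ D * T ^ c) ^ d ^ n" unfolding m_def Lm_def T_def
        by (rule bounds(1)) (use degs co inv[OF i] coeffS lcS An A0 in \<open>auto simp: D_def E_def\<close>)
      have low: "(Lm ^ D / T ^ c) ^ d ^ n \<le> m i" unfolding m_def Lm_def T_def
        by (rule bounds(2)) (use degs co inv[OF i] coeffS lcS An A0 in \<open>auto simp: D_def E_def\<close>)
      have Lm: "Lm > 0" by (simp add: Lm_def)
      have m0: "m i > 0" using nz inK[of n] abs_value_pos[OF K(1) v] by (auto simp: m_def less_max_iff_disj)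
      have lnT: "ln T = ln (M i) + ln (\<kappa> i)" unfolding T_def using M1[of i] k1 by (simp add: ln_mult_pos)
      have "ln (m i) \<le> ln ((Lm ^ D * T ^ c) ^ d ^ n)" using up m0 T Lm by (subst ln_le_cancel_iff) auto
      also have "\<dots> = real d ^ n * (D * ln Lm + c * ln T)"
        using T Lm by (simp add: ln_realpow ln_mult_pos)
      finally have 1: "ln (m i) \<le> real d ^ n * (D * ln Lm + c * ln T)" .
      have "real d ^ n * (D * ln Lm - c * ln T) = ln ((Lm ^ D / T ^ c) ^ d ^ n)"
        using T Lm by (simp add: ln_realpow ln_div)
      also have "\<dots> \<le> ln (m i)" using low m0 T Lm by (subst ln_le_cancel_iff) auto
      finally have 2: "real d ^ n * (D * ln Lm - c * ln T) \<le> ln (m i)" .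
      show ?thesis using 1 2 unfolding lnT[symmetric] Lm_def[symmetric]
        by (simp add: abs_le_iff right_diff_distrib distrib_left)
    qed
    have lnM: "(\<Sum>i\<in>I. ln (M i)) \<le> N * (\<Sum>s\<in>S. weil_height s)"
    proof -
      have "(\<Sum>i\<in>I. ln (M i)) = (\<Sum>i\<in>I. \<Sum>s\<in>S. ln (max 1 (av i s)))"
        unfolding M_def using S by (intro sum.cong refl ln_prod) auto
      also have "\<dots> = (\<Sum>s\<in>S. \<Sum>i\<in>I. ln (max 1 (av i s)))" by (rule sum.swap)
      also have "\<dots> \<le> (\<Sum>s\<in>S. N * weil_height s)" using I(5) K(2) by (intro sum_mono) auto
      finally show ?thesis by (simp add: sum_distrib_left)
    qed
    have hl: "(\<Sum>i\<in>I. ln (max 1 (av i lam))) = N * weil_height lam" using I(6) by (simp add: X_def)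
    have dn: "real d ^ n > 0" using d by simp
    have "\<bar>N * height_P1 (proj_point (a n) (b n)) - real d ^ n * (real D * (N * weil_height lam))\<bar>
        = \<bar>\<Sum>i\<in>I. ln (m i) - real d ^ n * (real D * ln (max 1 (av i lam)))\<bar>"
      unfolding ht[symmetric] hl[symmetric] by (simp add: sum_subtractf sum_distrib_left)
    also have "\<dots> \<le> (\<Sum>i\<in>I. real d ^ n * (c * (ln (M i) + ln (\<kappa> i))))"
      by (intro order_trans[OF sum_abs] sum_mono loc)
    also have "\<dots> = real d ^ n * (c * ((\<Sum>i\<in>I. ln (M i)) + N * ln 2))"
      by (simp only: I(4)[symmetric] sum.distrib[symmetric] sum_distrib_left[symmetric])
    also have "\<dots> \<le> real d ^ n * (c * (N * (\<Sum>s\<in>S. weil_height s) + N * ln 2))"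
      using lnM dn I(2) by (intro mult_left_mono add_mono) auto
    finally have "\<bar>N * height_P1 (proj_point (a n) (b n)) - real d ^ n * (real D * (N * weil_height lam))\<bar>
       \<le> (N * real d ^ n) * (c * ((\<Sum>s\<in>S. weil_height s) + ln 2))" by (simp add: algebra_simps)
    moreover have "N * height_P1 (proj_point (a n) (b n)) - real d ^ n * (real D * (N * weil_height lam))
       = (N * real d ^ n) * (height_P1 (proj_point (a n) (b n)) / real d ^ n - real D * weil_height lam)"
    proof -
      have "N * h - z * (r * (N * w)) = (N * z) * (h / z - r * w)" if "z > 0" for h z r w :: real
        using that by (simp add: field_simps)
      then show ?thesis using dn by blast
    qed
    ultimately have "(N * real d ^ n) * \<bar>height_P1 (proj_point (a n) (b n)) / real d ^ n - real D * weil_height lam\<bar>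
       \<le> (N * real d ^ n) * (c * ((\<Sum>s\<in>S. weil_height s) + ln 2))"
      using I(2) dn by (simp add: abs_mult)
    then show ?thesis using I(2) dn by (simp only: mult_le_cancel_left_pos mult_pos_pos)
  qed
  then show ?thesis unfolding D_def by blast
qed

section \<open>The generic fibre\<close>

lemma coprime_no_common_root:
  assumes "coprime (p :: complex poly) q" "poly p x = 0" "poly q x = 0"
  shows False
proof -
  have "[:-x, 1:] dvd p" "[:-x, 1:] dvd q" using assms by (simp_all add: poly_eq_0_iff_dvd)
  then have "[:-x, 1:] dvd 1" using assms(1) by (rule coprime_common_divisor[rotated])
  then show False by (simp add: poly_dvd_1)
qed

lemma no_common_root_coprime:
  assumes "q \<noteq> 0" "\<And>x. poly p x = 0 \<Longrightarrow> poly q x = 0 \<Longrightarrow> False"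
  shows "coprime (p :: complex poly) q"
proof (rule coprimeI)
  fix g assume g: "g dvd p" "g dvd q"
  have g0: "g \<noteq> 0" using g(2) assms(1) by auto
  have "degree g = 0"
  proof (rule ccontr)
    assume "degree g \<noteq> 0"
    then have "\<not> constant (poly g)" by (simp add: constant_degree)
    then obtain x where "poly g x = 0" using fundamental_theorem_of_algebra by blast
    then show False using assms(2)[of x] g by (auto elim!: dvdE)
  qed
  then show "g dvd 1" using g0 by (metis is_unit_iff_degree)
qed

lemma bezout_one:
  assumes K: "is_subfield K" and pq: "p \<in> polys_over K" "q \<in> polys_over K" "coprime p q" "p \<noteq> 0"
  obtains u v where "u \<in> polys_over K" "v \<in> polys_over K" "u * p + v * q = 1"
proof -
  obtain u v where uv: "u \<in> polys_over K" "v \<in> polys_over K" "u * p + v * q \<noteq> 0"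
    "u * p + v * q dvd p" "u * p + v * q dvd q"
    using polys_over_bezout[OF K pq(1,2,4)] by blast
  have "u * p + v * q dvd 1" using uv(4,5) pq(3) by (rule coprime_common_divisor[rotated])
  then obtain c where c: "u * p + v * q = [:c:]" "c \<noteq> 0" by (auto simp: poly_dvd_1 elim: degree_eq_zeroE)
  have "coeff (u * p + v * q) 0 \<in> K"
    by (intro polys_over_coeff[OF K] polys_over_add[OF K] polys_over_mult[OF K] uv pq)
  then have cK: "inverse c \<in> K" using c is_subfieldD(6)[OF K] by simp
  have "Polynomial.smult (inverse c) u * p + Polynomial.smult (inverse c) v * q = Polynomial.smult (inverse c) (u * p + v * q)"
    by (simp add: smult_add_right)
  also have "\<dots> = 1" using c by simp
  finally show thesis using that polys_over_smult[OF K cK] uv(1,2) by blast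
qed

lemma coprime_dvd_cancel:
  fixes a b c :: "complex poly"
  assumes "coprime a b" "b \<noteq> 0"
  shows "a dvd c * b \<Longrightarrow> a dvd c" and "b dvd a * c \<Longrightarrow> b dvd c"
proof -
  have sub: "is_subfield UNIV" and all: "\<And>f. f \<in> polys_over UNIV"
    by (simp_all add: is_subfield_def polys_over_def)
  have "coprime b a" using assms(1) by (simp only: coprime_commute[of b a])
  then obtain u v where "u \<in> polys_over UNIV" "v \<in> polys_over UNIV" and uv: "u * b + v * a = 1"
    using bezout_one[OF sub all all _ assms(2)] by metis
  have "u * (c * b) + (v * c) * a = c * (u * b + v * a)" "(u * c) * b + v * (a * c) = c * (u * b + v * a)"
    by (simp_all only: distrib_left mult_ac)
  then have c: "u * (c * b) + (v * c) * a = c" "(u * c) * b + v * (a * c) = c"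
    unfolding uv by simp_all
  show "a dvd c" if "a dvd c * b"
  proof -
    have "a dvd u * (c * b) + (v * c) * a" by (rule dvd_add[OF dvd_mult[OF that] dvd_triv_right])
    then show ?thesis unfolding c(1) .
  qed
  show "b dvd c" if "b dvd a * c"
  proof -
    have "b dvd (u * c) * b + v * (a * c)" by (rule dvd_add[OF dvd_triv_right dvd_mult[OF that]])
    then show ?thesis unfolding c(2) .
  qed
qed

text \<open>The degrees of the two summands are 0 and 1 modulo d, so their leading terms cannot
  cancel. The first claim holds whichever of \<open>p\<close> and \<open>q\<close> has the larger
  degree: one step puts the numerator in front.\<close>

lemma degree_step:
  fixes p q :: "complex poly"
  assumes "d \<ge> 2" "p \<noteq> 0" "q \<noteq> 0"
  shows "degree (p * q ^ (d - 1)) < degree (p ^ d + [:0, 1:] * q ^ d)"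
    "degree q < degree p \<Longrightarrow> degree (p ^ d + [:0, 1:] * q ^ d) = d * degree p"
proof -
  obtain e where e: "d = Suc (Suc e)" using assms(1) by (metis add_2_eq_Suc le_Suc_ex)
  have 1: "degree (p ^ d) = d * degree p" by (simp add: degree_power_eq assms)
  have 2: "degree ([:0, 1:] * q ^ d) = Suc (d * degree q)"
    using assms by (subst degree_mult_eq) (auto simp: degree_power_eq)
  have 3: "degree (p * q ^ (d - 1)) = degree p + (d - 1) * degree q"
    using assms by (simp add: degree_mult_eq degree_power_eq)
  show deg: "degree (p ^ d + [:0, 1:] * q ^ d) = d * degree p" if lt: "degree q < degree p"
  proof -
    have "d * Suc (degree q) \<le> d * degree p" using lt by (intro mult_le_mono2) simp
    then have "Suc (d * degree q) < d * degree p" using assms(1) by simp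
    then show ?thesis using 1 2 by (simp add: degree_add_eq_left)
  qed
  show "degree (p * q ^ (d - 1)) < degree (p ^ d + [:0, 1:] * q ^ d)"
  proof (cases "degree q < degree p")
    case True
    have "(d - 1) * degree q < (d - 1) * degree p" using True assms(1) by simp
    then show ?thesis unfolding deg[OF True] 3 by (simp add: e)
  next
    case False
    then have "d * degree p \<le> d * degree q" by simp
    then have "degree (p ^ d) < degree ([:0, 1:] * q ^ d)" unfolding 1 2 by (rule le_imp_less_Suc)
    then have "degree (p ^ d + [:0, 1:] * q ^ d) = Suc (d * degree q)" using 2 by (simp add: degree_add_eq_right)
    then show ?thesis using 3 False by (simp add: e)
  qed
qed

text \<open>A common root of \<open>A\<close> and \<open>B\<close> is not 0, because A(0) is
  nonzero; it is a root of both forms in \<open>p\<close> and \<open>q\<close>, and away from t = 0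
  these vanish together only where \<open>p\<close> and \<open>q\<close> do.\<close>

lemma coprime_step:
  fixes p q A B :: "complex poly"
  assumes "d \<ge> 2" "coprime p q" "coeff A 0 \<noteq> 0" "B \<noteq> 0"
    and "p ^ d + [:0, 1:] * q ^ d = monom 1 k * A" "p * q ^ (d - 1) = monom 1 k * B"
  shows "coprime A B"
proof (rule no_common_root_coprime[OF assms(4)])
  fix x assume x: "poly A x = 0" "poly B x = 0"
  then have x0: "x \<noteq> 0" using assms(3) by (auto simp: poly_0_coeff_0)
  have "poly (p ^ d + [:0, 1:] * q ^ d) x = 0" "poly (p * q ^ (d - 1)) x = 0"
    unfolding assms(5,6) using x by simp_all
  then have 1: "poly p x ^ d + x * poly q x ^ d = 0" "poly p x * poly q x ^ (d - 1) = 0"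
    by simp_all
  then have "poly p x = 0 \<and> poly q x = 0"
    using x0 assms(1) by (cases "poly p x = 0") (auto simp: power_0_left)
  then show False using coprime_no_common_root[OF assms(2)] by blast
qed

text \<open>Only one factor t can cancel, and this happens exactly if p(0) = 0. Then q(0) is
  nonzero, and the numerator divided by t has the value q(0)^d at 0.\<close>

lemma first_step:
  fixes p q :: "complex poly"
  assumes d: "d \<ge> 2" and pq: "coprime p q" "p \<noteq> 0" "q \<noteq> 0" and K: "is_subfield K" "p \<in> polys_over K" "q \<in> polys_over K"
  obtains A B k where "p ^ d + [:0, 1:] * q ^ d = monom 1 k * A" "p * q ^ (d - 1) = monom 1 k * B"
    "A \<in> polys_over K" "B \<in> polys_over K" "coeff A 0 \<noteq> 0" "B \<noteq> 0" "degree B < degree A" "coprime A B"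
proof -
  have XK: "[:0, 1:] \<in> polys_over K"
    by (intro polys_over_pCons[OF K(1)] polys_over_0[OF K(1)] is_subfieldD[OF K(1)])
  have "\<exists>A B k. p ^ d + [:0, 1:] * q ^ d = monom 1 k * A \<and> p * q ^ (d - 1) = monom 1 k * B \<and>
    A \<in> polys_over K \<and> B \<in> polys_over K \<and> coeff A 0 \<noteq> 0"
  proof (cases "coeff p 0 = 0")
    case False
    have "coeff (p ^ d + [:0, 1:] * q ^ d) 0 \<noteq> 0" using False by (simp add: coeff_0_power)
    moreover have "p ^ d + [:0, 1:] * q ^ d \<in> polys_over K" "p * q ^ (d - 1) \<in> polys_over K"
      by (intro polys_over_add[OF K(1)] polys_over_mult[OF K(1)] polys_over_power[OF K(1)] K XK)+
    ultimately show ?thesis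
      by (intro exI[of _ "p ^ d + [:0, 1:] * q ^ d"] exI[of _ "p * q ^ (d - 1)"] exI[of _ 0]) (simp add: one_pCons)
  next
    case True
    obtain c r where p: "p = pCons c r" by (cases p)
    with True have p: "p = [:0, 1:] * r" by simp
    have rK: "r \<in> polys_over K"
      unfolding polys_over_def using polys_over_coeff[OF K(1,2), of "Suc _"] by (simp add: p)
    have "coeff q 0 \<noteq> 0" using coprime_no_common_root[OF pq(1), of 0] True by (auto simp: poly_0_coeff_0)
    obtain e where e: "d = Suc (Suc e)" using d by (metis add_2_eq_Suc le_Suc_ex)
    define A where "A = [:0, 1:] ^ (d - 1) * r ^ d + q ^ d"
    have "poly A 0 = poly q 0 ^ d" by (simp add: A_def e)
    then have "coeff A 0 \<noteq> 0" using \<open>coeff q 0 \<noteq> 0\<close> by (simp add: poly_0_coeff_0)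
    moreover have "A \<in> polys_over K" "r * q ^ (d - 1) \<in> polys_over K" unfolding A_def
      by (intro polys_over_add[OF K(1)] polys_over_mult[OF K(1)] polys_over_power[OF K(1)] K XK rK)+
    moreover have X1: "monom 1 1 = ([:0, 1:] :: complex poly)" by (simp add: monom_Suc monom_0)
    have "p ^ d + [:0, 1:] * q ^ d = monom 1 1 * A" unfolding X1 A_def p power_mult_distrib e
      by (simp add: distrib_left mult.assoc del: mult_pCons_left)
    moreover have "p * q ^ (d - 1) = monom 1 1 * (r * q ^ (d - 1))" unfolding X1 p by (simp only: mult.assoc)
    ultimately show ?thesis by blast
  qed
  then obtain A B k where AB: "p ^ d + [:0, 1:] * q ^ d = monom 1 k * A" "p * q ^ (d - 1) = monom 1 k * B"
    "A \<in> polys_over K" "B \<in> polys_over K" "coeff A 0 \<noteq> 0" by blast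
  have B0: "B \<noteq> 0"
  proof
    assume "B = 0"
    then have "p * q ^ (d - 1) = 0" using AB(2) by simp
    then show False using pq by simp
  qed
  have A0: "A \<noteq> 0" using AB(5) by auto
  have m0: "monom 1 k \<noteq> (0 :: complex poly)" by simp
  have "degree (monom 1 k * B) < degree (monom 1 k * A)"
    using degree_step(1)[OF d pq(2,3)] unfolding AB(1,2) .
  then have "degree B < degree A" using A0 B0 m0 by (simp add: degree_mult_eq degree_monom_eq)
  moreover have "coprime A B" by (rule coprime_step[OF d pq(1) AB(5) B0 AB(1,2)])
  ultimately show thesis using that AB B0 by blast
qed

section \<open>Degrees and heights of rational functions\<close>

lemma to_fract_power: "to_fract (x ^ n) = to_fract x ^ n"
  by (induction n) (simp_all add: to_fract_mult)

text \<open>\<open>rdeg\<close> is defined by choice, so lowest terms must be unique up to units: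
  cross multiplication and coprimality give divisibility in both directions.\<close>

lemma rdeg_to_fract:
  assumes "coprime a b" "b \<noteq> 0"
  shows "rdeg (to_fract a / to_fract b) = max (degree a) (degree b)"
proof -
  define x where "x = to_fract a / to_fract b"
  have deg: "degree u = degree u'" if "u dvd u'" "u' dvd u" for u u' :: "complex poly"
    using that by (cases "u = 0") (auto intro!: antisym dvd_imp_degree_le)
  have uniq: "n = max (degree a) (degree b)"
    if n: "\<exists>a b. b \<noteq> 0 \<and> coprime a b \<and> x = to_fract a / to_fract b \<and> n = max (degree a) (degree b)" for n
  proof -
    obtain u w where uw: "w \<noteq> 0" "coprime u w" "x = to_fract u / to_fract w" "n = max (degree u) (degree w)"
      using n by blast
    have "to_fract a * to_fract w = to_fract u * to_fract b"
      using uw(1,3) assms(2) unfolding x_def by (simp add: frac_eq_eq)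
    then have eq: "a * w = u * b" by (simp only: to_fract_mult[symmetric] to_fract_eq_iff)
    have "a dvd u * b" "u dvd a * w" "b dvd a * w" "w dvd u * b"
      using eq by (metis dvd_triv_left dvd_triv_right)+
    then have "a dvd u" "u dvd a" "b dvd w" "w dvd b"
      using coprime_dvd_cancel assms uw(1,2) by blast+
    then show ?thesis using deg uw(4) by metis
  qed
  have "\<exists>a' b'. b' \<noteq> 0 \<and> coprime a' b' \<and> x = to_fract a' / to_fract b'
      \<and> max (degree a) (degree b) = max (degree a') (degree b')"
    using assms x_def by blast
  then show ?thesis unfolding rdeg_def x_def[symmetric] by (rule some_equality) (rule uniq)
qed

text \<open>The common factor \<open>k\<close> is a power of t in the first step and 1 in all later
  ones.\<close>

lemma gen_f_map_to_fract:
  assumes "d \<ge> 2" "p \<noteq> 0" "q \<noteq> 0" "k \<noteq> 0"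
    and "p ^ d + [:0, 1:] * q ^ d = k * A" "p * q ^ (d - 1) = k * B"
  shows "gen_f_map d (Some (to_fract p / to_fract q)) = Some (to_fract A / to_fract B)"
proof -
  define P where "P = to_fract p"
  define Q where "Q = to_fract q"
  have PQ: "P \<noteq> 0" "Q \<noteq> 0" using assms by (simp_all add: P_def Q_def)
  obtain e where e: "d = Suc (Suc e)" using assms(1) by (metis add_2_eq_Suc le_Suc_ex)
  have "((P / Q) ^ d + T_var) / (P / Q) = (P ^ d + T_var * Q ^ d) / (P * Q ^ (d - 1))"
    using PQ by (simp add: e field_simps)
  also have "P ^ d + T_var * Q ^ d = to_fract (p ^ d + [:0, 1:] * q ^ d)"
    by (simp only: P_def Q_def T_var_def to_fract_add to_fract_mult to_fract_power)
  also have "P * Q ^ (d - 1) = to_fract (p * q ^ (d - 1))"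
    by (simp only: P_def Q_def to_fract_mult to_fract_power)
  also have "to_fract (p ^ d + [:0, 1:] * q ^ d) / to_fract (p * q ^ (d - 1)) = to_fract A / to_fract B"
    unfolding assms(5,6) to_fract_mult using assms(4) by simp
  finally show ?thesis using PQ by (simp add: P_def Q_def)
qed

lemma gen_canonical_height_eq:
  fixes p q A B :: "complex poly"
  assumes d: "d \<ge> 2" and pq: "coprime p q" "p \<noteq> 0" "q \<noteq> 0"
    and AB: "p ^ d + [:0, 1:] * q ^ d = monom 1 k * A" "p * q ^ (d - 1) = monom 1 k * B"
      "coeff A 0 \<noteq> 0" "B \<noteq> 0" "degree B < degree A" "coprime A B"
  shows "gen_canonical_height d (to_fract p / to_fract q) = degree A / d"
proof -
  define c where "c = to_fract p / to_fract q"
  \<comment> \<open>The shift by one matters: after n + 1 steps the numerator has degree d^n deg A,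
    so the quotients are constant from index 1 on, and the divisor d appears.\<close>
  have it: "\<exists>P Q. (gen_f_map d ^^ Suc n) (Some c) = Some (to_fract P / to_fract Q) \<and> coprime P Q \<and> coeff P 0 \<noteq> 0
      \<and> Q \<noteq> 0 \<and> degree Q < degree P \<and> degree P = d ^ n * degree A" for n
  proof (induction n)
    case 0
    have "gen_f_map d (Some c) = Some (to_fract A / to_fract B)"
      unfolding c_def by (rule gen_f_map_to_fract[OF d pq(2,3) _ AB(1,2)]) simp
    then show ?case using AB by auto
  next
    case (Suc n)
    then obtain P Q where PQ: "(gen_f_map d ^^ Suc n) (Some c) = Some (to_fract P / to_fract Q)" "coprime P Q"
      "coeff P 0 \<noteq> 0" "Q \<noteq> 0" "degree Q < degree P" "degree P = d ^ n * degree A" by blast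
    define P' where "P' = P ^ d + [:0, 1:] * Q ^ d"
    define Q' where "Q' = P * Q ^ (d - 1)"
    have P0: "P \<noteq> 0" using PQ(3) by auto
    have "(gen_f_map d ^^ Suc (Suc n)) (Some c) = gen_f_map d (Some (to_fract P / to_fract Q))"
      using PQ(1) by simp
    also have "\<dots> = Some (to_fract P' / to_fract Q')"
      by (rule gen_f_map_to_fract[OF d P0 PQ(4), of 1]) (simp_all add: P'_def Q'_def)
    finally have 1: "(gen_f_map d ^^ Suc (Suc n)) (Some c) = Some (to_fract P' / to_fract Q')" .
    have 2: "coeff P' 0 \<noteq> 0" using PQ(3) by (simp add: P'_def coeff_0_power)
    have 3: "Q' \<noteq> 0" using P0 PQ(4) by (simp add: Q'_def)
    have 4: "coprime P' Q'"
      by (rule coprime_step[OF d PQ(2) 2 3, of 0]) (simp_all add: P'_def Q'_def one_pCons monom_0)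
    have "degree Q' < degree P'" "degree P' = d * degree P"
      unfolding P'_def Q'_def using degree_step[OF d P0 PQ(4)] PQ(5) by auto
    then show ?case using 1 2 3 4 PQ(6) by (intro exI[of _ P'] exI[of _ Q']) (simp add: mult.assoc)
  qed
  have "real (rdeg_P1 ((gen_f_map d ^^ Suc n) (Some c))) / real d ^ Suc n = degree A / d" for n
  proof -
    obtain P Q where PQ: "(gen_f_map d ^^ Suc n) (Some c) = Some (to_fract P / to_fract Q)" "coprime P Q"
      "Q \<noteq> 0" "degree Q < degree P" "degree P = d ^ n * degree A" using it[of n] by blast
    have "rdeg_P1 ((gen_f_map d ^^ Suc n) (Some c)) = d ^ n * degree A"
      unfolding PQ(1) using rdeg_to_fract[OF PQ(2,3)] PQ(4,5) by simp
    then show ?thesis using d by simp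
  qed
  then have "(\<lambda>n. real (rdeg_P1 ((gen_f_map d ^^ Suc n) (Some c))) / real d ^ Suc n) \<longlonglongrightarrow> degree A / d"
    by simp
  then have "(\<lambda>n. real (rdeg_P1 ((gen_f_map d ^^ n) (Some c))) / real d ^ n) \<longlonglongrightarrow> degree A / d"
    by (rule LIMSEQ_imp_Suc)
  then show ?thesis unfolding gen_canonical_height_def c_def by (rule limI)
qed

text \<open>The pair (A, B) describes f(c) rather than c, so the estimate for its orbit has to be
  divided by d. For nonzero lam a cancelled power of t is a nonzero number and does not change the
  projective point.\<close>

lemma canonical_height_bound:
  fixes p q A B :: "complex poly"
  assumes d: "d \<ge> 2" and pq: "coprime p q" "p \<noteq> 0" "q \<noteq> 0"
    and AB: "p ^ d + [:0, 1:] * q ^ d = monom 1 k * A" "p * q ^ (d - 1) = monom 1 k * B"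
      "A \<in> polys_over {x. algebraic x}" "B \<in> polys_over {x. algebraic x}"
      "coeff A 0 \<noteq> 0" "degree B < degree A" "coprime A B"
  shows "\<exists>C. \<forall>lam. algebraic lam \<longrightarrow> lam \<noteq> 0 \<longrightarrow>
    \<bar>canonical_height d lam (rat_eval p q lam) - degree A / d * weil_height lam\<bar> \<le> C"
proof -
  have A0: "A \<noteq> 0" using AB(5) by auto
  obtain U V where UV: "U \<in> polys_over {x. algebraic x}" "V \<in> polys_over {x. algebraic x}" "U * A + V * B = 1"
    using bezout_one[OF is_subfield_algebraic AB(3,4,7) A0] .
  obtain C where C: "\<And>lam a b n. algebraic lam \<Longrightarrow> lam \<noteq> 0 \<Longrightarrow> a 0 = poly A lam \<Longrightarrow> b 0 = poly B lam \<Longrightarrow>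
     (\<forall>n. a (Suc n) = a n ^ d + lam * b n ^ d) \<Longrightarrow> (\<forall>n. b (Suc n) = a n * b n ^ (d - 1)) \<Longrightarrow>
     \<bar>height_P1 (proj_point (a n) (b n)) / real d ^ n - real (degree A) * weil_height lam\<bar> \<le> C"
    using height_orbit_bound[OF d AB(3,4) UV(1,2) AB(6) UV(3) AB(5)] by blast
  have "\<bar>canonical_height d lam (rat_eval p q lam) - degree A / d * weil_height lam\<bar> \<le> C / d"
    if lam: "algebraic lam" "lam \<noteq> 0" for lam
  proof -
    define st where "st = (\<lambda>(x, y). (x ^ d + lam * y ^ d, x * y ^ (d - 1)))"
    define ab where "ab n = (st ^^ n) (poly A lam, poly B lam)" for n
    define a where "a n = fst (ab n)" for n
    define b where "b n = snd (ab n)" for n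
    have ab: "a 0 = poly A lam" "b 0 = poly B lam" "\<And>n. a (Suc n) = a n ^ d + lam * b n ^ d"
      "\<And>n. b (Suc n) = a n * b n ^ (d - 1)"
      by (simp_all add: a_def b_def ab_def st_def case_prod_beta)
    have ab0: "a 0 \<noteq> 0 \<or> b 0 \<noteq> 0"
      using coprime_no_common_root[OF AB(7)] ab(1,2) by metis
    have alg: "algebraic (a 0)" "algebraic (b 0)"
      using polys_over_poly[OF is_subfield_algebraic AB(3), of lam] polys_over_poly[OF is_subfield_algebraic AB(4), of lam] lam
      by (simp_all add: ab)
    have start: "f_map d lam (rat_eval p q lam) = proj_point (a 0) (b 0)"
    proof -
      have "rat_eval p q lam = proj_point (poly p lam) (poly q lam)" by (simp add: rat_eval_def proj_point_def)
      moreover have "poly p lam \<noteq> 0 \<or> poly q lam \<noteq> 0" using coprime_no_common_root[OF pq(1)] by blast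
      ultimately have "f_map d lam (rat_eval p q lam)
          = proj_point (poly p lam ^ d + lam * poly q lam ^ d) (poly p lam * poly q lam ^ (d - 1))"
        using f_map_proj_point[OF d lam(2)] by simp
      also have "poly p lam ^ d + lam * poly q lam ^ d = lam ^ k * a 0"
        using arg_cong[OF AB(1), of "\<lambda>f. poly f lam"] by (simp add: poly_monom ab)
      also have "poly p lam * poly q lam ^ (d - 1) = lam ^ k * b 0"
        using arg_cong[OF AB(2), of "\<lambda>f. poly f lam"] by (simp add: poly_monom ab)
      finally show ?thesis using proj_point_scale[of "lam ^ k"] lam(2) by simp
    qed
    have iter: "(f_map d lam ^^ Suc n) (rat_eval p q lam) = proj_point (a n) (b n)" for n
      using f_map_funpow[OF d lam(2) ab0 ab(3,4)] start by (simp add: funpow_Suc_right del: funpow.simps)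
    obtain l where l: "(\<lambda>n. height_P1 (proj_point (a n) (b n)) / real d ^ n) \<longlonglongrightarrow> l"
      using height_convergent[OF d lam(2) ab0 ab(3,4) lam(1) alg] by (auto simp: convergent_def)
    have "\<bar>l - real (degree A) * weil_height lam\<bar> \<le> C"
    proof (rule LIMSEQ_le_const2)
      show "(\<lambda>n. \<bar>height_P1 (proj_point (a n) (b n)) / real d ^ n - real (degree A) * weil_height lam\<bar>)
          \<longlonglongrightarrow> \<bar>l - real (degree A) * weil_height lam\<bar>"
        by (intro tendsto_intros l)
      show "\<exists>N. \<forall>n\<ge>N. \<bar>height_P1 (proj_point (a n) (b n)) / real d ^ n - real (degree A) * weil_height lam\<bar> \<le> C"
        using C[where a = a and b = b, OF lam ab(1,2)] ab(3,4) by blast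
    qed
    moreover have "canonical_height d lam (rat_eval p q lam) = l / d"
    proof -
      have "(\<lambda>n. height_P1 (proj_point (a n) (b n)) / real d ^ n / d) \<longlonglongrightarrow> l / d"
        using d by (intro tendsto_divide l tendsto_const) auto
      then have "(\<lambda>n. height_P1 ((f_map d lam ^^ Suc n) (rat_eval p q lam)) / real d ^ Suc n) \<longlonglongrightarrow> l / d"
        unfolding iter by (simp add: mult.commute)
      then have "(\<lambda>n. height_P1 ((f_map d lam ^^ n) (rat_eval p q lam)) / real d ^ n) \<longlonglongrightarrow> l / d"
        by (rule LIMSEQ_imp_Suc)
      then show ?thesis unfolding canonical_height_def by (rule limI)
    qed
    moreover have "l / d - degree A / d * weil_height lam = (l - degree A * weil_height lam) / d"
      by (simp add: diff_divide_distrib)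
    ultimately show ?thesis using d by (simp add: abs_divide divide_right_mono)
  qed
  then show ?thesis by blast
qed

lemma f_map_funpow_None: "(f_map d lam ^^ n) None = None"
  by (induction n) auto

lemma gen_f_map_funpow_None: "(gen_f_map d ^^ n) None = None"
  by (induction n) auto

theorem theorem1p1:
  fixes d :: nat and p q :: "complex poly"
  assumes "d \<ge> 2"
    and "q \<noteq> 0"
    and "coprime p q"
    and "\<forall>i. algebraic (coeff p i)"
    and "\<forall>i. algebraic (coeff q i)"
  shows "\<exists>C. \<forall>lam. algebraic lam \<longrightarrow>
           \<bar>canonical_height d lam (rat_eval p q lam)
             - gen_canonical_height d (to_fract p / to_fract q) * weil_height lam\<bar> \<le> C"
proof -
  let ?F = "\<lambda>lam. \<bar>canonical_height d lam (rat_eval p q lam)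
             - gen_canonical_height d (to_fract p / to_fract q) * weil_height lam\<bar>"
  have "\<exists>C. \<forall>lam. algebraic lam \<longrightarrow> lam \<noteq> 0 \<longrightarrow> ?F lam \<le> C"
  proof (cases "p = 0")
    case False
    have pq: "p \<in> polys_over {x. algebraic x}" "q \<in> polys_over {x. algebraic x}"
      using assms(4,5) by (auto simp: polys_over_def)
    obtain A B k where AB: "p ^ d + [:0, 1:] * q ^ d = monom 1 k * A" "p * q ^ (d - 1) = monom 1 k * B"
      "A \<in> polys_over {x. algebraic x}" "B \<in> polys_over {x. algebraic x}" "coeff A 0 \<noteq> 0" "B \<noteq> 0"
      "degree B < degree A" "coprime A B"
      using first_step[OF assms(1,3) False assms(2) is_subfield_algebraic pq] .
    show ?thesis
      unfolding gen_canonical_height_eq[OF assms(1,3) False assms(2) AB(1,2,5-8)]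
      by (rule canonical_height_bound[OF assms(1,3) False assms(2) AB(1-5,7,8)])
  next
    \<comment> \<open>For c = 0 the first step leads to the fixed point infinity, so both canonical
      heights vanish.\<close>
    case True
    have gen: "gen_canonical_height d (to_fract p / to_fract q) = 0"
    proof -
      have "(gen_f_map d ^^ Suc n) (Some (to_fract p / to_fract q)) = None" for n
        using True gen_f_map_funpow_None by (simp add: funpow_Suc_right del: funpow.simps)
      then have "(\<lambda>n. real (rdeg_P1 ((gen_f_map d ^^ Suc n) (Some (to_fract p / to_fract q)))) / real d ^ Suc n) \<longlonglongrightarrow> 0"
        by simp
      then show ?thesis unfolding gen_canonical_height_def by (intro limI) (rule LIMSEQ_imp_Suc)
    qed
    have "canonical_height d lam (rat_eval p q lam) = 0" if "lam \<noteq> 0" for lam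
    proof -
      have "poly q lam \<noteq> 0" using coprime_no_common_root[OF assms(3)] True by auto
      then have "(f_map d lam ^^ Suc n) (rat_eval p q lam) = None" for n
        using True that f_map_funpow_None by (simp add: rat_eval_def funpow_Suc_right del: funpow.simps)
      then have "(\<lambda>n. height_P1 ((f_map d lam ^^ Suc n) (rat_eval p q lam)) / real d ^ Suc n) \<longlonglongrightarrow> 0"
        by simp
      then show ?thesis unfolding canonical_height_def by (intro limI) (rule LIMSEQ_imp_Suc)
    qed
    then show ?thesis using gen by (intro exI[of _ 0]) simp
  qed
  then obtain C where C: "\<And>lam. algebraic lam \<Longrightarrow> lam \<noteq> 0 \<Longrightarrow> ?F lam \<le> C" by blast
  \<comment> \<open>The parameter 0 contributes one number, which is taken into the maximum.\<close>
  have "?F lam \<le> max C (?F 0)" if "algebraic lam" for lam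
    using C[OF that] by (cases "lam = 0") auto
  then show ?thesis by blast
qed

end
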